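(* Let $0<\alpha<1$ and $n-1<d<n$ be such that $n\alpha>d$, and let $U\subset\mathbb{R}^n$ be open and bounded with $\dim_{\mathrm{box}}\partial U=d$. Furthermore, let $u\in C^{0,\alpha}(U;\mathbb{R}^n)$. Then $\deg(u,U,\cdot)\in L^p(\mathbb{R}^n)$ for all $1\le p<\frac{n\alpha}{d}$, and for all $p\in(1,\frac{n\alpha}{d})$ there exists a constant $C=C(n,U,\alpha,d,p)$ (independent of $u$) such that $$\|\deg(u,U,\cdot)\|_{L^p(\mathbb{R}^n)}\le C\,\|u\|_{C^{0,\alpha}(U;\mathbb{R}^n)}^{n/p}.$$
   Context: For $A\subset\mathbb{R}^n$, $[f]_{C^{0,\alpha}(A)}=\sup_{x,y\in A,\,x\ne y}\frac{|f(x)-f(y)|}{|x-y|^\alpha}$ and $\|f\|_{C^{0,\alpha}(A)}=\sup_{A}|f|+[f]_{C^{0,\alpha}(A)}$; $C^{0,\alpha}(A)$ is the space of functions for which this norm is finite. A function $u\in C^{0,\alpha}(U;\mathbb{R}^n)$ is identified with its unique continuous extension to $\overline U$. Box dimension: for a bounded set $E\subset\mathbb{R}^n$, let $N_r(E)$ be the number of $n$-dimensional boxes (cubes) of side length $r$ required to cover $E$; then $\dim_{\mathrm{box}}E=\lim_{r\to0}\frac{\log N_r(E)}{-\log r}$, if this limit exists. The assumption $\dim_{\mathrm{box}}\partial U=d$ means the limit exists and equals $d$. Brouwer degree: for $U\subset\mathbb{R}^n$ bounded and open and $u\in C^\infty(\overline U;\mathbb{R}^n)$, $y\in\mathbb{R}^n\setminus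 u(\partial U)$, $\deg(u,U,y)=\int_U u^*(\mu)$, where $\mu$ is any smooth $n$-form with support in the connected component of $\mathbb{R}^n\setminus u(\partial U)$ containing $y$ and $\int_{\mathbb{R}^n}\mu=1$; for $u\in C^0(\overline U;\mathbb{R}^n)$ it is defined by approximation. The function $\deg(u,U,\cdot)$ is defined on $\mathbb{R}^n\setminus u(\partial U)$; the assertion that it lies in $L^p(\mathbb{R}^n)$ includes that it is defined almost everywhere. *)

theory Defs
  imports "HOL-Analysis.Analysis"
begin

subsection \<open>Hoelder spaces\<close>

text \<open>The norms take values in \<^typ>\<open>ennreal\<close>, so that the suprema are genuine even for
  functions outside the space, and a supremum over an empty set is 0.\<close>

definition holder_seminorm ::
    "real \<Rightarrow> 'a::metric_space set \<Rightarrow> ('a \<Rightarrow> 'b::real_normed_vector) \<Rightarrow> ennreal" where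
  "holder_seminorm \<alpha> A f =
     (SUP (x, y)\<in>{(x, y). x \<in> A \<and> y \<in> A \<and> x \<noteq> y}. ennreal (norm (f x - f y) / dist x y powr \<alpha>))"

definition holder_norm ::
    "real \<Rightarrow> 'a::metric_space set \<Rightarrow> ('a \<Rightarrow> 'b::real_normed_vector) \<Rightarrow> ennreal" where
  "holder_norm \<alpha> A f = (SUP x\<in>A. ennreal (norm (f x))) + holder_seminorm \<alpha> A f"

definition holder_space ::
    "real \<Rightarrow> 'a::metric_space set \<Rightarrow> ('a \<Rightarrow> 'b::real_normed_vector) set" where
  "holder_space \<alpha> A = {f. holder_norm \<alpha> A f < \<infinity>}"

text \<open>The continuous extension of \<open>u\<close> from \<open>U\<close> to its closure; the values off the closure
  are irrelevant.\<close>

definition cont_ext ::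
    "'a::topological_space set \<Rightarrow> ('a \<Rightarrow> 'b::t2_space) \<Rightarrow> 'a \<Rightarrow> 'b" where
  "cont_ext U u x = (if x \<in> U then u x else Lim (at x within U) u)"

subsection \<open>Box dimension\<close>

text \<open>The least number of closed axis-parallel cubes of side length \<open>r\<close> needed to cover \<open>E\<close>;
  the set \<open>P\<close> consists of the lower corners of the cubes.\<close>

definition covering_number :: "real \<Rightarrow> 'a::euclidean_space set \<Rightarrow> nat" where
  "covering_number r E =
     (LEAST k. \<exists>P. finite P \<and> card P = k \<and> E \<subseteq> (\<Union>a\<in>P. cbox a (a + r *\<^sub>R One)))"

definition has_box_dim :: "'a::euclidean_space set \<Rightarrow> real \<Rightarrow> bool" where
  "has_box_dim E d \<longleftrightarrow>
     ((\<lambda>r. ln (real (covering_number r E)) / (- ln r)) \<longlongrightarrow> d) (at_right 0)"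

subsection \<open>Smooth functions\<close>

text \<open>Intended for open \<open>S\<close>, because the derivative is taken \<open>at x\<close>, not \<open>at x within S\<close>.\<close>

fun Ck_on :: "nat \<Rightarrow> 'a::real_normed_vector set \<Rightarrow> ('a \<Rightarrow> 'b::real_normed_vector) \<Rightarrow> bool" where
  "Ck_on 0 S f \<longleftrightarrow> continuous_on S f"
| "Ck_on (Suc k) S f \<longleftrightarrow>
     (\<forall>x\<in>S. f differentiable (at x)) \<and> (\<forall>v. Ck_on k S (\<lambda>x. frechet_derivative f (at x) v))"

definition smooth_on :: "'a::real_normed_vector set \<Rightarrow> ('a \<Rightarrow> 'b::real_normed_vector) \<Rightarrow> bool" where
  "smooth_on S f \<longleftrightarrow> (\<forall>k. Ck_on k S f)"

text \<open>Smooth up to the boundary: smooth on an open neighbourhood of the closure.\<close>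

definition smooth_on_closure ::
    "'a::real_normed_vector set \<Rightarrow> ('a \<Rightarrow> 'b::real_normed_vector) \<Rightarrow> bool" where
  "smooth_on_closure U f \<longleftrightarrow> (\<exists>W. open W \<and> closure U \<subseteq> W \<and> smooth_on W f)"

subsection \<open>Brouwer degree\<close>

text \<open>A smooth \<open>n\<close>-form on \<open>\<real>\<^sup>n\<close> is \<open>\<phi> dy\<^sub>1 \<and> \<dots> \<and> dy\<^sub>n\<close> with a smooth density \<open>\<phi>\<close>. The following
  says that its support lies in the open set \<open>V\<close> and that its integral is 1.\<close>

definition unit_form_in :: "(real ^ 'n) set \<Rightarrow> (real ^ 'n \<Rightarrow> real) \<Rightarrow> bool" where
  "unit_form_in V \<phi> \<longleftrightarrow>
     smooth_on UNIV \<phi> \<and> closure {y. \<phi> y \<noteq> 0} \<subseteq> V \<and>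
     integrable lborel \<phi> \<and> (LINT y|lborel. \<phi> y) = 1"

text \<open>The pullback under \<open>u\<close> of the form with density \<open>\<phi>\<close> has density
  \<open>\<phi> (u x) * det (Du x)\<close>.\<close>

definition smooth_degree ::
    "(real ^ 'n \<Rightarrow> real ^ 'n) \<Rightarrow> (real ^ 'n) set \<Rightarrow> real ^ 'n \<Rightarrow> real" where
  "smooth_degree u U y =
     (THE D. \<forall>\<phi>. unit_form_in (connected_component_set (- (u ` frontier U)) y) \<phi> \<longrightarrow>
        (LINT x:U|lborel. \<phi> (u x) * det (jacobian u (at x))) = D)"

text \<open>For \<open>u\<close> continuous on the closure of \<open>U\<close>: the common limit of the degrees of all smooth
  uniform approximations. Meaningful for \<open>y \<notin> u ` frontier U\<close> only.\<close>

definition brouwer_degree ::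
    "(real ^ 'n \<Rightarrow> real ^ 'n) \<Rightarrow> (real ^ 'n) set \<Rightarrow> real ^ 'n \<Rightarrow> real" where
  "brouwer_degree u U y =
     (THE D. \<forall>v. (\<forall>k. smooth_on_closure U (v k)) \<and> uniform_limit (closure U) v u sequentially \<longrightarrow>
        (\<lambda>k. smooth_degree (v k) U y) \<longlonglongrightarrow> D)"

subsection \<open>Lebesgue spaces\<close>

text \<open>For a function \<open>f\<close> that is defined on \<open>D\<close> only; membership in \<open>L\<^sup>p\<close> of the whole space
  includes that \<open>f\<close> is defined almost everywhere.\<close>

definition in_Lp :: "real \<Rightarrow> 'a::euclidean_space set \<Rightarrow> ('a \<Rightarrow> real) \<Rightarrow> bool" where
  "in_Lp p D f \<longleftrightarrow>
     - D \<in> null_sets lebesgue \<and> f \<in> borel_measurable (lebesgue_on D) \<and>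
     integrable (lebesgue_on D) (\<lambda>x. \<bar>f x\<bar> powr p)"

definition Lp_norm :: "real \<Rightarrow> 'a::euclidean_space set \<Rightarrow> ('a \<Rightarrow> real) \<Rightarrow> real" where
  "Lp_norm p D f = (LINT x|lebesgue_on D. \<bar>f x\<bar> powr p) powr (1 / p)"

end

theory Submission
  imports Defs
begin

text \<open>For a test function \<open>\<phi>\<close> supported off \<open>u(\<partial>U)\<close>, the integral of \<open>\<phi>\<close> against the degree
  equals the integral of \<open>\<phi>(w) det Dw\<close> over \<open>U\<close>, for every \<open>C^1\<close> map \<open>w\<close> that is close to \<open>u\<close> on the
  boundary. We take \<open>w\<close> to be a Whitney-type interpolation of \<open>u\<close>, which at distance about \<open>r = 2^-k\<close>
  from \<open>\<partial>U\<close> agrees with a spline approximation at scale \<open>r\<close>, so that \<open>|Dw| \<le> C r^(\<alpha>-1)\<close> there. The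
  layer of points at this distance has measure at most \<open>C N_r(\<partial>U) r^n\<close>. Comparing \<open>w\<close> on this layer
  with its translates of length up to \<open>r^\<alpha>\<close> and averaging over the directions of translation, one
  bounds the contribution of the layer by \<open>C N_r(\<partial>U) r^(n\<alpha>/p)\<close> times the \<open>L^q\<close> norm of \<open>\<phi>\<close>, where
  \<open>1/p + 1/q = 1\<close>; these bounds are summable because \<open>d < n\<alpha>/p\<close>. Since the degree is locally constant,
  \<open>\<phi> = sgn(deg) |deg|^(p-1)\<close>, cut off near \<open>u(\<partial>U)\<close>, is an admissible test function, and duality gives
  the \<open>L^p\<close> bound.\<close>

subsection \<open>Continuously differentiable functions\<close>

definition C1_scalar :: "(real ^ 'n) set \<Rightarrow> (real ^ 'n \<Rightarrow> real) \<Rightarrow> (real ^ 'n \<Rightarrow> real ^ 'n) \<Rightarrow> bool" where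
  "C1_scalar S f g \<longleftrightarrow> (\<forall>x\<in>S. (f has_derivative (\<lambda>h. g x \<bullet> h)) (at x)) \<and> continuous_on S g"

definition C1_map :: "(real ^ 'n) set \<Rightarrow> (real ^ 'n \<Rightarrow> real ^ 'n) \<Rightarrow> (real ^ 'n \<Rightarrow> real ^ 'n ^ 'n) \<Rightarrow> bool" where
  "C1_map S w A \<longleftrightarrow> (\<forall>i. C1_scalar S (\<lambda>x. w x $ i) (\<lambda>x. A x $ i))"

lemma C1_scalar_cong:
  assumes "C1_scalar S f g" "open S" "\<And>x. x \<in> S \<Longrightarrow> f x = f' x" "\<And>x. x \<in> S \<Longrightarrow> g x = g' x"
  shows "C1_scalar S f' g'"
proof -
  have "(f' has_derivative (\<lambda>h. g' x \<bullet> h)) (at x)" if "x \<in> S" for x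
    using has_derivative_transform_within_open[of f "\<lambda>h. g x \<bullet> h" x UNIV S f'] assms that
    unfolding C1_scalar_def by auto
  then show ?thesis using assms unfolding C1_scalar_def by (simp cong: continuous_on_cong)
qed

lemma C1_scalar_subset: "C1_scalar S f g \<Longrightarrow> T \<subseteq> S \<Longrightarrow> C1_scalar T f g"
  unfolding C1_scalar_def using continuous_on_subset by blast

lemma C1_scalar_Un: "C1_scalar S f g \<Longrightarrow> C1_scalar T f g \<Longrightarrow> open S \<Longrightarrow> open T \<Longrightarrow> C1_scalar (S \<union> T) f g"
  unfolding C1_scalar_def using continuous_on_open_Un by blast

lemma C1_scalar_continuous_on: "C1_scalar S f g \<Longrightarrow> continuous_on S f"
  unfolding C1_scalar_def
  by (meson has_derivative_continuous continuous_at_imp_continuous_on)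

lemma C1_scalarI:
  assumes "\<And>x. x \<in> S \<Longrightarrow> (f has_derivative f' x) (at x)" "\<And>x h. x \<in> S \<Longrightarrow> f' x h = g x \<bullet> h"
    "continuous_on S g"
  shows "C1_scalar S f g"
proof -
  have "f' x = (\<lambda>h. g x \<bullet> h)" if "x \<in> S" for x using assms(2) that by auto
  then show ?thesis using assms(1,3) unfolding C1_scalar_def by metis
qed

lemma C1_scalarD: "C1_scalar S f g \<Longrightarrow> x \<in> S \<Longrightarrow> (f has_derivative (\<lambda>h. g x \<bullet> h)) (at x)"
  "C1_scalar S f g \<Longrightarrow> continuous_on S g"
  unfolding C1_scalar_def by blast+

lemma C1_scalar_const: "C1_scalar S (\<lambda>x. c) (\<lambda>x. 0)"
  by (rule C1_scalarI[where f'="\<lambda>x h. 0"]) auto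

lemma C1_scalar_add:
  "C1_scalar S f g \<Longrightarrow> C1_scalar S f' g' \<Longrightarrow> C1_scalar S (\<lambda>x. f x + f' x) (\<lambda>x. g x + g' x)"
  by (rule C1_scalarI[where f'="\<lambda>x h. g x \<bullet> h + g' x \<bullet> h"])
    (auto simp: inner_add_left C1_scalarD intro!: has_derivative_add continuous_on_add)

lemma C1_scalar_diff:
  "C1_scalar S f g \<Longrightarrow> C1_scalar S f' g' \<Longrightarrow> C1_scalar S (\<lambda>x. f x - f' x) (\<lambda>x. g x - g' x)"
  by (rule C1_scalarI[where f'="\<lambda>x h. g x \<bullet> h - g' x \<bullet> h"])
    (auto simp: inner_diff_left C1_scalarD intro!: has_derivative_diff continuous_on_diff)

lemma C1_scalar_sum:
  "(\<And>i. i \<in> I \<Longrightarrow> C1_scalar S (f i) (g i)) \<Longrightarrow> C1_scalar S (\<lambda>x. \<Sum>i\<in>I. f i x) (\<lambda>x. \<Sum>i\<in>I. g i x)"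
  by (rule C1_scalarI, rule has_derivative_sum)
    (auto simp: inner_sum_left intro!: C1_scalarD continuous_on_sum)

lemma C1_scalar_mult:
  assumes "C1_scalar S f g" "C1_scalar S f' g'"
  shows "C1_scalar S (\<lambda>x. f x * f' x) (\<lambda>x. f x *\<^sub>R g' x + f' x *\<^sub>R g x)"
proof -
  have "((\<lambda>x. f x * f' x) has_derivative (\<lambda>h. (f x *\<^sub>R g' x + f' x *\<^sub>R g x) \<bullet> h)) (at x)" if "x \<in> S" for x
  proof -
    have "((\<lambda>x. f x * f' x) has_derivative (\<lambda>h. f x * (g' x \<bullet> h) + (g x \<bullet> h) * f' x)) (at x)"
      by (rule has_derivative_mult) (use assms that in \<open>auto simp: C1_scalar_def\<close>)
    then show ?thesis by (simp add: inner_add_left mult.commute)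
  qed
  then show ?thesis using assms C1_scalar_continuous_on[OF assms(1)] C1_scalar_continuous_on[OF assms(2)]
    unfolding C1_scalar_def by (auto intro!: continuous_intros)
qed

lemma C1_scalar_cmult: "C1_scalar S f g \<Longrightarrow> C1_scalar S (\<lambda>x. c * f x) (\<lambda>x. c *\<^sub>R g x)"
  using C1_scalar_mult[OF C1_scalar_const[of S c]] by simp

lemma C1_map_continuous_on: assumes "C1_map S w A" shows "continuous_on S w" "continuous_on S A"
proof -
  have c: "C1_scalar S (\<lambda>x. w x $ i) (\<lambda>x. A x $ i)" for i
    using assms unfolding C1_map_def by blast
  have "continuous_on S (\<lambda>x. w x $ i)" "continuous_on S (\<lambda>x. A x $ i)" for i
    using C1_scalar_continuous_on[OF c] c unfolding C1_scalar_def by blast+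
  then show "continuous_on S w" "continuous_on S A"
    using continuous_on_vec_lambda[of S "\<lambda>i x. w x $ i"] continuous_on_vec_lambda[of S "\<lambda>i x. A x $ i"] by auto
qed

lemma C1_map_has_derivative:
  fixes w :: "real ^ 'n \<Rightarrow> real ^ 'n"
  assumes "C1_map S w A" "x \<in> S" shows "(w has_derivative (\<lambda>h. A x *v h)) (at x)"
proof (subst has_derivative_componentwise_within, safe)
  fix b :: "real ^ 'n" assume "b \<in> Basis"
  then obtain i where b: "b = axis i 1" by (auto simp: Basis_vec_def)
  have "((\<lambda>x. w x $ i) has_derivative (\<lambda>h. A x $ i \<bullet> h)) (at x)"
    using assms unfolding C1_map_def C1_scalar_def by blast
  then show "((\<lambda>x. w x \<bullet> b) has_derivative (\<lambda>h. (A x *v h) \<bullet> b)) (at x)"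
    unfolding b by (simp add: inner_axis matrix_vector_mul_component)
qed

lemma C1_mapI_has_derivative:
  assumes "\<And>x. x \<in> S \<Longrightarrow> (w has_derivative (\<lambda>h. A x *v h)) (at x)" "continuous_on S A"
  shows "C1_map S w A"
  unfolding C1_map_def C1_scalar_def
proof (intro allI conjI ballI)
  fix i x assume "x \<in> S"
  then have "((\<lambda>x. w x $ i) has_derivative (\<lambda>h. (A x *v h) $ i)) (at x)"
    by (intro bounded_linear.has_derivative[OF bounded_linear_vec_nth] assms)
  then show "((\<lambda>x. w x $ i) has_derivative (\<lambda>h. A x $ i \<bullet> h)) (at x)"
    by (simp add: matrix_vector_mul_component)
qed (use assms in \<open>auto intro!: continuous_intros\<close>)

lemma C1_map_subset: "C1_map S f g \<Longrightarrow> T \<subseteq> S \<Longrightarrow> C1_map T f g"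
  unfolding C1_map_def using C1_scalar_subset by blast

lemma C1_map_add:
  "C1_map S f g \<Longrightarrow> C1_map S f' g' \<Longrightarrow> C1_map S (\<lambda>x. f x + f' x) (\<lambda>x. g x + g' x)"
  unfolding C1_map_def by (simp add: C1_scalar_add)

lemma C1_map_diff:
  "C1_map S f g \<Longrightarrow> C1_map S f' g' \<Longrightarrow> C1_map S (\<lambda>x. f x - f' x) (\<lambda>x. g x - g' x)"
  unfolding C1_map_def by (simp add: C1_scalar_diff)

lemma C1_map_const: "C1_map S (\<lambda>x. c) (\<lambda>x. 0)"
  unfolding C1_map_def by (simp add: C1_scalar_const)

lemma C1_map_scaleR_const: "C1_map S f g \<Longrightarrow> C1_map S (\<lambda>x. c *\<^sub>R f x) (\<lambda>x. c *\<^sub>R g x)"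
  unfolding C1_map_def by (simp add: C1_scalar_cmult)

lemma C1_scalar_compose:
  assumes f: "C1_scalar T f g" and w: "C1_map S w A" and sub: "w ` S \<subseteq> T"
  shows "C1_scalar S (\<lambda>x. f (w x)) (\<lambda>x. \<Sum>i\<in>UNIV. (g (w x) $ i) *\<^sub>R A x $ i)"
proof -
  have "((\<lambda>x. f (w x)) has_derivative (\<lambda>h. (\<Sum>i\<in>UNIV. (g (w x) $ i) *\<^sub>R A x $ i) \<bullet> h)) (at x)" if "x \<in> S" for x
  proof -
    have "((\<lambda>x. f (w x)) has_derivative (\<lambda>h. g (w x) \<bullet> (A x *v h))) (at x)"
      by (rule has_derivative_compose[OF C1_map_has_derivative[OF w that]])
        (use f sub that in \<open>auto simp: C1_scalar_def\<close>)
    moreover have "g (w x) \<bullet> (A x *v h) = (\<Sum>i\<in>UNIV. (g (w x) $ i) *\<^sub>R A x $ i) \<bullet> h" for h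
      by (subst inner_vec_def) (simp add: inner_sum_left matrix_vector_mul_component)
    ultimately show ?thesis by simp
  qed
  moreover have "continuous_on S (\<lambda>x. g (w x))"
    using continuous_on_compose2[of T g S w] f sub C1_map_continuous_on(1)[OF w] unfolding C1_scalar_def by auto
  ultimately show ?thesis using C1_map_continuous_on(2)[OF w] unfolding C1_scalar_def
    by (auto intro!: continuous_intros)
qed

lemma C1_scalar_eq0_grad:
  assumes "C1_scalar UNIV f g" "closed K" "\<And>x. x \<notin> K \<Longrightarrow> f x = 0" "x \<notin> K" shows "g x = 0"
proof -
  have "(f has_derivative (\<lambda>h. g x \<bullet> h)) (at x)" using assms unfolding C1_scalar_def by auto
  moreover have "(f has_derivative (\<lambda>h. 0)) (at x)"
    by (rule has_derivative_transform_within_open[where s="-K" and f="\<lambda>x. 0"]) (use assms in auto)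
  ultimately have "(\<lambda>h. g x \<bullet> h) = (\<lambda>h. 0)" by (rule has_derivative_unique)
  then have "g x \<bullet> g x = 0" by metis
  then show ?thesis by simp
qed

lemma C1_scalar_extend:
  assumes t: "C1_scalar UNIV \<theta> \<theta>'" "closed K" "K \<subseteq> U" "open U" "\<And>x. x \<notin> K \<Longrightarrow> \<theta> x = 0"
    and f: "C1_scalar U f g"
  shows "C1_scalar UNIV (\<lambda>x. \<theta> x * f x) (\<lambda>x. \<theta> x *\<^sub>R g x + f x *\<^sub>R \<theta>' x)"
proof -
  have "C1_scalar (U \<union> -K) (\<lambda>x. \<theta> x * f x) (\<lambda>x. \<theta> x *\<^sub>R g x + f x *\<^sub>R \<theta>' x)"
  proof (rule C1_scalar_Un)
    show "C1_scalar U (\<lambda>x. \<theta> x * f x) (\<lambda>x. \<theta> x *\<^sub>R g x + f x *\<^sub>R \<theta>' x)"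
      by (rule C1_scalar_mult[OF C1_scalar_subset[OF t(1)] f]) auto
    show "C1_scalar (-K) (\<lambda>x. \<theta> x * f x) (\<lambda>x. \<theta> x *\<^sub>R g x + f x *\<^sub>R \<theta>' x)"
      by (rule C1_scalar_cong[OF C1_scalar_const[of "-K" 0]])
        (use t C1_scalar_eq0_grad[OF t(1,2,5)] in auto)
  qed (use t in auto)
  moreover have "U \<union> -K = UNIV" using t by auto
  ultimately show ?thesis by simp
qed

subsection \<open>Splines\<close>

definition pospart2 :: "real \<Rightarrow> real" where "pospart2 t = (max 0 t)\<^sup>2"

lemma pospart2_deriv: "(pospart2 has_real_derivative 2 * max 0 t) (at t)"
proof (cases "t = 0")
  case False
  show ?thesis
  proof (cases "t > 0")
    case True
    have "((\<lambda>t. t\<^sup>2) has_real_derivative 2 * max 0 t) (at t)" using True by (auto intro!: derivative_eq_intros)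
    then show ?thesis
      by (rule has_field_derivative_transform_within_open[where S="{0<..}"]) (use True in \<open>auto simp: pospart2_def\<close>)
  next
    case f: False
    have "((\<lambda>t. 0) has_real_derivative 2 * max 0 t) (at t)" using f by (auto intro!: derivative_eq_intros)
    then show ?thesis
      by (rule has_field_derivative_transform_within_open[where S="{..<0}"]) (use f False in \<open>auto simp: pospart2_def\<close>)
  qed
next
  case True
  have "((\<lambda>h. (pospart2 (0 + h) - pospart2 0) / h) \<longlongrightarrow> 0) (at 0)"
  proof (rule Lim_null_comparison)
    show "\<forall>\<^sub>F h in at 0. norm ((pospart2 (0 + h) - pospart2 0) / h) \<le> \<bar>h\<bar>"
      by (rule always_eventually) (auto simp: pospart2_def max_def power2_eq_square)
    show "((\<lambda>h::real. \<bar>h\<bar>) \<longlongrightarrow> 0) (at 0)" by (auto intro!: tendsto_eq_intros)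
  qed
  then show ?thesis using True by (simp add: DERIV_def)
qed

definition step_spline :: "real \<Rightarrow> real" where
  "step_spline t = 2 * (pospart2 t - 2 * pospart2 (t - 1/2) + pospart2 (t - 1))"

definition tent :: "real \<Rightarrow> real" where
  "tent t = 4 * (max 0 t - 2 * max 0 (t - 1/2) + max 0 (t - 1))"

lemma step_spline_deriv: "(step_spline has_real_derivative tent t) (at t)"
proof -
  have d: "((\<lambda>t. pospart2 (t - c)) has_real_derivative 2 * max 0 (t - c)) (at t)" for c
  proof -
    have "((\<lambda>t. t - c) has_real_derivative 1) (at t)" by (auto intro!: derivative_eq_intros)
    from DERIV_chain2[OF pospart2_deriv this] show ?thesis by simp
  qed
  show ?thesis unfolding step_spline_def[abs_def] tent_def
    by (rule derivative_eq_intros d pospart2_deriv refl)+ simp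
qed

lemma tent_cont: "continuous_on S tent" unfolding tent_def[abs_def] by (intro continuous_intros)
lemma tent_bounds: "0 \<le> tent t" "tent t \<le> 2" unfolding tent_def by (auto simp: max_def)
lemma tent_zero: "t \<le> 0 \<or> 1 \<le> t \<Longrightarrow> tent t = 0" unfolding tent_def by (auto simp: max_def)
lemma step_spline_0: "t \<le> 0 \<Longrightarrow> step_spline t = 0" unfolding step_spline_def pospart2_def by auto
lemma step_spline_1: "t \<ge> 1 \<Longrightarrow> step_spline t = 1"
  unfolding step_spline_def pospart2_def by (auto simp: max_def power2_eq_square algebra_simps)

lemma step_spline_mono: "s \<le> t \<Longrightarrow> step_spline s \<le> step_spline t"
  by (rule DERIV_nonneg_imp_nondecreasing) (use step_spline_deriv tent_bounds in blast)+

definition bspline :: "real \<Rightarrow> real" where "bspline t = step_spline (t + 1) - step_spline t"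
definition bspline' :: "real \<Rightarrow> real" where "bspline' t = tent (t + 1) - tent t"

lemma bspline_deriv: "(bspline has_real_derivative bspline' t) (at t)"
proof -
  have "((\<lambda>t. step_spline (t + 1)) has_real_derivative tent (t + 1)) (at t)"
  proof -
    have "((\<lambda>t::real. t + 1) has_real_derivative 1) (at t)" by (auto intro!: derivative_eq_intros)
    from DERIV_chain2[OF step_spline_deriv this] show ?thesis by simp
  qed
  then show ?thesis unfolding bspline_def[abs_def] bspline'_def by (intro DERIV_diff step_spline_deriv)
qed

lemma bspline'_cont: "continuous_on S bspline'" unfolding bspline'_def[abs_def]
  by (intro continuous_intros continuous_on_compose2[OF tent_cont[of UNIV]]) auto
lemma bspline_nonneg: "0 \<le> bspline t" unfolding bspline_def using step_spline_mono[of t "t+1"] by simp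
lemma bspline_zero: "\<bar>t\<bar> \<ge> 1 \<Longrightarrow> bspline t = 0"
  unfolding bspline_def by (cases "t \<ge> 1") (auto simp: step_spline_0 step_spline_1)
lemma bspline'_zero: "\<bar>t\<bar> \<ge> 1 \<Longrightarrow> bspline' t = 0"
proof -
  assume "\<bar>t\<bar> \<ge> 1"
  then have "t \<ge> 1 \<or> t \<le> -1" by linarith
  then show ?thesis unfolding bspline'_def by (auto simp: tent_zero)
qed
lemma bspline'_bound: "\<bar>bspline' t\<bar> \<le> 2"
  unfolding bspline'_def using tent_bounds[of t] tent_bounds[of "t+1"] by auto

lemma sum_telescope_int:
  fixes f :: "real \<Rightarrow> real" and t :: real
  shows "(\<Sum>m\<in>{- int M..int M}. f (t - m + 1) - f (t - m)) = f (t + M + 1) - f (t - M)"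
proof (induction M)
  case (Suc M)
  have "{- int (Suc M)..int (Suc M)} = insert (- int (Suc M)) (insert (int (Suc M)) {- int M..int M})" by auto
  then show ?case using Suc by (simp add: algebra_simps)
qed simp

lemma bspline_partition: fixes t :: real shows "\<bar>t\<bar> \<le> real M \<Longrightarrow> (\<Sum>m\<in>{- int M..int M}. bspline (t - m)) = 1"
  unfolding bspline_def sum_telescope_int by (simp add: step_spline_0 step_spline_1)
lemma bspline'_partition: fixes t :: real shows "\<bar>t\<bar> \<le> real M \<Longrightarrow> (\<Sum>m\<in>{- int M..int M}. bspline' (t - m)) = 0"
  unfolding bspline'_def sum_telescope_int
  using tent_zero[of "t + real M + 1"] tent_zero[of "t - real M"] by (simp add: abs_le_iff)

lemma bspline'_abs_sum: fixes t :: real shows "(\<Sum>m\<in>{- int M..int M}. \<bar>bspline' (t - m)\<bar>) \<le> 6"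
proof -
  have "(\<Sum>m\<in>{- int M..int M}. \<bar>bspline' (t - m)\<bar>) = (\<Sum>m\<in>{- int M..int M} \<inter> {\<lfloor>t\<rfloor>-1..\<lfloor>t\<rfloor>+1}. \<bar>bspline' (t - m)\<bar>)"
  proof (rule sum.mono_neutral_right)
    show "\<forall>i\<in>{- int M..int M} - {- int M..int M} \<inter> {\<lfloor>t\<rfloor> - 1..\<lfloor>t\<rfloor> + 1}. \<bar>bspline' (t - real_of_int i)\<bar> = 0"
    proof
      fix i assume "i \<in> {- int M..int M} - {- int M..int M} \<inter> {\<lfloor>t\<rfloor> - 1..\<lfloor>t\<rfloor> + 1}"
      then have "i < \<lfloor>t\<rfloor> - 1 \<or> i > \<lfloor>t\<rfloor> + 1" by auto
      then have "\<bar>t - i\<bar> \<ge> 1" by linarith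
      then show "\<bar>bspline' (t - real_of_int i)\<bar> = 0" by (simp add: bspline'_zero)
    qed
  qed auto
  also have "\<dots> \<le> (\<Sum>m\<in>{\<lfloor>t\<rfloor>-1..\<lfloor>t\<rfloor>+1}. \<bar>bspline' (t - m)\<bar>)" by (rule sum_mono2) auto
  also have "\<dots> \<le> (\<Sum>m\<in>{\<lfloor>t\<rfloor>-1..\<lfloor>t\<rfloor>+1}. 2)" by (rule sum_mono) (rule bspline'_bound)
  also have "\<dots> = 6" by simp
  finally show ?thesis .
qed

definition grid_bump :: "real \<Rightarrow> ('n::finite \<Rightarrow> int) \<Rightarrow> real ^ 'n \<Rightarrow> real" where
  "grid_bump r z x = (\<Prod>i\<in>UNIV. bspline (x $ i / r - z i))"

definition grid_bump' :: "real \<Rightarrow> ('n::finite \<Rightarrow> int) \<Rightarrow> real ^ 'n \<Rightarrow> real ^ 'n" where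
  "grid_bump' r z x = (\<chi> j. bspline' (x $ j / r - z j) / r * (\<Prod>i\<in>UNIV-{j}. bspline (x $ i / r - z i)))"

definition grid_point :: "real \<Rightarrow> ('n::finite \<Rightarrow> int) \<Rightarrow> real ^ 'n" where
  "grid_point r z = (\<chi> i. r * z i)"

definition grid :: "nat \<Rightarrow> ('n::finite \<Rightarrow> int) set" where
  "grid M = (\<Pi>\<^sub>E i\<in>UNIV. {- int M..int M})"

lemma finite_grid [simp]: "finite (grid M)"
  unfolding grid_def by (rule finite_PiE) auto

lemma C1_grid_bump:
  fixes z :: "'n::finite \<Rightarrow> int"
  shows "C1_scalar S (grid_bump r z) (grid_bump' r z)"
proof (rule C1_scalarI)
  fix x :: "real ^ 'n"
  have "((\<lambda>x. bspline (x $ i / r - z i)) has_derivative (\<lambda>h. bspline' (x $ i / r - z i) * (h $ i / r))) (at x)" for i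
  proof -
    have "((\<lambda>x. x $ i / r - z i) has_derivative (\<lambda>h. h $ i / r)) (at x)"
    proof -
      have "((\<lambda>x. x $ i * inverse r) has_derivative (\<lambda>h. h $ i * inverse r)) (at x)"
        by (intro has_derivative_mult_left bounded_linear.has_derivative[OF bounded_linear_vec_nth] has_derivative_ident)
      from has_derivative_diff[OF this has_derivative_const[of "of_int (z i)"]]
      show ?thesis by (simp add: divide_inverse)
    qed
    from has_derivative_compose[OF this bspline_deriv[unfolded has_field_derivative_def]]
    show ?thesis .
  qed
  then show "(grid_bump r z has_derivative
      (\<lambda>h. \<Sum>i\<in>UNIV. (bspline' (x $ i / r - z i) * (h $ i / r)) * (\<Prod>j\<in>UNIV-{i}. bspline (x $ j / r - z j)))) (at x)"
    unfolding grid_bump_def[abs_def] by (intro has_derivative_prod)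
next
  fix x h :: "real ^ 'n"
  show "(\<Sum>i\<in>UNIV. (bspline' (x $ i / r - z i) * (h $ i / r)) * (\<Prod>j\<in>UNIV-{i}. bspline (x $ j / r - z j))) = grid_bump' r z x \<bullet> h"
    unfolding inner_vec_def grid_bump'_def by (simp add: algebra_simps)
next
  have "continuous_on UNIV bspline"
    using bspline_deriv by (meson DERIV_isCont continuous_at_imp_continuous_on)
  then have "continuous_on S (grid_bump' r z)" if "r \<noteq> 0"
    unfolding grid_bump'_def[abs_def]
    using that by (auto intro!: continuous_intros continuous_on_compose2[OF bspline'_cont[of UNIV]] continuous_on_compose2[of UNIV bspline])
  moreover have "continuous_on S (grid_bump' r z)" if "r = 0"
    unfolding grid_bump'_def[abs_def] using that by simp
  ultimately show "continuous_on S (grid_bump' r z)" by blast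
qed

lemma grid_bump_nonneg: "0 \<le> grid_bump r z x"
  unfolding grid_bump_def by (intro prod_nonneg bspline_nonneg ballI)

lemma grid_bump_support:
  assumes "r > 0" "grid_bump r z x \<noteq> 0 \<or> grid_bump' r z x \<noteq> 0"
  shows "\<bar>x $ i - grid_point r z $ i\<bar> < r"
proof (rule ccontr)
  assume "\<not> ?thesis"
  then have "\<bar>x $ i / r - z i\<bar> \<ge> 1" using assms(1) unfolding grid_point_def
    by (auto simp: field_simps abs_if split: if_splits)
  then have 0: "bspline (x $ i / r - z i) = 0" "bspline' (x $ i / r - z i) = 0"
    by (auto simp: bspline_zero bspline'_zero)
  have "grid_bump r z x = 0" unfolding grid_bump_def using 0 by (auto intro!: prod_zero)
  moreover have "grid_bump' r z x $ j = 0" for j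
    unfolding grid_bump'_def using 0 by (cases "i = j") (auto intro!: prod_zero)
  ultimately show False using assms(2) by (auto simp: vec_eq_iff)
qed

lemma sum_grid_prod: "(\<Sum>z\<in>grid M. \<Prod>i\<in>UNIV. f i (z i)) = (\<Prod>i\<in>UNIV. \<Sum>m\<in>{-int M..int M}. f i m :: real)"
  unfolding grid_def by (rule prod_sum_PiE[symmetric]) auto

lemma grid_bump_partition:
  assumes "\<And>i. \<bar>x $ i\<bar> \<le> r * M" "r > 0"
  shows "(\<Sum>z\<in>grid M. grid_bump r z x) = 1"
proof -
  have "\<bar>x $ i / r\<bar> \<le> M" for i using assms(1)[of i] assms(2) by (simp add: field_simps)
  then show ?thesis unfolding grid_bump_def
    using sum_grid_prod[of "\<lambda>i m. bspline (x $ i / r - of_int m)" M] by (simp add: bspline_partition del: abs_divide)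
qed

lemma sum_grid_bump_factor:
  fixes c :: "real \<Rightarrow> real"
  assumes "\<And>i. \<bar>x $ i\<bar> \<le> r * M" "r > 0"
  shows "(\<Sum>z\<in>grid M. c (x $ j / r - z j) * (\<Prod>i\<in>UNIV-{j}. bspline (x $ i / r - z i)))
    = (\<Sum>m\<in>{-int M..int M}. c (x $ j / r - m))"
proof -
  have le: "\<bar>x $ i / r\<bar> \<le> M" for i using assms(1)[of i] assms(2) by (simp add: field_simps)
  define f where "f = (\<lambda>i m. if i = j then c (x $ i / r - real_of_int m) else bspline (x $ i / r - m))"
  have eq: "c (x $ j / r - z j) * (\<Prod>i\<in>UNIV-{j}. bspline (x $ i / r - z i)) = (\<Prod>i\<in>UNIV. f i (z i))" for z
  proof -
    have "(\<Prod>i\<in>UNIV. f i (z i)) = f j (z j) * (\<Prod>i\<in>UNIV-{j}. f i (z i))"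
      by (rule prod.remove) auto
    also have "(\<Prod>i\<in>UNIV-{j}. f i (z i)) = (\<Prod>i\<in>UNIV-{j}. bspline (x $ i / r - z i))"
      by (rule prod.cong) (auto simp: f_def)
    finally show ?thesis by (simp add: f_def)
  qed
  have "(\<Prod>i\<in>UNIV. \<Sum>m\<in>{-int M..int M}. f i m) = (\<Sum>m\<in>{-int M..int M}. f j m) * (\<Prod>i\<in>UNIV-{j}. \<Sum>m\<in>{-int M..int M}. f i m)"
    by (rule prod.remove) auto
  also have "(\<Prod>i\<in>UNIV-{j}. \<Sum>m\<in>{-int M..int M}. f i m) = 1"
    by (rule prod.neutral) (use le in \<open>auto simp: f_def bspline_partition\<close>)
  finally show ?thesis unfolding eq sum_grid_prod by (simp add: f_def)
qed

lemma grid_bump'_partition: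
  assumes "\<And>i. \<bar>x $ i\<bar> \<le> r * M" "r > 0"
  shows "(\<Sum>z\<in>grid M. grid_bump' r z x) = 0"
proof -
  have le: "\<bar>x $ i / r\<bar> \<le> M" for i using assms(1)[of i] assms(2) by (simp add: field_simps)
  have "(\<Sum>z\<in>grid M. grid_bump' r z x $ j) = 0" for j
    unfolding grid_bump'_def vec_lambda_beta
    using sum_grid_bump_factor[OF assms, of "\<lambda>t. bspline' t / r" j] bspline'_partition[OF le[of j]]
    by (simp add: sum_divide_distrib[symmetric])
  then show ?thesis by (simp add: vec_eq_iff)
qed

lemma grid_bump'_abs_sum:
  assumes "\<And>i. \<bar>x $ i\<bar> \<le> r * M" "r > 0"
  shows "(\<Sum>z\<in>grid M. \<bar>grid_bump' r z x $ j\<bar>) \<le> 6 / r"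
proof -
  have le: "\<bar>x $ i / r\<bar> \<le> M" for i using assms(1)[of i] assms(2) by (simp add: field_simps)
  have "(\<Sum>z\<in>grid M. \<bar>grid_bump' r z x $ j\<bar>) = (\<Sum>m\<in>{-int M..int M}. \<bar>bspline' (x $ j / r - m)\<bar> / r)"
    unfolding grid_bump'_def vec_lambda_beta
    using sum_grid_bump_factor[OF assms, of "\<lambda>t. \<bar>bspline' t\<bar> / r" j] assms(2)
    by (simp add: abs_mult prod_nonneg bspline_nonneg)
  also have "\<dots> \<le> 6 / r" using bspline'_abs_sum[where M=M and t="x $ j / r"] assms(2)
    by (simp add: sum_divide_distrib[symmetric] divide_right_mono)
  finally show ?thesis .
qed

subsection \<open>Cut-off functions\<close>

definition cube_in :: "(real ^ 'n) set \<Rightarrow> real ^ 'n \<Rightarrow> real \<Rightarrow> bool" where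
  "cube_in U x s \<longleftrightarrow> (\<forall>y. (\<forall>i. \<bar>y $ i - x $ i\<bar> \<le> s) \<longrightarrow> y \<in> U)"

lemma cube_in_shift:
  assumes "cube_in U x s" "\<And>i. \<bar>y $ i - x $ i\<bar> \<le> a" "a + t \<le> s" shows "cube_in U y t"
  unfolding cube_in_def
proof (intro allI impI)
  fix w assume w: "\<forall>i. \<bar>w $ i - y $ i\<bar> \<le> t"
  have "\<bar>w $ i - x $ i\<bar> \<le> s" for i using w[rule_format, of i] assms(2)[of i] assms(3) by linarith
  then show "w \<in> U" using assms(1) unfolding cube_in_def by blast
qed

lemma cube_in_mono: "cube_in U x s \<Longrightarrow> t \<le> s \<Longrightarrow> cube_in U x t"
  using cube_in_shift[of U x s x 0 t] by simp

lemma cube_in_mem: "cube_in U x s \<Longrightarrow> 0 \<le> s \<Longrightarrow> x \<in> U" unfolding cube_in_def by auto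

definition grid_size :: "(real ^ 'n) set \<Rightarrow> real \<Rightarrow> nat" where
  "grid_size U r = (SOME M. \<forall>x\<in>closure U. \<forall>i. \<bar>x $ i\<bar> \<le> r * real M)"

lemma grid_size:
  assumes "bounded U" "r > 0" "x \<in> closure U" shows "\<bar>x $ i\<bar> \<le> r * real (grid_size U r)"
proof -
  have "bounded (closure U)" using assms by auto
  then obtain B where B: "\<And>x. x \<in> closure U \<Longrightarrow> norm x \<le> B" using bounded_iff by blast
  obtain M :: nat where "B / r \<le> real M" using real_arch_simple by blast
  then have "B \<le> r * real M" using assms(2) by (simp add: field_simps)
  then have "\<forall>x\<in>closure U. \<forall>i. \<bar>x $ i\<bar> \<le> r * real M"
    by (intro ballI allI order_trans[OF component_le_norm_cart]) (use B in force)
  then have "\<forall>x\<in>closure U. \<forall>i. \<bar>x $ i\<bar> \<le> r * real (grid_size U r)"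
    unfolding grid_size_def by (rule someI)
  then show ?thesis using assms(3) by blast
qed

definition inner_grid :: "(real ^ 'n) set \<Rightarrow> real \<Rightarrow> ('n \<Rightarrow> int) set" where
  "inner_grid U r = {z \<in> grid (grid_size U r). cube_in U (grid_point r z) (4 * r)}"

definition cutoff :: "(real ^ 'n) set \<Rightarrow> real \<Rightarrow> real ^ 'n \<Rightarrow> real" where
  "cutoff U r x = (\<Sum>z\<in>inner_grid U r. grid_bump r z x)"

definition cutoff' :: "(real ^ 'n) set \<Rightarrow> real \<Rightarrow> real ^ 'n \<Rightarrow> real ^ 'n" where
  "cutoff' U r x = (\<Sum>z\<in>inner_grid U r. grid_bump' r z x)"

lemma finite_inner_grid [simp]: "finite (inner_grid U r)" unfolding inner_grid_def by simp

lemma C1_cutoff: "C1_scalar S (cutoff U r) (cutoff' U r)"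
  unfolding cutoff_def[abs_def] cutoff'_def[abs_def] by (intro C1_scalar_sum C1_grid_bump)

lemma cutoff_nonneg: "0 \<le> cutoff U r x"
  unfolding cutoff_def by (intro sum_nonneg grid_bump_nonneg)

lemma cutoff_support:
  assumes "r > 0" "cutoff U r x \<noteq> 0 \<or> cutoff' U r x \<noteq> 0" shows "cube_in U x (3 * r)"
proof -
  have "\<exists>z\<in>inner_grid U r. grid_bump r z x \<noteq> 0 \<or> grid_bump' r z x \<noteq> 0"
    using assms(2) unfolding cutoff_def cutoff'_def by (metis (no_types, lifting) sum.neutral)
  then obtain z where z: "z \<in> inner_grid U r" "grid_bump r z x \<noteq> 0 \<or> grid_bump' r z x \<noteq> 0" by blast
  show ?thesis
    by (rule cube_in_shift[of U "grid_point r z" "4*r" x r])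
      (use z grid_bump_support[OF assms(1) z(2)] in \<open>auto simp: inner_grid_def less_imp_le\<close>)
qed

lemma cutoff_outside: assumes "r > 0" "x \<notin> U" shows "cutoff U r x = 0" "cutoff' U r x = 0"
  using cutoff_support[of r U x] cube_in_mem[of U x "3*r"] assms by auto

lemma cutoff_inside:
  assumes "bounded U" "r > 0" "cube_in U x (5 * r)" shows "cutoff U r x = 1" "cutoff' U r x = 0"
proof -
  have x: "x \<in> closure U" using cube_in_mem[OF assms(3)] assms(2) closure_subset by auto
  have z0: "grid_bump r z x = 0" "grid_bump' r z x = 0" if "z \<in> grid (grid_size U r) - inner_grid U r" for z
  proof -
    have "\<not> cube_in U (grid_point r z) (4*r)" using that unfolding inner_grid_def by auto
    then have "\<exists>i. \<bar>grid_point r z $ i - x $ i\<bar> > r"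
    proof -
      have "r + 4 * r \<le> 5 * r" by simp
      then show ?thesis
        using cube_in_shift[OF assms(3), of "grid_point r z" r "4*r"] \<open>\<not> cube_in U (grid_point r z) (4*r)\<close>
        by (meson not_less)
    qed
    then obtain i where "\<bar>x $ i - grid_point r z $ i\<bar> > r" by (auto simp: abs_minus_commute)
    then show "grid_bump r z x = 0" "grid_bump' r z x = 0"
      using grid_bump_support[OF assms(2), of z x i] by auto
  qed
  have sub: "inner_grid U r \<subseteq> grid (grid_size U r)" unfolding inner_grid_def by auto
  have "cutoff U r x = (\<Sum>z\<in>grid (grid_size U r). grid_bump r z x)"
    unfolding cutoff_def by (rule sum.mono_neutral_left) (use sub z0 in auto)
  then show "cutoff U r x = 1" using grid_bump_partition[OF grid_size[OF assms(1,2) x] assms(2)] by simp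
  have "cutoff' U r x = (\<Sum>z\<in>grid (grid_size U r). grid_bump' r z x)"
    unfolding cutoff'_def by (rule sum.mono_neutral_left) (use sub z0 in auto)
  then show "cutoff' U r x = 0" using grid_bump'_partition[OF grid_size[OF assms(1,2) x] assms(2)] by simp
qed

lemma cutoff_le_1: assumes "bounded U" "r > 0" shows "cutoff U r x \<le> 1"
proof (cases "x \<in> U")
  case True
  then have x: "x \<in> closure U" using closure_subset by auto
  have "cutoff U r x \<le> (\<Sum>z\<in>grid (grid_size U r). grid_bump r z x)"
    unfolding cutoff_def by (rule sum_mono2) (auto simp: inner_grid_def grid_bump_nonneg)
  then show ?thesis using grid_bump_partition[OF grid_size[OF assms x] assms(2)] by simp
qed (simp add: cutoff_outside assms)

lemma cutoff'_bound: assumes "bounded U" "r > 0" shows "\<bar>cutoff' U r x $ j\<bar> \<le> 6 / r"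
proof (cases "x \<in> U")
  case True
  then have x: "x \<in> closure U" using closure_subset by auto
  have "\<bar>cutoff' U r x $ j\<bar> \<le> (\<Sum>z\<in>inner_grid U r. \<bar>grid_bump' r z x $ j\<bar>)"
    unfolding cutoff'_def sum_component by (rule sum_abs)
  also have "\<dots> \<le> (\<Sum>z\<in>grid (grid_size U r). \<bar>grid_bump' r z x $ j\<bar>)"
    by (rule sum_mono2) (auto simp: inner_grid_def)
  finally show ?thesis using grid_bump'_abs_sum[OF grid_size[OF assms x] assms(2), of j] by simp
qed (use assms in \<open>simp add: cutoff_outside\<close>)

lemma cube_in_compact:
  assumes "compact K" "K \<subseteq> U" "open U" shows "\<exists>s>0. \<forall>x\<in>K. cube_in U x s"
proof -
  obtain e where e: "e > 0" "\<And>x y. x \<in> K \<Longrightarrow> dist y x < e \<Longrightarrow> y \<in> U"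
  proof (cases "K = {} \<or> U = UNIV")
    case True then show ?thesis using that[of 1] assms by auto
  next
    case False
    have "\<exists>d>0. \<forall>x\<in>K. \<forall>y\<in>-U. d \<le> dist x y"
      by (rule separate_compact_closed) (use assms in auto)
    then obtain d where "d > 0" "\<And>x y. x \<in> K \<Longrightarrow> y \<in> -U \<Longrightarrow> d \<le> dist x y" by blast
    then show ?thesis using that[of d] by (metis ComplI dist_commute not_less)
  qed
  define s where "s = e / (2 * CARD('a))"
  have s: "s > 0" using e unfolding s_def by simp
  have "cube_in U x s" if x: "x \<in> K" for x
    unfolding cube_in_def
  proof (intro allI impI)
    fix y :: "real ^ 'a" assume y: "\<forall>i. \<bar>y $ i - x $ i\<bar> \<le> s"
    have "dist y x \<le> (\<Sum>i\<in>UNIV. \<bar>(y - x) $ i\<bar>)" unfolding dist_norm by (rule norm_le_l1_cart)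
    also have "\<dots> \<le> (\<Sum>i\<in>(UNIV::'a set). s)" by (rule sum_mono) (use y in auto)
    also have "\<dots> < e" using e by (simp add: s_def)
    finally show "y \<in> U" using e(2)[OF x] by simp
  qed
  then show ?thesis using s by blast
qed

lemma ex_cutoff:
  assumes "compact K" "K \<subseteq> U" "open U"
  obtains \<theta> \<theta>' L V where "C1_scalar UNIV \<theta> \<theta>'" "compact L" "L \<subseteq> U" "\<And>x. x \<notin> L \<Longrightarrow> \<theta> x = 0"
    "open V" "K \<subseteq> V" "\<And>x. x \<in> V \<Longrightarrow> \<theta> x = 1" "\<And>x. x \<in> V \<Longrightarrow> \<theta>' x = 0"
proof -
  have "bounded K" using assms compact_imp_bounded by auto
  then obtain B where B: "K \<subseteq> ball 0 B" using bounded_subset_ballD by blast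
  define U1 where "U1 = U \<inter> ball 0 B"
  have U1: "open U1" "bounded U1" "K \<subseteq> U1" "U1 \<subseteq> U" unfolding U1_def using assms B by auto
  obtain s where s: "s > 0" "\<And>x. x \<in> K \<Longrightarrow> cube_in U1 x s"
    using cube_in_compact[OF assms(1) U1(3,1)] by blast
  define r where "r = s / 10"
  have r: "r > 0" using s r_def by auto
  define L where "L = closure {x. cutoff U1 r x \<noteq> 0}"
  have L: "cube_in U1 x (2 * r)" if "x \<in> L" for x
  proof -
    have "\<exists>y\<in>{x. cutoff U1 r x \<noteq> 0}. dist y x < r"
      using that r unfolding L_def closure_approachable by blast
    then obtain y where y: "cutoff U1 r y \<noteq> 0" "dist y x < r" by blast
    have "\<bar>x $ i - y $ i\<bar> \<le> r" for i
      using component_le_norm_cart[of "x - y" i] y(2) by (simp add: dist_norm norm_minus_commute)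
    then show ?thesis
      by (intro cube_in_shift[of U1 y "3*r" x r]) (use cutoff_support[OF r] y in auto)
  qed
  have L_U1: "L \<subseteq> U1" using cube_in_mem[OF L] r by force
  define V where "V = (\<Union>x\<in>K. ball x r)"
  have V: "cube_in U1 x (5 * r)" if "x \<in> V" for x
  proof -
    obtain y where y: "y \<in> K" "dist y x < r" using \<open>x \<in> V\<close> unfolding V_def by auto
    have "\<bar>x $ i - y $ i\<bar> \<le> r" for i
      using component_le_norm_cart[of "x - y" i] y(2) by (simp add: dist_norm norm_minus_commute)
    then show ?thesis
      by (intro cube_in_shift[of U1 y s x r]) (use s y r_def in auto)
  qed
  show ?thesis
  proof
    show "C1_scalar UNIV (cutoff U1 r) (cutoff' U1 r)" by (rule C1_cutoff)
    show "compact L" unfolding L_def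
      by (metis L_U1 L_def U1(2) bounded_subset closed_closure compact_eq_bounded_closed)
    show "L \<subseteq> U" using L_U1 U1 by auto
    show "cutoff U1 r x = 0" if "x \<notin> L" for x
      using that closure_subset[of "{x. cutoff U1 r x \<noteq> 0}"] unfolding L_def by auto
    show "open V" unfolding V_def by auto
    show "K \<subseteq> V" unfolding V_def using r by auto
    show "cutoff U1 r x = 1" "cutoff' U1 r x = 0" if "x \<in> V" for x
      using cutoff_inside[OF U1(2) r V[OF that]] by auto
  qed
qed

subsection \<open>The integral of a Jacobian determinant\<close>

lemma onorm_matrix_bound:
  fixes A :: "'a::topological_space \<Rightarrow> real ^ 'n ^ 'm"
  assumes "compact K" "continuous_on K A"
  obtains L where "L > 0" "\<And>x. x \<in> K \<Longrightarrow> onorm ((*v) (A x)) \<le> L"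
proof -
  have "continuous_on K (\<lambda>x. \<Sum>i\<in>UNIV. \<Sum>j\<in>UNIV. \<bar>A x $ i $ j\<bar>)"
    by (intro continuous_intros assms)
  then have "bounded ((\<lambda>x. \<Sum>i\<in>UNIV. \<Sum>j\<in>UNIV. \<bar>A x $ i $ j\<bar>) ` K)"
    using assms(1) compact_continuous_image compact_imp_bounded by blast
  then obtain B where B: "B > 0" "\<And>x. x \<in> K \<Longrightarrow> norm (\<Sum>i\<in>UNIV. \<Sum>j\<in>UNIV. \<bar>A x $ i $ j\<bar>) \<le> B"
    unfolding bounded_pos by (metis imageI)
  have "onorm ((*v) (A x)) \<le> B" if "x \<in> K" for x
    using onorm_le_matrix_component_sum[of "A x"] B(2)[OF that] by (simp add: real_norm_def)
  then show ?thesis using that B(1) by blast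
qed

lemma onorm_matrix_0: "onorm ((*v) (0 :: real ^ 'n ^ 'm)) = 0"
proof -
  have "(*v) (0 :: real ^ 'n ^ 'm) = (\<lambda>_. 0)" by (rule ext) simp
  then show ?thesis by (simp add: onorm_zero)
qed

lemma mat_zero: "mat 0 = 0"
  by (simp add: mat_def vec_eq_iff)

lemma det_zero: "det (0 :: real ^ 'n ^ 'n) = 0"
  using det_0 unfolding mat_zero .

lemma continuous_on_det:
  fixes A :: "'a::topological_space \<Rightarrow> real ^ 'n ^ 'n"
  assumes "continuous_on S A" shows "continuous_on S (\<lambda>x. det (A x))"
  unfolding det_def by (intro continuous_intros assms)

lemma mat_vector_mult: "mat s *v v = s *\<^sub>R v"
  by (simp add: matrix_vector_mult_def mat_def vec_eq_iff if_distrib if_distribR sum.delta cong: if_cong)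

lemma det_shift_pos:
  fixes A :: "real ^ 'n ^ 'n"
  assumes "\<And>h. norm (A *v h) \<le> L * norm h" "s > L" "L > 0"
  shows "det (mat s + A) > 0"
proof -
  have nz: "det (mat s + t *\<^sub>R A) \<noteq> 0" if "t \<in> {0..1}" for t
  proof -
    have "v = 0" if "(mat s + t *\<^sub>R A) *v v = 0" for v
    proof (rule ccontr)
      assume "v \<noteq> 0"
      have "s *\<^sub>R v + t *\<^sub>R (A *v v) = 0"
        using that by (simp add: matrix_vector_mult_add_rdistrib mat_vector_mult scaleR_matrix_vector_assoc)
      then have "s *\<^sub>R v = - (t *\<^sub>R (A *v v))" by (simp add: eq_neg_iff_add_eq_0)
      then have "norm (s *\<^sub>R v) = norm (t *\<^sub>R (A *v v))" by (metis norm_minus_cancel)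
      then have "s * norm v = t * norm (A *v v)" using assms \<open>t \<in> {0..1}\<close> by simp
      also have "\<dots> \<le> 1 * (L * norm v)" using assms \<open>t \<in> {0..1}\<close> by (intro mult_mono) auto
      finally show False using assms \<open>v \<noteq> 0\<close> by simp
    qed
    then have "invertible (mat s + t *\<^sub>R A)"
      unfolding invertible_left_inverse matrix_left_invertible_ker by blast
    then show ?thesis by (simp add: invertible_det_nz)
  qed
  have cont: "continuous_on {0..1} (\<lambda>t. det (mat s + t *\<^sub>R A))"
    by (intro continuous_on_det continuous_intros)
  have d0: "det (mat s + 0 *\<^sub>R A) > 0"
    using assms by (simp add: det_diagonal mat_def)
  show ?thesis
  proof (rule ccontr)
    assume "\<not> ?thesis"
    then have "det (mat s + 1 *\<^sub>R A) \<le> 0" by simp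
    then have "\<exists>t\<ge>0. t \<le> 1 \<and> det (mat s + t *\<^sub>R A) = 0"
      using IVT2'[of "\<lambda>t. det (mat s + t *\<^sub>R A)" 1 0 0] d0 cont by force
    then show False using nz by auto
  qed
qed

text \<open>For large \<open>s\<close> the map \<open>x \<mapsto> s x + g x\<close> is a diffeomorphism, so that the integral of its
  Jacobian determinant over a box is independent of \<open>g\<close>. Both sides are polynomials in
  \<open>s\<close>, hence they also agree at \<open>s = 0\<close>.\<close>

lemma integral_det_shift:
  fixes g :: "real ^ 'm::{finite,wellorder} \<Rightarrow> real ^ 'm::_"
  assumes g: "C1_map UNIV g A" and 0: "\<And>x. x \<notin> cbox a b \<Longrightarrow> g x = 0"
    and L: "L > 0" "\<And>x. onorm ((*v) (A x)) \<le> L" "s > L"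
  shows "integral (cbox a b) (\<lambda>x. det (mat s + A x)) = measure lebesgue ((\<lambda>x. s *\<^sub>R x) ` cbox a b)"
proof -
  define F where "F x = s *\<^sub>R x + g x" for x
  have s: "s > 0" using L by simp
  have lip: "norm (g x - g y) \<le> L * norm (x - y)" for x y
    by (rule differentiable_bound[of UNIV _ "\<lambda>x. (*v) (A x)"]) (use C1_map_has_derivative[OF g] L in auto)
  have inj: "x = y" if "F x = F y" for x y
  proof (rule ccontr)
    assume "x \<noteq> y"
    have "s *\<^sub>R (x - y) = g y - g x" using that unfolding F_def by (simp add: algebra_simps)
    then have "s * norm (x - y) \<le> L * norm (x - y)"
      using lip[of y x] s by (metis norm_minus_commute norm_scaleR abs_of_pos)
    then show False using L(3) \<open>x \<noteq> y\<close> by simp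
  qed
  have surj: "\<exists>x. F x = y" for y
  proof -
    have "\<exists>!x. inverse s *\<^sub>R (y - g x) = x"
    proof (rule banach_fix_type[of "L / s"])
      show "\<forall>u v. dist (inverse s *\<^sub>R (y - g u)) (inverse s *\<^sub>R (y - g v)) \<le> L / s * dist u v"
      proof (intro allI)
        fix u v
        have "inverse s *\<^sub>R (y - g u) - inverse s *\<^sub>R (y - g v) = inverse s *\<^sub>R (g v - g u)"
          by (simp add: algebra_simps)
        then have "dist (inverse s *\<^sub>R (y - g u)) (inverse s *\<^sub>R (y - g v)) = inverse s * norm (g v - g u)"
          using s by (simp add: dist_norm)
        also have "\<dots> \<le> inverse s * (L * norm (v - u))"
          using lip[of v u] s by (intro mult_left_mono) auto
        finally show "dist (inverse s *\<^sub>R (y - g u)) (inverse s *\<^sub>R (y - g v)) \<le> L / s * dist u v"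
          by (simp add: dist_norm norm_minus_commute field_simps)
      qed
    qed (use L in auto)
    then obtain x where "inverse s *\<^sub>R (y - g x) = x" by blast
    then have "s *\<^sub>R (inverse s *\<^sub>R (y - g x)) = s *\<^sub>R x" by simp
    then have "F x = y" using s unfolding F_def by (simp add: algebra_simps)
    then show ?thesis ..
  qed
  have img: "F ` cbox a b = (\<lambda>x. s *\<^sub>R x) ` cbox a b"
  proof safe
    fix x assume x: "x \<in> cbox a b"
    show "F x \<in> (\<lambda>x. s *\<^sub>R x) ` cbox a b"
    proof (rule ccontr)
      assume *: "F x \<notin> (\<lambda>x. s *\<^sub>R x) ` cbox a b"
      define x' where "x' = inverse s *\<^sub>R F x"
      have e: "s *\<^sub>R x' = F x" unfolding x'_def using s by simp
      then have "x' \<notin> cbox a b" using * by (metis imageI)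
      then have "F x' = F x" using 0 e unfolding F_def by simp
      then show False using inj x \<open>x' \<notin> cbox a b\<close> by blast
    qed
  next
    fix x assume x: "x \<in> cbox a b"
    obtain z where z: "F z = s *\<^sub>R x" using surj by blast
    have "z \<in> cbox a b"
    proof (rule ccontr)
      assume "z \<notin> cbox a b"
      then have "s *\<^sub>R z = s *\<^sub>R x" using z 0 unfolding F_def by simp
      then show False using s x \<open>z \<notin> cbox a b\<close> by simp
    qed
    then show "s *\<^sub>R x \<in> F ` cbox a b" using z by (metis imageI)
  qed
  have der: "(F has_derivative (\<lambda>h. (mat s + A x) *v h)) (at x within cbox a b)" for x
  proof -
    have "(F has_derivative (\<lambda>h. s *\<^sub>R h + A x *v h)) (at x within cbox a b)"
      unfolding F_def[abs_def]
      by (intro has_derivative_add has_derivative_at_withinI[OF C1_map_has_derivative[OF g]])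
        (auto intro!: derivative_eq_intros)
    then show ?thesis by (simp add: matrix_vector_mult_add_rdistrib mat_vector_mult)
  qed
  have cont: "continuous_on (cbox a b) (\<lambda>x. det (mat s + A x))"
    using continuous_on_subset[OF C1_map_continuous_on(2)[OF g]]
    by (intro continuous_on_det continuous_intros) auto
  have pos: "\<bar>det (mat s + A x)\<bar> = det (mat s + A x)" for x
  proof -
    have "norm (A x *v h) \<le> L * norm h" for h
      using onorm[of "(*v) (A x)" h] L(2)[of x]
      by (meson matrix_vector_mul_bounded_linear mult_right_mono norm_ge_zero order_trans)
    then show ?thesis using det_shift_pos[of "A x" L s] L by simp
  qed
  have "measure lebesgue (F ` cbox a b) = integral (cbox a b) (\<lambda>x. \<bar>det (matrix (\<lambda>h. (mat s + A x) *v h))\<bar>)"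
    by (rule measure_differentiable_image_eq[OF _ der])
      (use inj cont in \<open>auto simp: inj_on_def pos intro!: integrable_continuous\<close>)
  then show ?thesis by (simp add: pos img)
qed

lemma det_shift_expand:
  fixes A :: "real ^ 'n ^ 'n"
  shows "det (mat s + A) = (\<Sum>p | p permutes UNIV. \<Sum>B\<in>Pow UNIV.
     (of_int (sign p) * ((\<Prod>i\<in>B. if i = p i then 1 else 0) * (\<Prod>i\<in>UNIV-B. A $ i $ p i))) * s ^ card B)"
proof -
  have "(\<Prod>i\<in>UNIV. (mat s + A) $ i $ p i) =
    (\<Sum>B\<in>Pow UNIV. ((\<Prod>i\<in>B. if i = p i then 1 else 0) * (\<Prod>i\<in>UNIV-B. A $ i $ p i)) * s ^ card B)" for p
  proof -
    have "(\<Prod>i\<in>UNIV. (mat s + A) $ i $ p i) = (\<Prod>i\<in>UNIV. (if i = p i then 1 else 0) * s + A $ i $ p i)"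
      by (rule prod.cong) (auto simp: mat_def)
    also have "\<dots> = (\<Sum>B\<in>Pow UNIV. (\<Prod>i\<in>B. (if i = p i then 1 else 0) * s) * (\<Prod>i\<in>UNIV-B. A $ i $ p i))"
      by (rule prod_add) simp
    also have "\<dots> = (\<Sum>B\<in>Pow UNIV. ((\<Prod>i\<in>B. if i = p i then 1 else 0) * (\<Prod>i\<in>UNIV-B. A $ i $ p i)) * s ^ card B)"
      by (rule sum.cong) (auto simp: prod.distrib)
    finally show ?thesis .
  qed
  then show ?thesis unfolding det_def by (simp add: sum_distrib_left mult.assoc)
qed

lemma integral_det_zero_wellorder:
  fixes g :: "real ^ 'm::{finite,wellorder} \<Rightarrow> real ^ 'm::_"
  assumes g: "C1_map UNIV g A" and K: "compact K" "\<And>x. x \<notin> K \<Longrightarrow> g x = 0" "\<And>x. x \<notin> K \<Longrightarrow> A x = 0"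
  shows "(\<integral>x. det (A x) \<partial>lborel) = 0"
proof -
  obtain a b where ab: "K \<subseteq> cbox a b"
    using bounded_subset_cbox_symmetric compact_imp_bounded[OF K(1)] by blast
  have contA: "continuous_on S A" for S using C1_map_continuous_on(2)[OF g] continuous_on_subset by blast
  obtain L where L: "L > 0" "\<And>x. x \<in> K \<Longrightarrow> onorm ((*v) (A x)) \<le> L"
    using onorm_matrix_bound[OF K(1) contA] by blast
  have L': "onorm ((*v) (A x)) \<le> L" for x
    using L K(3)[of x] by (cases "x \<in> K") (auto simp: onorm_matrix_0)
  define c where "c p B x = of_int (sign p) * ((\<Prod>i\<in>B. if i = p i then 1 else 0) * (\<Prod>i\<in>UNIV-B. A x $ i $ p i))"
    for p :: "'m \<Rightarrow> 'm" and B :: "'m set" and x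
  have c_int: "c p B integrable_on cbox a b" for p B
    unfolding c_def by (intro integrable_continuous continuous_intros contA)
  define q where "q = (\<Sum>p | p permutes UNIV. \<Sum>B\<in>Pow UNIV. monom (integral (cbox a b) (c p B)) (card B))
      - monom (measure lebesgue (cbox a b)) CARD('m)"
  have q: "poly q s = integral (cbox a b) (\<lambda>x. det (mat s + A x)) - s ^ CARD('m) * measure lebesgue (cbox a b)" for s
  proof -
    have "integral (cbox a b) (\<lambda>x. det (mat s + A x)) =
      (\<Sum>p | p permutes UNIV. \<Sum>B\<in>Pow UNIV. integral (cbox a b) (c p B) * s ^ card B)"
      unfolding det_shift_expand c_def[symmetric]
      by (subst integral_sum; (intro finite_permutations integrable_sum integrable_on_mult_left c_int finite)?)
        (subst integral_sum; (intro finite_Pow_iff[THEN iffD2] integrable_on_mult_left c_int finite)?; simp)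
    then show ?thesis unfolding q_def by (simp add: poly_sum poly_monom)
  qed
  have "poly q s = 0" if "s > L" for s
  proof -
    have "integral (cbox a b) (\<lambda>x. det (mat s + A x)) = measure lebesgue ((\<lambda>x. s *\<^sub>R x) ` cbox a b)"
      by (rule integral_det_shift[OF g _ L(1) L' that]) (use K ab in blast)
    also have "\<dots> = integral (cbox a b) (\<lambda>x. det (mat s + (A x - A x)))"
      by (rule integral_det_shift[symmetric, where g="\<lambda>x. 0" and L=L and A="\<lambda>x. A x - A x"])
        (use L that in \<open>auto simp: C1_map_const onorm_matrix_0\<close>)
    also have "\<dots> = s ^ CARD('m) * measure lebesgue (cbox a b)"
      by (simp add: det_diagonal mat_def mult.commute)
    finally show ?thesis by (simp add: q)
  qed
  then have "{L<..} \<subseteq> {s. poly q s = 0}" by auto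
  moreover have "infinite {L<..}" by (rule infinite_Ioi)
  ultimately have "q = 0" using poly_roots_finite finite_subset by blast
  then have "integral (cbox a b) (\<lambda>x. det (mat 0 + A x)) = 0" using q[of 0] by simp
  then have *: "integral (cbox a b) (\<lambda>x. det (A x)) = 0" by (simp add: mat_zero)
  have d0: "det (A x) = 0" if "x \<notin> cbox a b" for x
  proof -
    have "x \<notin> K" using that ab by blast
    then show ?thesis by (simp add: K(3) det_zero)
  qed
  have eq: "(\<lambda>x. indicator (cbox a b) x *\<^sub>R det (A x)) = (\<lambda>x. det (A x))"
  proof
    fix x show "indicator (cbox a b) x *\<^sub>R det (A x) = det (A x)"
      by (cases "x \<in> cbox a b") (simp_all add: d0)
  qed
  have "integrable lborel (\<lambda>x. indicator (cbox a b) x *\<^sub>R det (A x))"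
    by (intro borel_integrable_compact continuous_on_det contA) auto
  then have "(\<integral>x. det (A x) \<partial>lborel) = integral UNIV (\<lambda>x. det (A x))"
    unfolding eq by (rule integral_lborel[symmetric])
  also have "\<dots> = integral UNIV (\<lambda>x. if x \<in> cbox a b then det (A x) else 0)"
    using d0 by (intro integral_cong) auto
  also have "\<dots> = 0" using * by (simp add: integral_restrict_UNIV)
  finally show ?thesis .
qed

text \<open>The change of variables theorem of the library needs a well-ordered index type; hence a copy
  of the index type with some well-order.\<close>

typedef 'a ordered_copy = "UNIV :: 'a set" morphisms of_copy to_copy by blast

instance ordered_copy :: (finite) finite
proof
  have "(UNIV :: 'a ordered_copy set) = to_copy ` UNIV"
    using of_copy_inverse by (metis UNIV_I UNIV_eq_I image_eqI)
  then show "finite (UNIV :: 'a ordered_copy set)" by (metis finite finite_imageI)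
qed

definition copy_rank :: "'a::finite ordered_copy \<Rightarrow> nat" where
  "copy_rank = (SOME f. inj f)"

lemma inj_copy_rank: "inj copy_rank"
proof -
  have "\<exists>f :: 'a ordered_copy \<Rightarrow> nat. inj f"
    using finite_imp_inj_to_nat_seg[of "UNIV :: 'a ordered_copy set"] by auto
  then show ?thesis unfolding copy_rank_def by (rule someI_ex)
qed

instantiation ordered_copy :: (finite) wellorder
begin
definition less_eq_ordered_copy :: "'a ordered_copy \<Rightarrow> 'a ordered_copy \<Rightarrow> bool" where
  "x \<le> y \<longleftrightarrow> copy_rank x \<le> copy_rank y"
definition less_ordered_copy :: "'a ordered_copy \<Rightarrow> 'a ordered_copy \<Rightarrow> bool" where
  "x < y \<longleftrightarrow> copy_rank x < copy_rank y"
instance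
proof
  fix P :: "'a ordered_copy \<Rightarrow> bool" and a :: "'a ordered_copy" assume *: "\<And>x. (\<And>y. y < x \<Longrightarrow> P y) \<Longrightarrow> P x"
  show "P a"
    by (induction a rule: measure_induct_rule[of copy_rank]) (use * in \<open>auto simp: less_ordered_copy_def\<close>)
qed (auto simp: less_eq_ordered_copy_def less_ordered_copy_def inj_eq[OF inj_copy_rank])
end

lemma bij_to_copy: "bij (to_copy :: 'a \<Rightarrow> 'a ordered_copy)"
  by (rule bijI') (metis to_copy_inverse UNIV_I, metis of_copy_inverse)

lemma of_to_copy [simp]: "of_copy (to_copy x) = x" "to_copy (of_copy y) = y"
  using to_copy_inverse of_copy_inverse by auto

lemma sign_conjugate:
  fixes f :: "'a::finite \<Rightarrow> 'b::finite"
  assumes "bij f" "p permutes UNIV" shows "sign (f \<circ> p \<circ> inv f) = sign p"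
proof -
  have ff: "inv f (f a) = a" "f (inv f b) = b" for a b
    using assms(1) by (auto simp: bij_is_inj bij_is_surj surj_f_inv_f)
  have *: "swapidseq n q \<Longrightarrow> swapidseq n (f \<circ> q \<circ> inv f)" for n q
  proof (induction rule: swapidseq.induct)
    case id
    have "f \<circ> id \<circ> inv f = id" using ff by (auto simp: fun_eq_iff)
    then show ?case using swapidseq.id by metis
  next
    case (comp_Suc n p a b)
    have "f \<circ> (Transposition.transpose a b \<circ> p) \<circ> inv f = Transposition.transpose (f a) (f b) \<circ> (f \<circ> p \<circ> inv f)"
      using ff assms(1) by (auto simp: fun_eq_iff Transposition.transpose_def bij_is_inj[THEN inj_eq])
    moreover have "f a \<noteq> f b" using comp_Suc assms(1) by (simp add: bij_is_inj inj_eq)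
    ultimately show ?case using swapidseq.comp_Suc[OF comp_Suc.IH] by metis
  qed
  have "permutation p" using assms(2) permutation_permutes by (metis finite)
  then obtain n where n: "swapidseq n p" unfolding permutation_def by blast
  have "evenperm (f \<circ> p \<circ> inv f) = evenperm p"
    using evenperm_unique[OF n refl] evenperm_unique[OF *[OF n] refl] by simp
  then show ?thesis by (simp add: sign_def)
qed

lemma det_reindex:
  fixes A :: "real ^ 'n ^ 'n" and f :: "'m::finite \<Rightarrow> 'n"
  assumes f: "bij f" shows "det (\<chi> i j. A $ f i $ f j) = det A"
proof -
  have ff: "inv f (f a) = a" "f (inv f b) = b" for a b
    using assms(1) by (auto simp: bij_is_inj bij_is_surj surj_f_inv_f)
  have bi: "bij (inv f)" using f by (rule bij_imp_bij_inv)
  have inv_inv: "inv (inv f) = f" using f by (rule inv_inv_eq)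
  have perm: "(g \<circ> p \<circ> inv g) permutes UNIV" if "p permutes UNIV" "bij g" for p and g :: "'c \<Rightarrow> 'd"
    by (rule bij_imp_permutes) (auto intro!: bij_comp permutes_bij[OF that(1)] bij_imp_bij_inv that(2))
  have "det (\<chi> i j. A $ f i $ f j) = (\<Sum>p | p permutes (UNIV::'m set). of_int (sign p) * (\<Prod>i\<in>UNIV. A $ f i $ f (p i)))"
    unfolding det_def by simp
  also have "\<dots> = (\<Sum>p | p permutes (UNIV::'n set). of_int (sign p) * (\<Prod>i\<in>UNIV. A $ i $ p i))"
  proof (rule sum.reindex_bij_witness[of _ "\<lambda>p. inv f \<circ> p \<circ> f" "\<lambda>p. f \<circ> p \<circ> inv f"])
    fix p assume p: "p \<in> {p. p permutes (UNIV::'m set)}"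
    show "inv f \<circ> (f \<circ> p \<circ> inv f) \<circ> f = p" by (auto simp: fun_eq_iff ff)
    show "f \<circ> p \<circ> inv f \<in> {p. p permutes UNIV}" using perm[of p f] p f by blast
    have "(\<Prod>i\<in>UNIV. A $ i $ (f \<circ> p \<circ> inv f) i) = (\<Prod>i\<in>UNIV. A $ f i $ (f \<circ> p \<circ> inv f) (f i))"
      using prod.reindex_bij_betw[OF f, of "\<lambda>i. A $ i $ (f \<circ> p \<circ> inv f) i"] by simp
    then show "of_int (sign (f \<circ> p \<circ> inv f)) * (\<Prod>i\<in>UNIV. A $ i $ (f \<circ> p \<circ> inv f) i)
        = of_int (sign p) * (\<Prod>i\<in>UNIV. A $ f i $ f (p i))"
      using p by (simp add: ff sign_conjugate[OF f])
  next
    fix p assume p: "p \<in> {p. p permutes (UNIV::'n set)}"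
    show "f \<circ> (inv f \<circ> p \<circ> f) \<circ> inv f = p" by (auto simp: fun_eq_iff ff)
    show "inv f \<circ> p \<circ> f \<in> {p. p permutes UNIV}" using perm[of p "inv f"] p bi inv_inv by simp
  qed
  finally show ?thesis unfolding det_def .
qed

lemma prod_Basis_cart:
  fixes g :: "real ^ 'n \<Rightarrow> 'b::comm_monoid_mult"
  shows "(\<Prod>b\<in>Basis. g b) = (\<Prod>i\<in>UNIV. g (axis i 1))"
proof -
  have B: "(Basis :: (real ^ 'n) set) = range (\<lambda>i. axis i 1)" by (auto simp: Basis_vec_def)
  have "inj (\<lambda>i::'n. axis i (1::real))" by (auto simp: inj_on_def axis_eq_axis)
  then show ?thesis unfolding B using prod.reindex[of "\<lambda>i. axis i (1::real)" UNIV g] by (simp add: o_def)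
qed

lemma lborel_reindex:
  fixes f :: "'n::finite \<Rightarrow> 'm::finite"
  assumes f: "bij f"
  shows "distr lborel borel (\<lambda>y :: real ^ 'm. \<chi> i. y $ f i) = lborel"
proof (rule lborel_eqI[symmetric])
  fix l u :: "real ^ 'n" assume le: "\<And>b. b \<in> Basis \<Longrightarrow> l \<bullet> b \<le> u \<bullet> b"
  have ff: "inv f (f a) = a" "f (inv f b) = b" for a b
    using assms(1) by (auto simp: bij_is_inj bij_is_surj surj_f_inv_f)
  have bi: "bij (inv f)" using f by (rule bij_imp_bij_inv)
  define l' u' where "l' = (\<chi> j. l $ inv f j)" and "u' = (\<chi> j. u $ inv f j)"
  have m: "(\<lambda>y :: real ^ 'm. \<chi> i. y $ f i) \<in> borel \<rightarrow>\<^sub>M borel"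
    by (intro borel_measurable_continuous_onI continuous_intros)
  have vim: "(\<lambda>y :: real ^ 'm. \<chi> i. y $ f i) -` box l u = box l' u'"
    unfolding l'_def u'_def by (auto simp: mem_box_cart ff) (metis ff)+
  have "emeasure (distr lborel borel (\<lambda>y :: real ^ 'm. \<chi> i. y $ f i)) (box l u) = emeasure lborel (box l' u')"
    by (subst emeasure_distr) (use m vim in auto)
  also have "\<dots> = (\<Prod>b\<in>Basis. (u' - l') \<bullet> b)"
  proof (rule emeasure_lborel_box)
    fix b :: "real ^ 'm" assume "b \<in> Basis"
    then obtain j where "b = axis j 1" by (auto simp: Basis_vec_def)
    then show "l' \<bullet> b \<le> u' \<bullet> b" using le[of "axis (inv f j) 1"]
      by (simp add: inner_axis l'_def u'_def)
  qed
  also have "(\<Prod>b\<in>Basis. (u' - l') \<bullet> b) = (\<Prod>j\<in>UNIV. (u - l) $ inv f j)"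
    by (simp add: prod_Basis_cart inner_axis l'_def u'_def)
  also have "\<dots> = (\<Prod>b\<in>Basis. (u - l) \<bullet> b)"
    using prod.reindex_bij_betw[OF bi, of "\<lambda>i. (u - l) $ i"] by (simp add: prod_Basis_cart inner_axis)
  finally show "emeasure (distr lborel borel (\<lambda>y :: real ^ 'm. \<chi> i. y $ f i)) (box l u) = (\<Prod>b\<in>Basis. (u - l) \<bullet> b)" .
qed simp

lemma integral_det_zero:
  fixes g :: "real ^ 'n \<Rightarrow> real ^ 'n"
  assumes g: "C1_map UNIV g A" and K: "compact K" "\<And>x. x \<notin> K \<Longrightarrow> g x = 0"
  shows "(\<integral>x. det (A x) \<partial>lborel) = 0"
proof -
  define R where "R y = (\<chi> i. y $ to_copy i)" for y :: "real ^ 'n ordered_copy"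
  define Q where "Q x = (\<chi> j. x $ of_copy j)" for x :: "real ^ 'n"
  have RQ: "R (Q x) = x" "Q (R y) = y" for x y unfolding R_def Q_def by (auto simp: vec_eq_iff)
  have A0: "A x = 0" if "x \<notin> K" for x
  proof -
    have "A x $ i = 0" for i
      by (rule C1_scalar_eq0_grad[of "\<lambda>x. g x $ i" "\<lambda>x. A x $ i" K])
        (use g K that in \<open>auto simp: C1_map_def compact_imp_closed\<close>)
    then show ?thesis by (simp add: vec_eq_iff)
  qed
  have linR: "bounded_linear R" unfolding R_def
    by (auto intro!: linear_conv_bounded_linear[THEN iffD1] linearI simp: vec_eq_iff)
  have linQ: "bounded_linear Q" unfolding Q_def
    by (auto intro!: linear_conv_bounded_linear[THEN iffD1] linearI simp: vec_eq_iff)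
  define A' where "A' y = (\<chi> i j. A (R y) $ of_copy i $ of_copy j)" for y
  have "(\<integral>y. det (A' y) \<partial>lborel) = 0"
  proof (rule integral_det_zero_wellorder[where g="\<lambda>y. Q (g (R y))" and K="Q ` K"])
    show "C1_map UNIV (\<lambda>y. Q (g (R y))) A'"
    proof (rule C1_mapI_has_derivative)
      fix y
      have "((\<lambda>y. Q (g (R y))) has_derivative (\<lambda>h. Q (A (R y) *v R h))) (at y)"
        by (intro bounded_linear.has_derivative[OF linQ] has_derivative_compose[OF bounded_linear.has_derivative[OF linR has_derivative_ident]]
            C1_map_has_derivative[OF g]) auto
      moreover have "Q (A (R y) *v R h) = A' y *v h" for h
      proof -
        have "(\<Sum>j\<in>UNIV. a $ j * h $ to_copy j) = (\<Sum>j\<in>UNIV. a $ of_copy j * h $ j)" for a :: "real ^ 'n"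
          using sum.reindex_bij_betw[OF bij_to_copy, of "\<lambda>j. a $ of_copy j * h $ j"] by simp
        then show ?thesis unfolding A'_def Q_def R_def
          by (simp add: vec_eq_iff matrix_vector_mult_def)
      qed
      ultimately show "((\<lambda>y. Q (g (R y))) has_derivative (\<lambda>h. A' y *v h)) (at y)" by simp
    next
      have "continuous_on UNIV (\<lambda>y. A (R y))"
        by (rule continuous_on_compose2[OF C1_map_continuous_on(2)[OF g]])
          (auto intro!: linear_continuous_on linR)
      then show "continuous_on UNIV A'" unfolding A'_def[abs_def] by (intro continuous_intros)
    qed
    show "compact (Q ` K)" using K(1) linQ by (intro compact_continuous_image linear_continuous_on)
    show "Q (g (R y)) = 0" "A' y = 0" if "y \<notin> Q ` K" for y
    proof -
      have "R y \<notin> K" using that RQ(2) by (metis imageI)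
      then show "Q (g (R y)) = 0" "A' y = 0" using K(2) A0 by (auto simp: Q_def A'_def vec_eq_iff)
    qed
  qed
  moreover have "det (A' y) = det (A (R y))" for y
  proof -
    have "bij (of_copy :: 'n ordered_copy \<Rightarrow> 'n)" by (rule bijI') (metis of_to_copy, metis of_to_copy)
    then show ?thesis unfolding A'_def by (rule det_reindex)
  qed
  moreover have "(\<integral>x. det (A x) \<partial>lborel) = (\<integral>y. det (A (R y)) \<partial>lborel)"
  proof -
    have l: "lborel = distr lborel borel R"
      unfolding R_def[abs_def] by (rule lborel_reindex[OF bij_to_copy, symmetric])
    show ?thesis
      by (subst l, subst integral_distr)
        (auto intro!: borel_measurable_continuous_onI linear_continuous_on linR continuous_on_det C1_map_continuous_on(2)[OF g])
  qed
  ultimately show ?thesis by simp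
qed

definition row_upd :: "real ^ 'n ^ 'n \<Rightarrow> 'n \<Rightarrow> real ^ 'n \<Rightarrow> real ^ 'n ^ 'n" where
  "row_upd A j a = (\<chi> i. if i = j then a else A $ i)"

lemma det_row_upd_add: "det (row_upd A j (a + b)) = det (row_upd A j a) + det (row_upd A j b)"
  unfolding row_upd_def by (rule det_row_add)
lemma det_row_upd_scale: "det (row_upd A j (c *\<^sub>R a)) = c * det (row_upd A j a)"
  unfolding row_upd_def scalar_mult_eq_scaleR[symmetric] by (rule det_row_mul)
lemma row_upd_same: "row_upd A j (A $ j) = A"
  unfolding row_upd_def by (simp add: vec_eq_iff)
lemma det_row_upd_0: "det (row_upd A j 0) = 0"
  using det_row_upd_scale[of A j 0 0] by simp
lemma det_row_upd_sum: "det (row_upd A j (\<Sum>i\<in>I. f i)) = (\<Sum>i\<in>I. det (row_upd A j (f i)))"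
  by (induction I rule: infinite_finite_induct) (auto simp: det_row_upd_0 det_row_upd_add)
lemma det_row_upd_other: "i \<noteq> j \<Longrightarrow> det (row_upd A j (A $ i)) = 0"
  by (rule det_identical_rows[of i j]) (auto simp: row_def row_upd_def vec_eq_iff)

lemma continuous_on_row_upd:
  assumes "continuous_on S A" "continuous_on S a"
  shows "continuous_on S (\<lambda>x. row_upd (A x) j (a x))"
proof -
  have "continuous_on S (\<lambda>x. if i = j then a x else A x $ i)" for i
    using assms by (cases "i = j") (auto intro!: continuous_intros)
  then show ?thesis unfolding row_upd_def by (intro continuous_on_vec_lambda)
qed

lemma integral_det_row_zero:
  fixes w :: "real ^ 'n \<Rightarrow> real ^ 'n"
  assumes U: "open U" and w: "C1_map U w A" and a: "C1_scalar UNIV a a'"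
    and K: "compact K" "K \<subseteq> U" "\<And>x. x \<notin> K \<Longrightarrow> a x = 0"
  shows "(\<integral>x. det (row_upd (A x) j (a' x)) \<partial>lborel) = 0"
proof -
  obtain \<theta> \<theta>' L V where th: "C1_scalar UNIV \<theta> \<theta>'" "compact L" "L \<subseteq> U" "\<And>x. x \<notin> L \<Longrightarrow> \<theta> x = 0"
    "open V" "K \<subseteq> V" "\<And>x. x \<in> V \<Longrightarrow> \<theta> x = 1" "\<And>x. x \<in> V \<Longrightarrow> \<theta>' x = 0"
    using ex_cutoff[OF K(1,2) U] by metis
  define g where "g x = (\<chi> i. if i = j then a x else \<theta> x * w x $ i)" for x
  define B where "B x = (\<chi> i. if i = j then a' x else \<theta> x *\<^sub>R A x $ i + w x $ i *\<^sub>R \<theta>' x)" for x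
  have "C1_map UNIV g B"
    unfolding C1_map_def
  proof
    fix i
    have "C1_scalar UNIV (\<lambda>x. \<theta> x * w x $ i) (\<lambda>x. \<theta> x *\<^sub>R A x $ i + w x $ i *\<^sub>R \<theta>' x)"
      by (rule C1_scalar_extend[OF th(1) compact_imp_closed[OF th(2)] th(3) U th(4)])
        (use w in \<open>auto simp: C1_map_def\<close>)
    then show "C1_scalar UNIV (\<lambda>x. g x $ i) (\<lambda>x. B x $ i)"
      using a by (cases "i = j") (auto simp: g_def B_def)
  qed
  moreover have "g x = 0" if "x \<notin> K \<union> L" for x
    using that K th by (auto simp: g_def vec_eq_iff)
  ultimately have "(\<integral>x. det (B x) \<partial>lborel) = 0"
    using integral_det_zero[of g B "K \<union> L"] K(1) th(2) by auto
  moreover have "det (B x) = det (row_upd (A x) j (a' x))" for x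
  proof (cases "x \<in> K")
    case True
    then show ?thesis using th by (auto simp: B_def row_upd_def subset_iff cong: if_cong)
  next
    case False
    then have "a' x = 0" using C1_scalar_eq0_grad[OF a compact_imp_closed[OF K(1)] K(3)] by blast
    then show ?thesis unfolding B_def
      using det_row_upd_0[of "\<chi> i. \<theta> x *\<^sub>R A x $ i + w x $ i *\<^sub>R \<theta>' x" j] det_row_upd_0[of "A x" j]
      by (simp add: row_upd_def cong: if_cong)
  qed
  ultimately show ?thesis by simp
qed

subsection \<open>The homotopy formula\<close>

lemma det_line_deriv:
  fixes A B :: "real ^ 'n ^ 'n"
  shows "((\<lambda>t. det (A + t *\<^sub>R B)) has_real_derivative (\<Sum>j\<in>UNIV. det (row_upd (A + t *\<^sub>R B) j (B $ j)))) (at t)"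
proof -
  let ?P = "\<lambda>p j. B $ j $ p j * (\<Prod>i\<in>UNIV-{j}. (A + t *\<^sub>R B) $ i $ p i)"
  have "((\<lambda>t. A $ i $ k + t * B $ i $ k) has_derivative (\<lambda>h. h * B $ i $ k)) (at t)" for i k
    by (auto intro!: derivative_eq_intros)
  then have d1: "((\<lambda>t. \<Prod>i\<in>UNIV. A $ i $ p i + t * B $ i $ p i) has_derivative
      (\<lambda>h. \<Sum>j\<in>UNIV. h * B $ j $ p j * (\<Prod>i\<in>UNIV-{j}. A $ i $ p i + t * B $ i $ p i))) (at t)" for p
    by (intro has_derivative_prod)
  have d2: "((\<lambda>t. \<Sum>p | p permutes UNIV. of_int (sign p) * (\<Prod>i\<in>UNIV. A $ i $ p i + t * B $ i $ p i)) has_derivative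
     (\<lambda>h. \<Sum>p | p permutes UNIV. of_int (sign p) * (\<Sum>j\<in>UNIV. h * B $ j $ p j * (\<Prod>i\<in>UNIV-{j}. A $ i $ p i + t * B $ i $ p i)))) (at t)"
    by (intro has_derivative_sum has_derivative_mult_right d1)
  have row: "det (row_upd (A + t *\<^sub>R B) j (B $ j)) = (\<Sum>p | p permutes UNIV. of_int (sign p) * ?P p j)" for j
    unfolding det_def
  proof (intro sum.cong refl arg_cong2[where f="(*)"])
    fix p
    have "(\<Prod>i\<in>UNIV. row_upd (A + t *\<^sub>R B) j (B $ j) $ i $ p i) =
       row_upd (A + t *\<^sub>R B) j (B $ j) $ j $ p j * (\<Prod>i\<in>UNIV-{j}. row_upd (A + t *\<^sub>R B) j (B $ j) $ i $ p i)"
      by (rule prod.remove) auto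
    also have "(\<Prod>i\<in>UNIV-{j}. row_upd (A + t *\<^sub>R B) j (B $ j) $ i $ p i) = (\<Prod>i\<in>UNIV-{j}. (A + t *\<^sub>R B) $ i $ p i)"
      by (rule prod.cong) (auto simp: row_upd_def)
    finally show "(\<Prod>i\<in>UNIV. row_upd (A + t *\<^sub>R B) j (B $ j) $ i $ p i) = ?P p j"
      by (simp add: row_upd_def)
  qed
  have "(\<Sum>p | p permutes UNIV. of_int (sign p) * (\<Sum>j\<in>UNIV. h * B $ j $ p j * (\<Prod>i\<in>UNIV-{j}. A $ i $ p i + t * B $ i $ p i)))
    = (\<Sum>j\<in>UNIV. det (row_upd (A + t *\<^sub>R B) j (B $ j))) * h" for h
    unfolding row sum_distrib_left sum_distrib_right
    by (subst sum.swap) (simp add: algebra_simps)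
  then show ?thesis using d2 unfolding has_field_derivative_def det_def[of "_ + _"] by simp
qed

lemma integrable_compact_support:
  fixes f :: "'a::euclidean_space \<Rightarrow> real"
  assumes "compact K" "continuous_on K f" "\<And>x. x \<notin> K \<Longrightarrow> f x = 0"
  shows "integrable lborel f"
proof -
  have "(\<lambda>x. indicator K x *\<^sub>R f x) = f"
  proof
    fix x show "indicator K x *\<^sub>R f x = f x" by (cases "x \<in> K") (simp_all add: assms)
  qed
  then show ?thesis using borel_integrable_compact[OF assms(1,2)] by simp
qed

lemma homotopy_formula:
  fixes v z :: "real ^ 'n \<Rightarrow> real ^ 'n"
  assumes U: "open U" and v: "C1_map U v A" and z: "C1_map U z B" and phi: "C1_scalar UNIV \<phi> \<phi>'"
    and th: "C1_scalar UNIV \<theta> \<theta>'" and K: "compact K" "K \<subseteq> U" "\<And>x. x \<notin> K \<Longrightarrow> \<theta> x = 0" and T: "0 \<le> T"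
  shows "(\<integral>x. \<theta> x * (\<phi> (v x + T *\<^sub>R z x) * det (A x + T *\<^sub>R B x)) \<partial>lborel) - (\<integral>x. \<theta> x * (\<phi> (v x) * det (A x)) \<partial>lborel)
    = - (\<integral>t. indicator {0..T} t * (\<integral>x. \<phi> (v x + t *\<^sub>R z x) *
          (\<Sum>j\<in>UNIV. z x $ j * det (row_upd (A x + t *\<^sub>R B x) j (\<theta>' x))) \<partial>lborel) \<partial>lborel)"
proof -
  define q where "q t x = \<phi> (v x + t *\<^sub>R z x) * det (A x + t *\<^sub>R B x)" for t x
  define dq where "dq t x = (\<Sum>i\<in>UNIV. \<phi>' (v x + t *\<^sub>R z x) $ i * z x $ i) * det (A x + t *\<^sub>R B x)
     + \<phi> (v x + t *\<^sub>R z x) * (\<Sum>j\<in>UNIV. det (row_upd (A x + t *\<^sub>R B x) j (B x $ j)))" for t x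
  define E where "E t x = \<phi> (v x + t *\<^sub>R z x) * (\<Sum>j\<in>UNIV. z x $ j * det (row_upd (A x + t *\<^sub>R B x) j (\<theta>' x)))" for t x
  have th': "\<theta>' x = 0" if "x \<notin> K" for x
    using C1_scalar_eq0_grad[OF th compact_imp_closed[OF K(1)] K(3) that] .
  have cv: "continuous_on K v" "continuous_on K A" "continuous_on K z" "continuous_on K B"
    using C1_map_continuous_on[OF C1_map_subset[OF v K(2)]] C1_map_continuous_on[OF C1_map_subset[OF z K(2)]] by auto
  have cphi: "continuous_on UNIV \<phi>" "continuous_on UNIV \<phi>'"
    using C1_scalar_continuous_on[OF phi] C1_scalarD(2)[OF phi] by auto
  have cth: "continuous_on K \<theta>" "continuous_on K \<theta>'"
    using C1_scalar_continuous_on[OF th] C1_scalarD(2)[OF th] continuous_on_subset by blast+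
  have cont_E: "continuous_on K (E t)" for t
    unfolding E_def
    by (intro continuous_on_mult continuous_on_sum continuous_on_det continuous_on_row_upd continuous_on_compose2[OF cphi(1)]
      continuous_on_add continuous_on_scaleR continuous_on_const continuous_on_component cv cth subset_UNIV)
  have int_E: "integrable lborel (E t)" for t
    by (rule integrable_compact_support[OF K(1) cont_E]) (auto simp: E_def th' det_row_upd_0)
  have fst_cont: "continuous_on S (\<lambda>p. f (snd p))" if "continuous_on K f" "S \<subseteq> UNIV \<times> K" for f :: "real^'n \<Rightarrow> 'c::topological_space" and S :: "(real \<times> (real^'n)) set"
    by (rule continuous_on_compose2[OF that(1)]) (use that(2) in \<open>auto intro!: continuous_intros\<close>)
  have cont_dq: "continuous_on ({0..T} \<times> K) (\<lambda>p. \<theta> (snd p) * dq (fst p) (snd p))"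
    unfolding dq_def
    by (intro continuous_on_mult continuous_on_sum continuous_on_det continuous_on_row_upd continuous_on_compose2[OF cphi(1)]
       continuous_on_compose2[OF cphi(2)] continuous_on_fst continuous_on_id
      continuous_on_add continuous_on_scaleR continuous_on_const continuous_on_component fst_cont cv cth subset_UNIV) auto
  have cont_dq1: "continuous_on K (\<lambda>x. \<theta> x * dq t x)" for t
    unfolding dq_def
    by (intro continuous_on_mult continuous_on_sum continuous_on_det continuous_on_row_upd continuous_on_compose2[OF cphi(1)]
       continuous_on_compose2[OF cphi(2)]
      continuous_on_add continuous_on_scaleR continuous_on_const continuous_on_component cv cth subset_UNIV)
  have int_dq: "integrable lborel (\<lambda>x. \<theta> x * dq t x)" for t
    by (rule integrable_compact_support[OF K(1) cont_dq1]) (simp add: K)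
  have deriv_q: "((\<lambda>t. q t x) has_real_derivative dq t x) (at t)" for t x
  proof -
    have "((\<lambda>t. \<phi> (v x + t *\<^sub>R z x)) has_derivative (\<lambda>h. \<phi>' (v x + t *\<^sub>R z x) \<bullet> (h *\<^sub>R z x))) (at t)"
      by (rule has_derivative_compose[OF _ C1_scalarD(1)[OF phi UNIV_I]]) (auto intro!: derivative_eq_intros)
    then have "((\<lambda>t. \<phi> (v x + t *\<^sub>R z x)) has_real_derivative (\<Sum>i\<in>UNIV. \<phi>' (v x + t *\<^sub>R z x) $ i * z x $ i)) (at t)"
      unfolding has_field_derivative_def
      by (rule has_derivative_eq_rhs) (auto simp: fun_eq_iff inner_vec_def sum_distrib_left sum_distrib_right algebra_simps)
    from DERIV_mult[OF this det_line_deriv[of "A x" "B x" t]] show ?thesis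
      unfolding q_def dq_def by (simp add: algebra_simps)
  qed
  have key: "(\<integral>x. \<theta> x * dq t x \<partial>lborel) = - (\<integral>x. E t x \<partial>lborel)" for t
  proof -
    define a' where "a' j x = \<theta> x *\<^sub>R (\<phi> (v x + t *\<^sub>R z x) *\<^sub>R B x $ j + z x $ j *\<^sub>R (\<Sum>i\<in>UNIV. \<phi>' (v x + t *\<^sub>R z x) $ i *\<^sub>R (A x + t *\<^sub>R B x) $ i))
        + (\<phi> (v x + t *\<^sub>R z x) * z x $ j) *\<^sub>R \<theta>' x" for j x
    have vt: "C1_map U (\<lambda>x. v x + t *\<^sub>R z x) (\<lambda>x. A x + t *\<^sub>R B x)"
      by (intro C1_map_add C1_map_scaleR_const v z)
    have a: "C1_scalar UNIV (\<lambda>x. \<theta> x * (\<phi> (v x + t *\<^sub>R z x) * z x $ j)) (a' j)" for j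
      unfolding a'_def
      by (rule C1_scalar_extend[OF th compact_imp_closed[OF K(1)] K(2) U K(3)],
        assumption, rule C1_scalar_mult[OF C1_scalar_compose[OF phi vt]]) (use z in \<open>auto simp: C1_map_def\<close>)
    have zero: "(\<integral>x. det (row_upd (A x + t *\<^sub>R B x) j (a' j x)) \<partial>lborel) = 0" for j
      by (rule integral_det_row_zero[OF U vt a K(1,2)]) (simp add: K(3))
    have ca: "continuous_on K (\<lambda>x. det (row_upd (A x + t *\<^sub>R B x) j (a' j x)))" for j
      by (intro continuous_on_det continuous_on_row_upd continuous_on_add continuous_on_scaleR continuous_on_const cv
        continuous_on_subset[OF C1_scalarD(2)[OF a]]) auto
    have a'0: "a' j x = 0" if "x \<notin> K" for x j using that K(3) th' unfolding a'_def by simp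
    have ia: "integrable lborel (\<lambda>x. det (row_upd (A x + t *\<^sub>R B x) j (a' j x)))" for j
      by (rule integrable_compact_support[OF K(1) ca]) (simp add: a'0 det_row_upd_0)
    have "(\<Sum>j\<in>UNIV. det (row_upd (A x + t *\<^sub>R B x) j (a' j x))) = \<theta> x * dq t x + E t x" for x
    proof -
      define M where "M = A x + t *\<^sub>R B x"
      have d: "(\<Sum>i\<in>UNIV. c i * det (row_upd M j (M $ i))) = c j * det M" for c :: "'n \<Rightarrow> real" and j
      proof -
        have "(\<Sum>i\<in>UNIV. c i * det (row_upd M j (M $ i))) = (\<Sum>i\<in>UNIV. if i = j then c i * det M else 0)"
          by (intro sum.cong refl) (simp add: det_row_upd_other row_upd_same)
        then show ?thesis by simp
      qed
      have "det (row_upd M j (a' j x)) = \<theta> x * \<phi> (v x + t *\<^sub>R z x) * det (row_upd M j (B x $ j))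
        + \<theta> x * z x $ j * (\<phi>' (v x + t *\<^sub>R z x) $ j * det M)
        + \<phi> (v x + t *\<^sub>R z x) * z x $ j * det (row_upd M j (\<theta>' x))" for j
        unfolding a'_def M_def[symmetric]
        using d[of "\<lambda>i. \<phi>' (v x + t *\<^sub>R z x) $ i" j]
        by (simp add: det_row_upd_add det_row_upd_scale det_row_upd_sum algebra_simps)
      then show ?thesis unfolding dq_def E_def M_def[symmetric]
        by (simp add: sum.distrib sum_distrib_left sum_distrib_right algebra_simps)
    qed
    then have "(\<integral>x. \<theta> x * dq t x + E t x \<partial>lborel) = (\<Sum>j\<in>UNIV. \<integral>x. det (row_upd (A x + t *\<^sub>R B x) j (a' j x)) \<partial>lborel)"
      using ia by (subst Bochner_Integration.integral_sum[symmetric]) auto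
    then show ?thesis using zero int_dq[of t] int_E[of t] by simp
  qed
  have FTC: "(\<integral>t. indicator {0..T} t * (\<theta> x * dq t x) \<partial>lborel) = \<theta> x * (q T x - q 0 x)" for x
  proof (cases "x \<in> K")
    case True
    have "continuous_on UNIV (\<lambda>t. dq t x)"
      unfolding dq_def
      by (intro continuous_on_mult continuous_on_sum continuous_on_det continuous_on_row_upd continuous_on_compose2[OF cphi(1)]
       continuous_on_compose2[OF cphi(2)] continuous_on_id
      continuous_on_add continuous_on_scaleR continuous_on_const continuous_on_component subset_UNIV)
    then have "(\<integral>t. dq t x * indicator {0..T} t \<partial>lborel) = q T x - q 0 x"
      by (intro integral_FTC_Icc_real T deriv_q) (auto simp: continuous_on_eq_continuous_at)
    then have "\<theta> x * (\<integral>t. dq t x * indicator {0..T} t \<partial>lborel) = \<theta> x * (q T x - q 0 x)" by simp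
    then show ?thesis by (simp add: integral_mult_right_zero[symmetric] algebra_simps del: integral_mult_right_zero)
  qed (simp add: K)
  have "integrable (lborel \<Otimes>\<^sub>M lborel) (\<lambda>(t, x). indicator {0..T} t * (\<theta> x * dq t x))"
  proof -
    have "integrable lborel (\<lambda>p. indicator ({0..T} \<times> K) p *\<^sub>R (\<theta> (snd p) * dq (fst p) (snd p)))"
      by (intro borel_integrable_compact cont_dq compact_Times K) auto
    moreover have "(\<lambda>p. indicator ({0..T} \<times> K) p *\<^sub>R (\<theta> (snd p) * dq (fst p) (snd p))) = (\<lambda>(t, x). indicator {0..T} t * (\<theta> x * dq t x))"
      using K(3) by (auto simp: fun_eq_iff indicator_def)
    ultimately show ?thesis by (simp add: lborel_prod)
  qed
  from lborel_pair.Fubini_integral[OF this]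
  have "(\<integral>x. \<theta> x * (q T x - q 0 x) \<partial>lborel) = (\<integral>t. indicator {0..T} t * (\<integral>x. \<theta> x * dq t x \<partial>lborel) \<partial>lborel)"
    unfolding FTC by simp
  also have "\<dots> = - (\<integral>t. indicator {0..T} t * (\<integral>x. E t x \<partial>lborel) \<partial>lborel)"
    unfolding key by simp
  finally have main: "(\<integral>x. \<theta> x * (q T x - q 0 x) \<partial>lborel) = - (\<integral>t. indicator {0..T} t * (\<integral>x. E t x \<partial>lborel) \<partial>lborel)" .
  have cont_q: "continuous_on K (\<lambda>x. \<theta> x * q t x)" for t
    unfolding q_def
    by (intro continuous_on_mult continuous_on_det continuous_on_compose2[OF cphi(1)]
      continuous_on_add continuous_on_scaleR continuous_on_const cv cth subset_UNIV)
  have iq: "integrable lborel (\<lambda>x. \<theta> x * q t x)" for t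
    by (rule integrable_compact_support[OF K(1) cont_q]) (simp add: K)
  have "(\<integral>x. \<theta> x * (q T x - q 0 x) \<partial>lborel) = (\<integral>x. \<theta> x * q T x \<partial>lborel) - (\<integral>x. \<theta> x * q 0 x \<partial>lborel)"
    using iq by (simp add: right_diff_distrib)
  then show ?thesis using main unfolding q_def E_def by simp
qed

lemma degree_integral_homotopy:
  fixes v w :: "real ^ 'n \<Rightarrow> real ^ 'n"
  assumes U: "open U" "bounded U" and v: "C1_map U v A" and w: "C1_map U w B" and phi: "C1_scalar UNIV \<phi> \<phi>'"
    and cont: "continuous_on (closure U) v" "continuous_on (closure U) w"
    and S: "closed S" "\<And>y. y \<notin> S \<Longrightarrow> \<phi> y = 0"
    and off: "\<And>x t. x \<in> frontier U \<Longrightarrow> t \<in> {0..1} \<Longrightarrow> v x + t *\<^sub>R (w x - v x) \<notin> S"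
  shows "(LINT x:U|lborel. \<phi> (v x) * det (A x)) = (LINT x:U|lborel. \<phi> (w x) * det (B x))"
proof -
  define P where "P = {p \<in> {0..1::real} \<times> closure U. v (snd p) + fst p *\<^sub>R (w (snd p) - v (snd p)) \<in> S}"
  have "compact ({0..1::real} \<times> closure U)" using U by (intro compact_Times) auto
  moreover have "closed P"
  proof -
    have "continuous_on ({0..1::real} \<times> closure U) (\<lambda>p. f (snd p))" if "continuous_on (closure U) f" for f :: "real^'n \<Rightarrow> real^'n"
      by (rule continuous_on_compose2[OF that]) (auto intro!: continuous_intros)
    then have "continuous_on ({0..1::real} \<times> closure U) (\<lambda>p. v (snd p) + fst p *\<^sub>R (w (snd p) - v (snd p)))"
      using cont by (auto intro!: continuous_intros)
    from continuous_closed_preimage[OF this _ S(1)] show ?thesis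
      unfolding P_def by (simp add: closed_Times vimage_def Int_def)
  qed
  ultimately have "compact P" unfolding P_def by (metis (no_types, lifting) closed_Int_compact Int_absorb2 mem_Collect_eq subsetI)
  define K where "K = snd ` P"
  have K: "compact K" unfolding K_def using \<open>compact P\<close> by (intro compact_continuous_image continuous_intros)
  have K_iff: "x \<in> K \<longleftrightarrow> x \<in> closure U \<and> (\<exists>t\<in>{0..1}. v x + t *\<^sub>R (w x - v x) \<in> S)" for x
    unfolding K_def P_def by force
  have KU: "K \<subseteq> U"
  proof
    fix x assume "x \<in> K"
    then have "x \<in> closure U" "x \<notin> frontier U" using off K_iff by blast+
    then show "x \<in> U" using U(1) by (simp add: frontier_def interior_open)
  qed
  obtain \<theta> \<theta>' L V where th: "C1_scalar UNIV \<theta> \<theta>'" "compact L" "L \<subseteq> U" "\<And>x. x \<notin> L \<Longrightarrow> \<theta> x = 0"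
    "open V" "K \<subseteq> V" "\<And>x. x \<in> V \<Longrightarrow> \<theta> x = 1" "\<And>x. x \<in> V \<Longrightarrow> \<theta>' x = 0"
    using ex_cutoff[OF K KU U(1)] by metis
  have z: "C1_map U (\<lambda>x. w x - v x) (\<lambda>x. B x - A x)" by (intro C1_map_diff v w)
  have phi0: "\<phi> (v x + t *\<^sub>R (w x - v x)) = 0" if "x \<in> U" "x \<notin> K" "t \<in> {0..1}" for x t
    using that K_iff S(2) closure_subset by blast
  have th': "\<theta>' x = 0" if "x \<notin> L" for x
    using C1_scalar_eq0_grad[OF th(1) compact_imp_closed[OF th(2)] th(4) that] .
  have "\<phi> (v x + t *\<^sub>R (w x - v x)) * (\<Sum>j\<in>UNIV. (w x - v x) $ j * det (row_upd (A x + t *\<^sub>R (B x - A x)) j (\<theta>' x))) = 0"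
    if "t \<in> {0..1}" for t x
  proof (cases "x \<in> L - K")
    case True then show ?thesis using phi0 th(3) that by auto
  next
    case False
    then have "\<theta>' x = 0" using th' th(6,8) by blast
    then show ?thesis by (simp add: det_row_upd_0)
  qed
  note Z = this
  have zero: "(\<lambda>t. indicator {0..1} t * (\<integral>x. \<phi> (v x + t *\<^sub>R (w x - v x)) *
          (\<Sum>j\<in>UNIV. (w x - v x) $ j * det (row_upd (A x + t *\<^sub>R (B x - A x)) j (\<theta>' x))) \<partial>lborel)) = (\<lambda>t. 0)"
  proof
    fix t :: real
    show "indicator {0..1} t * (\<integral>x. \<phi> (v x + t *\<^sub>R (w x - v x)) *
          (\<Sum>j\<in>UNIV. (w x - v x) $ j * det (row_upd (A x + t *\<^sub>R (B x - A x)) j (\<theta>' x))) \<partial>lborel) = 0"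
    proof (cases "t \<in> {0..1}")
      case True then show ?thesis by (simp only: Z integral_zero mult_zero_right)
    next
      case False then have "indicator {0..1} t = (0 :: real)" by (simp add: indicator_def)
      then show ?thesis by (simp only: mult_zero_left)
    qed
  qed
  have "(\<integral>x. \<theta> x * (\<phi> (w x) * det (B x)) \<partial>lborel) = (\<integral>x. \<theta> x * (\<phi> (v x) * det (A x)) \<partial>lborel)"
    using homotopy_formula[OF U(1) v z phi th(1,2,3,4), of 1] unfolding zero by simp
  moreover have "\<theta> x * (\<phi> (w x) * det (B x)) = indicator U x *\<^sub>R (\<phi> (w x) * det (B x))" for x
    using th(3,4,6,7) phi0[of x 1] KU by (cases "x \<in> K"; cases "x \<in> U") auto
  moreover have "\<theta> x * (\<phi> (v x) * det (A x)) = indicator U x *\<^sub>R (\<phi> (v x) * det (A x))" for x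
    using th(3,4,6,7) phi0[of x 0] KU by (cases "x \<in> K"; cases "x \<in> U") auto
  ultimately show ?thesis unfolding set_lebesgue_integral_def by simp
qed

subsection \<open>Localised estimate of the degree integral\<close>

lemma One_component: "(One :: real ^ 'n) $ i = 1"
proof -
  have "One \<bullet> axis i (1 :: real) = 1"
    using inner_sum_left_Basis[of "axis i 1 :: real ^ 'n" "\<lambda>_. 1"] by simp
  then show ?thesis by (simp add: inner_axis)
qed

lemma real_card_ge_1: "real CARD('n::finite) \<ge> 1"
proof -
  have "CARD('n) > 0" by simp
  then show ?thesis by linarith
qed

lemma nn_integral_affine:
  fixes c :: "'a::euclidean_space"
  assumes [measurable]: "f \<in> borel_measurable borel" and t: "t > 0"
  shows "(\<integral>\<^sup>+x. f (c + t *\<^sub>R x) \<partial>lborel) = ennreal (t powr - real DIM('a)) * (\<integral>\<^sup>+x. f x \<partial>lborel)"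
proof -
  have "(\<integral>\<^sup>+x. f x \<partial>lborel) = (\<integral>\<^sup>+x. f x \<partial>density (distr lborel borel (\<lambda>x. c + t *\<^sub>R x)) (\<lambda>_. \<bar>t\<bar>^DIM('a)))"
    using t by (subst lborel_affine[of t c]) auto
  also have "\<dots> = (\<integral>\<^sup>+x. ennreal (t ^ DIM('a)) * f (c + t *\<^sub>R x) \<partial>lborel)"
    using t by (simp add: nn_integral_density nn_integral_distr)
  also have "\<dots> = ennreal (t ^ DIM('a)) * (\<integral>\<^sup>+x. f (c + t *\<^sub>R x) \<partial>lborel)"
    by (rule nn_integral_cmult) measurable
  finally have "ennreal (t powr - real DIM('a)) * (\<integral>\<^sup>+x. f x \<partial>lborel)
     = ennreal (t powr - real DIM('a)) * (ennreal (t ^ DIM('a)) * (\<integral>\<^sup>+x. f (c + t *\<^sub>R x) \<partial>lborel))" by simp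
  also have "\<dots> = ennreal (t powr - real DIM('a) * t ^ DIM('a)) * (\<integral>\<^sup>+x. f (c + t *\<^sub>R x) \<partial>lborel)"
    using t by (simp add: ennreal_mult mult.assoc)
  also have "t powr - real DIM('a) * t ^ DIM('a) = 1"
    using t by (simp add: powr_minus powr_realpow)
  finally show ?thesis by simp
qed

lemma le_powr_interpolate:
  fixes a l q :: real
  assumes "a \<ge> 0" "l > 0" "q \<ge> 1" shows "a \<le> l + l powr (1 - q) * a powr q"
proof (cases "a \<le> l")
  case False
  have "l powr (q - 1) \<le> a powr (q - 1)" using False assms by (intro powr_mono2) auto
  then have "a * l powr (q - 1) \<le> a * a powr (q - 1)" using assms by (intro mult_left_mono)
  also have "a * a powr (q - 1) = a powr q" using False assms by (simp add: powr_mult_base)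
  finally have "a * l powr (q - 1) * l powr (1 - q) \<le> a powr q * l powr (1 - q)"
    by (intro mult_right_mono) auto
  moreover have "l powr (q - 1) * l powr (1 - q) = 1" using assms by (simp add: powr_add[symmetric])
  ultimately have "a \<le> a powr q * l powr (1 - q)" by (simp add: mult.assoc)
  then show ?thesis using assms by (simp add: mult.commute)
qed (use assms in \<open>simp add: add_increasing2\<close>)

lemma cube_average_le:
  fixes \<phi> :: "real ^ 'n \<Rightarrow> real"
  assumes [measurable]: "\<phi> \<in> borel_measurable borel" and t: "t > 0" and q: "q \<ge> 1" and N: "N > 0"
    and I: "(\<integral>\<^sup>+y. ennreal (\<bar>\<phi> y\<bar> powr q) \<partial>lborel) \<le> ennreal (N powr q)"
  shows "(\<integral>\<^sup>+e. indicator (cbox 0 One) e * ennreal \<bar>\<phi> (c + t *\<^sub>R e)\<bar> \<partial>lborel)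
    \<le> ennreal (2 * N * t powr (- real CARD('n) / q))"
proof -
  define l where "l = N * t powr (- real CARD('n) / q)"
  have l: "l > 0" using N t by (simp add: l_def)
  have "(\<integral>\<^sup>+e. indicator (cbox 0 One) e * ennreal \<bar>\<phi> (c + t *\<^sub>R e)\<bar> \<partial>lborel)
    \<le> (\<integral>\<^sup>+e. ennreal l * indicator (cbox 0 One) e + ennreal (l powr (1 - q)) * ennreal (\<bar>\<phi> (c + t *\<^sub>R e)\<bar> powr q) \<partial>lborel)"
  proof (rule nn_integral_mono)
    fix e :: "real ^ 'n"
    have "ennreal \<bar>\<phi> (c + t *\<^sub>R e)\<bar> \<le> ennreal (l + l powr (1 - q) * \<bar>\<phi> (c + t *\<^sub>R e)\<bar> powr q)"
      by (intro ennreal_leI le_powr_interpolate l q) auto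
    then have "ennreal \<bar>\<phi> (c + t *\<^sub>R e)\<bar> \<le> ennreal l + ennreal (l powr (1 - q)) * ennreal (\<bar>\<phi> (c + t *\<^sub>R e)\<bar> powr q)"
      using l by (simp add: ennreal_mult)
    then show "indicator (cbox 0 One) e * ennreal \<bar>\<phi> (c + t *\<^sub>R e)\<bar>
      \<le> ennreal l * indicator (cbox 0 One) e + ennreal (l powr (1 - q)) * ennreal (\<bar>\<phi> (c + t *\<^sub>R e)\<bar> powr q)"
      by (auto simp: indicator_def)
  qed
  also have "\<dots> = (\<integral>\<^sup>+e. ennreal l * indicator (cbox 0 One) (e :: real ^ 'n) \<partial>lborel)
     + (\<integral>\<^sup>+e. ennreal (l powr (1 - q)) * ennreal (\<bar>\<phi> (c + t *\<^sub>R e)\<bar> powr q) \<partial>lborel)"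
    by (rule nn_integral_add) measurable
  also have "(\<integral>\<^sup>+e. ennreal l * indicator (cbox 0 One) (e :: real ^ 'n) \<partial>lborel) = ennreal l"
    by (simp add: nn_integral_cmult_indicator emeasure_lborel_cbox_eq)
  also have "(\<integral>\<^sup>+e. ennreal (l powr (1 - q)) * ennreal (\<bar>\<phi> (c + t *\<^sub>R e)\<bar> powr q) \<partial>lborel)
     = ennreal (l powr (1 - q)) * (\<integral>\<^sup>+e. ennreal (\<bar>\<phi> (c + t *\<^sub>R e)\<bar> powr q) \<partial>lborel)"
    by (rule nn_integral_cmult) measurable
  also have "(\<integral>\<^sup>+e. ennreal (\<bar>\<phi> (c + t *\<^sub>R e)\<bar> powr q) \<partial>lborel)
     = ennreal (t powr - real CARD('n)) * (\<integral>\<^sup>+y. ennreal (\<bar>\<phi> y\<bar> powr q) \<partial>lborel)"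
    using nn_integral_affine[of "\<lambda>y. ennreal (\<bar>\<phi> y\<bar> powr q)" t c] t by simp
  also have "ennreal (l powr (1 - q)) * (ennreal (t powr - real CARD('n)) * (\<integral>\<^sup>+y. ennreal (\<bar>\<phi> y\<bar> powr q) \<partial>lborel))
     \<le> ennreal (l powr (1 - q)) * (ennreal (t powr - real CARD('n)) * ennreal (N powr q))"
    by (intro mult_left_mono I) auto
  also have "\<dots> = ennreal (l powr (1 - q) * (t powr - real CARD('n) * N powr q))"
    by (simp add: ennreal_mult)
  also have "l powr (1 - q) * (t powr - real CARD('n) * N powr q) = l"
  proof -
    have "l powr (1 - q) = N powr (1 - q) * t powr (- real CARD('n) / q * (1 - q))"
      unfolding l_def using N t by (simp add: powr_mult powr_powr)
    then have "l powr (1 - q) * (t powr - real CARD('n) * N powr q)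
       = (N powr (1 - q) * N powr q) * (t powr (- real CARD('n) / q * (1 - q)) * t powr - real CARD('n))"
      by simp
    also have "\<dots> = N powr 1 * t powr (- real CARD('n) / q * (1 - q) + - real CARD('n))"
      by (simp only: powr_add[symmetric]) simp
    also have "- real CARD('n) / q * (1 - q) + - real CARD('n) = - real CARD('n) / q"
      using q by (simp add: field_simps)
    finally show ?thesis using N by (simp add: l_def)
  qed
  finally show ?thesis using l by (simp add: l_def mult.assoc ennreal_plus[symmetric] del: ennreal_plus)
qed

lemma norm_integral_le_nn_integral:
  fixes f :: "'a \<Rightarrow> real"
  shows "ennreal \<bar>\<integral>x. f x \<partial>M\<bar> \<le> (\<integral>\<^sup>+x. ennreal \<bar>f x\<bar> \<partial>M)"
  using integral_norm_bound_ennreal[of M f] by (cases "integrable M f") (auto simp: not_integrable_integral_eq)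

lemma nn_integral_powr_from_0:
  assumes "s < 1" "T > 0"
  shows "(\<integral>\<^sup>+t. indicator {0..T} t * ennreal (t powr (- s)) \<partial>lborel) = ennreal (T powr (1 - s) / (1 - s))"
proof -
  have "((\<lambda>x. x powr (- s)) has_integral T powr (- s + 1) / (- s + 1)) {0..T}"
    by (rule has_integral_powr_from_0) (use assms in auto)
  from nn_integral_has_integral_lebesgue[OF _ this] show ?thesis
    by (simp add: ennreal_mult' ennreal_indicator)
qed

text \<open>The translates \<open>w + t e\<close> with \<open>t \<in> [0, T]\<close> are homotopic to \<open>w\<close>. Averaging the homotopy
  formula over \<open>e\<close> in the unit cube turns the values of \<open>\<phi>\<close> into averages over cubes, which are
  controlled by the \<open>L\<^sup>q\<close> norm of \<open>\<phi>\<close>.\<close>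

lemma localized_degree_estimate:
  fixes w :: "real ^ 'n \<Rightarrow> real ^ 'n"
  assumes w: "C1_map UNIV w A" and phi: "C1_scalar UNIV \<phi> \<phi>'" and th: "C1_scalar UNIV \<theta> \<theta>'"
    and K: "compact K" "\<And>x. x \<notin> K \<Longrightarrow> \<theta> x = 0"
    and q: "q > real CARD('n)" and T: "T > 0" and N: "N > 0"
    and I: "(\<integral>\<^sup>+y. ennreal (\<bar>\<phi> y\<bar> powr q) \<partial>lborel) \<le> ennreal (N powr q)"
    and A0: "(\<integral>\<^sup>+x. ennreal \<bar>\<theta> x * det (A x)\<bar> \<partial>lborel) \<le> ennreal A0" "0 \<le> A0"
    and A1: "(\<integral>\<^sup>+x. ennreal (\<Sum>j\<in>UNIV. \<bar>det (row_upd (A x) j (\<theta>' x))\<bar>) \<partial>lborel) \<le> ennreal A1" "0 \<le> A1"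
  shows "\<bar>\<integral>x. \<theta> x * (\<phi> (w x) * det (A x)) \<partial>lborel\<bar>
     \<le> 2 * N * (A0 * T powr (- real CARD('n) / q) + A1 * (T powr (1 - real CARD('n) / q) / (1 - real CARD('n) / q)))"
proof -
  let ?n = "real CARD('n)"
  let ?E = "cbox 0 One :: (real ^ 'n) set"
  have q1: "q \<ge> 1" "?n / q < 1" "q > 0"
  proof -
    show "q \<ge> 1" "q > 0" using q real_card_ge_1[where 'n='n] by linarith+
    then show "?n / q < 1" using q by simp
  qed
  define X where "X = (\<integral>x. \<theta> x * (\<phi> (w x) * det (A x)) \<partial>lborel)"
  define a where "a x = ennreal \<bar>\<theta> x * det (A x)\<bar>" for x
  define m where "m x = ennreal (\<Sum>j\<in>UNIV. \<bar>det (row_upd (A x) j (\<theta>' x))\<bar>)" for x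
  have cont: "continuous_on UNIV w" "continuous_on UNIV A" "continuous_on UNIV \<phi>" "continuous_on UNIV \<theta>" "continuous_on UNIV \<theta>'"
    using C1_map_continuous_on[OF w] C1_scalar_continuous_on[OF phi] C1_scalar_continuous_on[OF th] C1_scalarD(2)[OF th] by auto
  have [measurable]: "w \<in> borel_measurable borel" "\<phi> \<in> borel_measurable borel"
    by (auto intro!: borel_measurable_continuous_onI cont)
  have [measurable]: "a \<in> borel_measurable borel"
    unfolding a_def[abs_def]
    by (intro measurable_compose[OF borel_measurable_continuous_onI measurable_ennreal]) (intro continuous_intros continuous_on_det cont)
  have [measurable]: "m \<in> borel_measurable borel"
    unfolding m_def[abs_def]
    by (intro measurable_compose[OF borel_measurable_continuous_onI measurable_ennreal])
      (intro continuous_intros continuous_on_det continuous_on_row_upd cont)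
  have avg: "(\<integral>\<^sup>+e. indicator ?E e * ennreal \<bar>\<phi> (w x + t *\<^sub>R e)\<bar> \<partial>lborel) \<le> ennreal (2 * N * t powr (- ?n / q))"
    if "t > 0" for x t by (rule cube_average_le) (use that q1 N I in auto)
  have pw: "ennreal \<bar>X\<bar> \<le> (\<integral>\<^sup>+x. a x * ennreal \<bar>\<phi> (w x + T *\<^sub>R e)\<bar> \<partial>lborel)
     + (\<integral>\<^sup>+t. indicator {0..T} t * (\<integral>\<^sup>+x. m x * ennreal \<bar>\<phi> (w x + t *\<^sub>R e)\<bar> \<partial>lborel) \<partial>lborel)"
    if e: "e \<in> ?E" for e
  proof -
    have ej: "\<bar>e $ j\<bar> \<le> 1" for j
    proof -
      have "(0 :: real ^ 'n) $ j \<le> e $ j" "e $ j \<le> (One :: real ^ 'n) $ j"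
        using e unfolding mem_box_cart by blast+
      then show ?thesis using One_component[of j] by simp
    qed
    define J where "J t = (\<integral>x. \<phi> (w x + t *\<^sub>R e) * (\<Sum>j\<in>UNIV. e $ j * det (row_upd (A x) j (\<theta>' x))) \<partial>lborel)" for t
    have "(\<integral>x. \<theta> x * (\<phi> (w x + T *\<^sub>R e) * det (A x)) \<partial>lborel) - X = - (\<integral>t. indicator {0..T} t * J t \<partial>lborel)"
      using homotopy_formula[OF open_UNIV w C1_map_const[of UNIV e] phi th K(1) subset_UNIV K(2), of T] T
      unfolding X_def J_def by simp
    then have "\<bar>X\<bar> \<le> \<bar>\<integral>x. \<theta> x * (\<phi> (w x + T *\<^sub>R e) * det (A x)) \<partial>lborel\<bar> + \<bar>\<integral>t. indicator {0..T} t * J t \<partial>lborel\<bar>"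
      by linarith
    then have "ennreal \<bar>X\<bar> \<le> ennreal \<bar>\<integral>x. \<theta> x * (\<phi> (w x + T *\<^sub>R e) * det (A x)) \<partial>lborel\<bar> + ennreal \<bar>\<integral>t. indicator {0..T} t * J t \<partial>lborel\<bar>"
      by (simp add: ennreal_plus[symmetric] ennreal_leI del: ennreal_plus)
    also have "\<dots> \<le> (\<integral>\<^sup>+x. ennreal \<bar>\<theta> x * (\<phi> (w x + T *\<^sub>R e) * det (A x))\<bar> \<partial>lborel) + (\<integral>\<^sup>+t. ennreal \<bar>indicator {0..T} t * J t\<bar> \<partial>lborel)"
      by (intro add_mono norm_integral_le_nn_integral)
    also have "(\<integral>\<^sup>+x. ennreal \<bar>\<theta> x * (\<phi> (w x + T *\<^sub>R e) * det (A x))\<bar> \<partial>lborel) = (\<integral>\<^sup>+x. a x * ennreal \<bar>\<phi> (w x + T *\<^sub>R e)\<bar> \<partial>lborel)"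
      unfolding a_def by (simp add: ennreal_mult[symmetric] abs_mult ac_simps)
    also have "(\<integral>\<^sup>+t. ennreal \<bar>indicator {0..T} t * J t\<bar> \<partial>lborel) \<le> (\<integral>\<^sup>+t. indicator {0..T} t * (\<integral>\<^sup>+x. m x * ennreal \<bar>\<phi> (w x + t *\<^sub>R e)\<bar> \<partial>lborel) \<partial>lborel)"
    proof (rule nn_integral_mono)
      fix t
      have "ennreal \<bar>J t\<bar> \<le> (\<integral>\<^sup>+x. ennreal \<bar>\<phi> (w x + t *\<^sub>R e) * (\<Sum>j\<in>UNIV. e $ j * det (row_upd (A x) j (\<theta>' x)))\<bar> \<partial>lborel)"
        unfolding J_def by (rule norm_integral_le_nn_integral)
      also have "\<dots> \<le> (\<integral>\<^sup>+x. m x * ennreal \<bar>\<phi> (w x + t *\<^sub>R e)\<bar> \<partial>lborel)"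
      proof (rule nn_integral_mono)
        fix x
        have "\<bar>\<Sum>j\<in>UNIV. e $ j * det (row_upd (A x) j (\<theta>' x))\<bar> \<le> (\<Sum>j\<in>UNIV. \<bar>e $ j * det (row_upd (A x) j (\<theta>' x))\<bar>)"
          by (rule sum_abs)
        also have "\<dots> \<le> (\<Sum>j\<in>UNIV. \<bar>det (row_upd (A x) j (\<theta>' x))\<bar>)"
          using ej by (intro sum_mono) (auto simp: abs_mult mult_left_le_one_le)
        finally have "\<bar>\<phi> (w x + t *\<^sub>R e) * (\<Sum>j\<in>UNIV. e $ j * det (row_upd (A x) j (\<theta>' x)))\<bar>
          \<le> (\<Sum>j\<in>UNIV. \<bar>det (row_upd (A x) j (\<theta>' x))\<bar>) * \<bar>\<phi> (w x + t *\<^sub>R e)\<bar>"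
          by (simp add: abs_mult mult.commute mult_left_mono)
        then show "ennreal \<bar>\<phi> (w x + t *\<^sub>R e) * (\<Sum>j\<in>UNIV. e $ j * det (row_upd (A x) j (\<theta>' x)))\<bar> \<le> m x * ennreal \<bar>\<phi> (w x + t *\<^sub>R e)\<bar>"
          unfolding m_def by (simp add: ennreal_mult[symmetric] sum_nonneg ennreal_leI)
      qed
      finally show "ennreal \<bar>indicator {0..T} t * J t\<bar> \<le> indicator {0..T} t * (\<integral>\<^sup>+x. m x * ennreal \<bar>\<phi> (w x + t *\<^sub>R e)\<bar> \<partial>lborel)"
        by (auto simp: indicator_def)
    qed
    finally show ?thesis by (simp add: add_left_mono)
  qed
  have "ennreal \<bar>X\<bar> = (\<integral>\<^sup>+e. ennreal \<bar>X\<bar> * indicator ?E e \<partial>lborel)"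
    by (simp add: nn_integral_cmult_indicator emeasure_lborel_cbox_eq)
  also have "\<dots> \<le> (\<integral>\<^sup>+e. (\<integral>\<^sup>+x. indicator ?E e * (a x * ennreal \<bar>\<phi> (w x + T *\<^sub>R e)\<bar>) \<partial>lborel)
     + (\<integral>\<^sup>+t. \<integral>\<^sup>+x. indicator {0..T} t * m x * (indicator ?E e * ennreal \<bar>\<phi> (w x + t *\<^sub>R e)\<bar>) \<partial>lborel \<partial>lborel) \<partial>lborel)"
  proof (rule nn_integral_mono)
    fix e :: "real ^ 'n"
    show "ennreal \<bar>X\<bar> * indicator ?E e \<le> (\<integral>\<^sup>+x. indicator ?E e * (a x * ennreal \<bar>\<phi> (w x + T *\<^sub>R e)\<bar>) \<partial>lborel)
     + (\<integral>\<^sup>+t. \<integral>\<^sup>+x. indicator {0..T} t * m x * (indicator ?E e * ennreal \<bar>\<phi> (w x + t *\<^sub>R e)\<bar>) \<partial>lborel \<partial>lborel)"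
    proof (cases "e \<in> ?E")
      case True
      then show ?thesis using pw[OF True] by (simp add: mult.assoc nn_integral_cmult)
    qed simp
  qed
  also have "\<dots> = (\<integral>\<^sup>+e. (\<integral>\<^sup>+x. indicator ?E e * (a x * ennreal \<bar>\<phi> (w x + T *\<^sub>R e)\<bar>) \<partial>lborel) \<partial>lborel)
     + (\<integral>\<^sup>+e. (\<integral>\<^sup>+t. \<integral>\<^sup>+x. indicator {0..T} t * m x * (indicator ?E e * ennreal \<bar>\<phi> (w x + t *\<^sub>R e)\<bar>) \<partial>lborel \<partial>lborel) \<partial>lborel)"
    by (rule nn_integral_add) measurable
  also have "(\<integral>\<^sup>+e. (\<integral>\<^sup>+x. indicator ?E e * (a x * ennreal \<bar>\<phi> (w x + T *\<^sub>R e)\<bar>) \<partial>lborel) \<partial>lborel)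
     = (\<integral>\<^sup>+x. (\<integral>\<^sup>+e. indicator ?E e * (a x * ennreal \<bar>\<phi> (w x + T *\<^sub>R e)\<bar>) \<partial>lborel) \<partial>lborel)"
    by (rule lborel_pair.Fubini') measurable
  also have "\<dots> \<le> (\<integral>\<^sup>+x. a x * ennreal (2 * N * T powr (- ?n / q)) \<partial>lborel)"
  proof (rule nn_integral_mono)
    fix x
    have "(\<integral>\<^sup>+e. indicator ?E e * (a x * ennreal \<bar>\<phi> (w x + T *\<^sub>R e)\<bar>) \<partial>lborel)
       = (\<integral>\<^sup>+e. a x * (indicator ?E e * ennreal \<bar>\<phi> (w x + T *\<^sub>R e)\<bar>) \<partial>lborel)" by (simp add: ac_simps)
    also have "\<dots> = a x * (\<integral>\<^sup>+e. indicator ?E e * ennreal \<bar>\<phi> (w x + T *\<^sub>R e)\<bar> \<partial>lborel)"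
      by (rule nn_integral_cmult) measurable
    also have "\<dots> \<le> a x * ennreal (2 * N * T powr (- ?n / q))" by (intro mult_left_mono avg T) auto
    finally show "(\<integral>\<^sup>+e. indicator ?E e * (a x * ennreal \<bar>\<phi> (w x + T *\<^sub>R e)\<bar>) \<partial>lborel) \<le> a x * ennreal (2 * N * T powr (- ?n / q))" .
  qed
  also have "\<dots> = (\<integral>\<^sup>+x. a x \<partial>lborel) * ennreal (2 * N * T powr (- ?n / q))"
    by (rule nn_integral_multc) measurable
  also have "\<dots> \<le> ennreal A0 * ennreal (2 * N * T powr (- ?n / q))"
    using A0 unfolding a_def by (intro mult_right_mono) auto
  also have "(\<integral>\<^sup>+e. (\<integral>\<^sup>+t. \<integral>\<^sup>+x. indicator {0..T} t * m x * (indicator ?E e * ennreal \<bar>\<phi> (w x + t *\<^sub>R e)\<bar>) \<partial>lborel \<partial>lborel) \<partial>lborel)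
     = (\<integral>\<^sup>+t. (\<integral>\<^sup>+e. \<integral>\<^sup>+x. indicator {0..T} t * m x * (indicator ?E e * ennreal \<bar>\<phi> (w x + t *\<^sub>R e)\<bar>) \<partial>lborel \<partial>lborel) \<partial>lborel)"
    by (rule lborel_pair.Fubini') measurable
  also have "\<dots> = (\<integral>\<^sup>+t. (\<integral>\<^sup>+x. \<integral>\<^sup>+e. indicator {0..T} t * m x * (indicator ?E e * ennreal \<bar>\<phi> (w x + t *\<^sub>R e)\<bar>) \<partial>lborel \<partial>lborel) \<partial>lborel)"
    by (intro nn_integral_cong lborel_pair.Fubini') measurable
  also have "\<dots> \<le> (\<integral>\<^sup>+t. ennreal (2 * N * A1) * (indicator {0..T} t * ennreal (t powr (- (?n / q)))) \<partial>lborel)"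
  proof (rule nn_integral_mono_AE)
    have "AE t in lborel. t \<noteq> (0 :: real)" by (rule AE_lborel_singleton)
    then show "AE t in lborel. (\<integral>\<^sup>+x. \<integral>\<^sup>+e. indicator {0..T} t * m x * (indicator ?E e * ennreal \<bar>\<phi> (w x + t *\<^sub>R e)\<bar>) \<partial>lborel \<partial>lborel)
       \<le> ennreal (2 * N * A1) * (indicator {0..T} t * ennreal (t powr (- (?n / q))))"
    proof eventually_elim
      fix t :: real assume t0: "t \<noteq> 0"
      show "(\<integral>\<^sup>+x. \<integral>\<^sup>+e. indicator {0..T} t * m x * (indicator ?E e * ennreal \<bar>\<phi> (w x + t *\<^sub>R e)\<bar>) \<partial>lborel \<partial>lborel)
       \<le> ennreal (2 * N * A1) * (indicator {0..T} t * ennreal (t powr (- (?n / q))))"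
      proof (cases "t \<in> {0..T}")
        case True
        then have t: "t > 0" using t0 by auto
        have "(\<integral>\<^sup>+x. \<integral>\<^sup>+e. indicator {0..T} t * m x * (indicator ?E e * ennreal \<bar>\<phi> (w x + t *\<^sub>R e)\<bar>) \<partial>lborel \<partial>lborel)
          = (\<integral>\<^sup>+x. m x * (\<integral>\<^sup>+e. indicator ?E e * ennreal \<bar>\<phi> (w x + t *\<^sub>R e)\<bar> \<partial>lborel) \<partial>lborel)"
          using True by (simp add: nn_integral_cmult)
        also have "\<dots> \<le> (\<integral>\<^sup>+x. m x * ennreal (2 * N * t powr (- ?n / q)) \<partial>lborel)"
          by (intro nn_integral_mono mult_left_mono avg t) auto
        also have "\<dots> = (\<integral>\<^sup>+x. m x \<partial>lborel) * ennreal (2 * N * t powr (- ?n / q))"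
          by (rule nn_integral_multc) measurable
        also have "\<dots> \<le> ennreal A1 * ennreal (2 * N * t powr (- ?n / q))"
          using A1 unfolding m_def by (intro mult_right_mono) auto
        also have "\<dots> = ennreal (2 * N * A1) * ennreal (t powr (- (?n / q)))"
          using A1 N by (simp add: ennreal_mult[symmetric] ac_simps)
        finally show ?thesis using True by simp
      qed simp
    qed
  qed
  also have "\<dots> = ennreal (2 * N * A1) * (\<integral>\<^sup>+t. (indicator {0..T} t * ennreal (t powr (- (?n / q)))) \<partial>lborel)"
    by (rule nn_integral_cmult) measurable
  also have "\<dots> = ennreal (2 * N * A1) * ennreal (T powr (1 - ?n / q) / (1 - ?n / q))"
    using nn_integral_powr_from_0[OF q1(2) T] by simp
  finally have "ennreal \<bar>X\<bar> \<le> ennreal A0 * ennreal (2 * N * T powr (- ?n / q)) + ennreal (2 * N * A1) * ennreal (T powr (1 - ?n / q) / (1 - ?n / q))"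
    by (simp add: add_mono)
  also have "\<dots> = ennreal (2 * N * (A0 * T powr (- ?n / q) + A1 * (T powr (1 - ?n / q) / (1 - ?n / q))))"
    using A0(2) A1(2) N q1 T
    by (simp add: ennreal_mult[symmetric] ennreal_plus[symmetric] distrib_left ac_simps del: ennreal_plus)
  finally show ?thesis
    using A0(2) A1(2) N q1 T unfolding X_def by (subst (asm) ennreal_le_iff) (auto intro!: mult_nonneg_nonneg add_nonneg_nonneg)
qed

subsection \<open>Smooth functions\<close>

lemma smooth_on_coinduct:
  assumes "f \<in> F" "\<And>f x. f \<in> F \<Longrightarrow> f differentiable (at x)"
    "\<And>f v. f \<in> F \<Longrightarrow> (\<lambda>x. frechet_derivative f (at x) v) \<in> F"
  shows "smooth_on UNIV f"
proof -
  have "\<forall>f\<in>F. Ck_on k UNIV f" for k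
  proof (induction k)
    case 0
    show ?case using assms(2) by (simp add: differentiable_imp_continuous_within continuous_on_eq_continuous_within)
  next
    case (Suc k)
    then show ?case using assms(2,3) by simp
  qed
  then show ?thesis using assms(1) unfolding smooth_on_def by blast
qed

lemma real_polynomial_function_has_derivative:
  "real_polynomial_function p \<Longrightarrow>
    \<exists>p'. (\<forall>x. (p has_derivative p' x) (at x)) \<and> (\<forall>v. real_polynomial_function (\<lambda>x. p' x v))"
proof (induction rule: real_polynomial_function.induct)
  case (linear f)
  then show ?case
    by (intro exI[of _ "\<lambda>x. f"]) (auto intro: bounded_linear_imp_has_derivative real_polynomial_function.intros(2))
next
  case (const c)
  show ?case by (intro exI[of _ "\<lambda>x v. 0"]) (auto intro: real_polynomial_function.intros(2))
next
  case (add f g)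
  then obtain f' g' where "\<forall>x. (f has_derivative f' x) (at x)" "\<forall>v. real_polynomial_function (\<lambda>x. f' x v)"
    "\<forall>x. (g has_derivative g' x) (at x)" "\<forall>v. real_polynomial_function (\<lambda>x. g' x v)" by blast
  then show ?case
    by (intro exI[of _ "\<lambda>x v. f' x v + g' x v"]) (auto intro: has_derivative_add real_polynomial_function.intros(3))
next
  case (mult f g)
  then obtain f' g' where "\<forall>x. (f has_derivative f' x) (at x)" "\<forall>v. real_polynomial_function (\<lambda>x. f' x v)"
    "\<forall>x. (g has_derivative g' x) (at x)" "\<forall>v. real_polynomial_function (\<lambda>x. g' x v)" by blast
  note fg = this
  have "real_polynomial_function (\<lambda>x. f x * g' x v + f' x v * g x)" for v
    using fg mult.hyps by (intro real_polynomial_function.intros(3,4)) blast+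
  then show ?case using fg
    by (intro exI[of _ "\<lambda>x v. f x * g' x v + f' x v * g x"]) (auto intro: has_derivative_mult)
qed

lemma smooth_on_polynomial_function:
  fixes f :: "'a::euclidean_space \<Rightarrow> 'b::euclidean_space"
  assumes "polynomial_function f" shows "smooth_on UNIV f"
proof (rule smooth_on_coinduct[where F="{f. polynomial_function f}"])
  have diff: "f differentiable (at x)" if "polynomial_function f" for f :: "'a \<Rightarrow> 'b" and x
    using that by (rule differentiable_at_polynomial_function)
  then show "\<And>(f :: 'a \<Rightarrow> 'b) x. f \<in> {f. polynomial_function f} \<Longrightarrow> f differentiable (at x)" by blast
  fix f :: "'a \<Rightarrow> 'b" and v assume f: "f \<in> {f. polynomial_function f}"
  have "real_polynomial_function (h \<circ> (\<lambda>x. frechet_derivative f (at x) v))" if h: "bounded_linear h" for h :: "'b \<Rightarrow> real"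
  proof -
    have "real_polynomial_function (h \<circ> f)" using f h unfolding polynomial_function_def by blast
    then obtain p' where p': "\<And>x. ((h \<circ> f) has_derivative p' x) (at x)" "real_polynomial_function (\<lambda>x. p' x v)"
      using real_polynomial_function_has_derivative by metis
    have "p' x v = h (frechet_derivative f (at x) v)" for x
    proof -
      have "(f has_derivative frechet_derivative f (at x)) (at x)"
        using diff f frechet_derivative_works by blast
      then have "((h \<circ> f) has_derivative (\<lambda>v. h (frechet_derivative f (at x) v))) (at x)"
        unfolding o_def by (rule bounded_linear.has_derivative[OF h])
      then show ?thesis using has_derivative_unique p'(1) by metis
    qed
    then show ?thesis using p'(2) by (simp add: o_def)
  qed
  then show "(\<lambda>x. frechet_derivative f (at x) v) \<in> {f. polynomial_function f}"
    unfolding polynomial_function_def by simp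
qed (use assms in simp)

definition exp_inv :: "nat \<Rightarrow> real \<Rightarrow> real" where
  "exp_inv m t = (if t > 0 then exp (- 1 / t) / t ^ m else 0)"

lemma power_le_exp: "(s::real) \<ge> 0 \<Longrightarrow> s ^ Suc k \<le> real (Suc k) ^ Suc k * exp s"
proof -
  assume s: "s \<ge> 0"
  have "s / Suc k \<le> exp (s / Suc k)" using exp_ge_add_one_self[of "s / Suc k"] by linarith
  then have "(s / Suc k) ^ Suc k \<le> exp (s / Suc k) ^ Suc k" using s by (intro power_mono) auto
  also have "\<dots> = exp s" using exp_of_nat_mult[of "Suc k" "s / Suc k"] by simp
  finally show ?thesis by (simp add: power_divide field_simps del: power_Suc of_nat_Suc)
qed

lemma exp_inv_le:
  assumes "t > 0" shows "exp_inv m t \<le> real (Suc m) ^ Suc m * t"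
proof -
  have "(1 / t) ^ Suc m \<le> real (Suc m) ^ Suc m * exp (1 / t)"
    using power_le_exp[of "1/t" m] assms by simp
  then have "(1 / t) ^ Suc m * exp (- (1 / t)) \<le> real (Suc m) ^ Suc m * exp (1 / t) * exp (- (1 / t))"
    by (intro mult_right_mono) auto
  also have "\<dots> = real (Suc m) ^ Suc m" by (simp add: exp_minus)
  finally have "(1 / t) ^ Suc m * exp (- (1 / t)) * t \<le> real (Suc m) ^ Suc m * t"
    using assms by (intro mult_right_mono) auto
  then show ?thesis using assms unfolding exp_inv_def by (simp add: power_divide field_simps)
qed

lemma exp_inv_nonneg: "exp_inv m t \<ge> 0" unfolding exp_inv_def by auto

lemma exp_inv_deriv: "(exp_inv m has_real_derivative exp_inv (m + 2) t - m * exp_inv (m + 1) t) (at t)"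
proof (cases "t = 0")
  case True
  have "((\<lambda>h. (exp_inv m (0 + h) - exp_inv m 0) / h) \<longlongrightarrow> 0) (at 0)"
  proof (rule Lim_null_comparison)
    have "norm ((exp_inv m (0 + h) - exp_inv m 0) / h) \<le> real (Suc (m + 1)) ^ Suc (m + 1) * \<bar>h\<bar>" for h
    proof (cases "h > 0")
      case True
      then have "(exp_inv m (0 + h) - exp_inv m 0) / h = exp_inv (m + 1) h"
        by (simp add: exp_inv_def field_simps)
      then show ?thesis using exp_inv_le[OF True, of "m+1"] exp_inv_nonneg[of "m+1" h] True by simp
    next
      case False
      then have "(exp_inv m (0 + h) - exp_inv m 0) / h = 0" by (simp add: exp_inv_def)
      then show ?thesis by (simp only: norm_zero) (intro mult_nonneg_nonneg zero_le_power; simp)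
    qed
    then show "\<forall>\<^sub>F h in at 0. norm ((exp_inv m (0 + h) - exp_inv m 0) / h) \<le> real (Suc (m + 1)) ^ Suc (m + 1) * \<bar>h\<bar>"
      by (intro always_eventually allI)
    show "((\<lambda>h::real. real (Suc (m + 1)) ^ Suc (m + 1) * \<bar>h\<bar>) \<longlongrightarrow> 0) (at 0)"
      by (intro tendsto_eq_intros) auto
  qed
  then show ?thesis using True by (simp add: DERIV_def exp_inv_def)
next
  case False
  show ?thesis
  proof (cases "t > 0")
    case True
    have "((\<lambda>t. exp (- 1 / t) / t ^ m) has_real_derivative exp_inv (m + 2) t - m * exp_inv (m + 1) t) (at t)"
    proof -
      have d1: "((\<lambda>t. exp (- 1 / t)) has_real_derivative exp (- 1 / t) * (1 / t ^ 2)) (at t)"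
        using True by (auto intro!: derivative_eq_intros simp: power2_eq_square)
      have d2: "((\<lambda>t. t ^ m) has_real_derivative real m * t ^ (m - 1)) (at t)"
        by (auto intro!: derivative_eq_intros)
      have nz: "t ^ m \<noteq> 0" using True by simp
      have "(exp (- 1 / t) * (1 / t ^ 2) * t ^ m - exp (- 1 / t) * (real m * t ^ (m - 1))) / (t ^ m * t ^ m)
         = exp_inv (m + 2) t - m * exp_inv (m + 1) t"
      proof (cases m)
        case (Suc k)
        show ?thesis using True unfolding exp_inv_def Suc by (simp add: field_simps power2_eq_square)
      qed (use True in \<open>simp add: exp_inv_def power2_eq_square\<close>)
      with DERIV_divide[OF d1 d2 nz] show ?thesis by simp
    qed
    then show ?thesis
      by (rule has_field_derivative_transform_within_open[where S="{0<..}"]) (use True in \<open>auto simp: exp_inv_def\<close>)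
  next
    case f: False
    have "((\<lambda>t. 0) has_real_derivative exp_inv (m + 2) t - m * exp_inv (m + 1) t) (at t)"
      using f by (simp add: exp_inv_def)
    then show ?thesis
      by (rule has_field_derivative_transform_within_open[where S="{..<0}"]) (use f False in \<open>auto simp: exp_inv_def\<close>)
  qed
qed

inductive bump_class :: "('a::real_normed_vector \<Rightarrow> real) \<Rightarrow> ('a \<Rightarrow> real) \<Rightarrow> bool" for q where
  base: "real_polynomial_function p \<Longrightarrow> bump_class q (\<lambda>x. p x * exp_inv m (q x))"
| add: "bump_class q f \<Longrightarrow> bump_class q g \<Longrightarrow> bump_class q (\<lambda>x. f x + g x)"

lemma bump_class_derivative:
  assumes q: "real_polynomial_function q"
  shows "bump_class q f \<Longrightarrow> \<exists>f'. (\<forall>x. (f has_derivative f' x) (at x)) \<and> (\<forall>v. bump_class q (\<lambda>x. f' x v))"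
proof (induction rule: bump_class.induct)
  case (base p m)
  obtain p' where p': "\<And>x. (p has_derivative p' x) (at x)" "\<And>v. real_polynomial_function (\<lambda>x. p' x v)"
    using real_polynomial_function_has_derivative[OF base] by blast
  obtain q' where q': "\<And>x. (q has_derivative q' x) (at x)" "\<And>v. real_polynomial_function (\<lambda>x. q' x v)"
    using real_polynomial_function_has_derivative[OF q] by blast
  let ?d = "\<lambda>x v. p' x v * exp_inv m (q x) + ((p x * q' x v) * exp_inv (m + 2) (q x) + (- real m * (p x * q' x v)) * exp_inv (m + 1) (q x))"
  show ?case
  proof (intro exI[of _ ?d] conjI allI)
    fix x
    have "((\<lambda>x. exp_inv m (q x)) has_derivative (\<lambda>h. (exp_inv (m + 2) (q x) - m * exp_inv (m + 1) (q x)) * q' x h)) (at x)"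
      by (rule has_derivative_compose[OF q'(1) exp_inv_deriv[unfolded has_field_derivative_def]])
    from has_derivative_mult[OF p'(1) this]
    show "((\<lambda>x. p x * exp_inv m (q x)) has_derivative ?d x) (at x)"
      by (rule has_derivative_eq_rhs) (auto simp: fun_eq_iff algebra_simps)
  next
    fix v
    show "bump_class q (\<lambda>x. ?d x v)"
      by (intro bump_class.add bump_class.base p' q' real_polynomial_function.intros(4) base real_polynomial_function.intros(2))
  qed
next
  case (add f g)
  then obtain f' g' where "\<forall>x. (f has_derivative f' x) (at x)" "\<forall>v. bump_class q (\<lambda>x. f' x v)"
    "\<forall>x. (g has_derivative g' x) (at x)" "\<forall>v. bump_class q (\<lambda>x. g' x v)" by blast
  then show ?case
    by (intro exI[of _ "\<lambda>x v. f' x v + g' x v"]) (auto intro: has_derivative_add bump_class.add)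
qed

lemma smooth_on_bump_class:
  assumes q: "real_polynomial_function q" and f: "bump_class q f" shows "smooth_on UNIV f"
proof (rule smooth_on_coinduct[where F="{f. bump_class q f}"])
  fix f :: "'a \<Rightarrow> real" and x v assume "f \<in> {f. bump_class q f}"
  then obtain f' where f': "\<And>x. (f has_derivative f' x) (at x)" "\<And>v. bump_class q (\<lambda>x. f' x v)"
    using bump_class_derivative[OF q] by blast
  show "f differentiable (at x)" using f'(1) unfolding differentiable_def by blast
  have "frechet_derivative f (at x) = f' x" for x using frechet_derivative_at[OF f'(1)] by simp
  then show "(\<lambda>x. frechet_derivative f (at x) v) \<in> {f. bump_class q f}" using f'(2) by simp
qed (use f in simp)

lemma ex_smooth_bump:
  fixes c :: "real ^ 'n"
  assumes "e > 0"
  shows "\<exists>\<phi> :: real ^ 'n \<Rightarrow> real. smooth_on UNIV \<phi> \<and> (\<forall>x. \<phi> x \<ge> 0) \<and> (\<forall>x. x \<notin> cball c e \<longrightarrow> \<phi> x = 0) \<and>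
    integrable lborel \<phi> \<and> (\<integral>x. \<phi> x \<partial>lborel) = 1"
proof -
  define q where "q x = e\<^sup>2 - (x - c) \<bullet> (x - c)" for x
  have comp: "real_polynomial_function (\<lambda>x. (x - c) \<bullet> b)" for b :: "real ^ 'n"
  proof -
    have "real_polynomial_function (\<lambda>x. x \<bullet> b + (- (c \<bullet> b)))"
      by (intro real_polynomial_function.intros(3) real_polynomial_function.intros(2) real_polynomial_function.intros(1) bounded_linear_inner_left)
    then show ?thesis by (simp add: inner_diff_left)
  qed
  have q: "real_polynomial_function q"
  proof -
    have "real_polynomial_function (\<lambda>x. e\<^sup>2 + (- 1) * (\<Sum>b\<in>Basis. ((x - c) \<bullet> b) * ((x - c) \<bullet> b)))"
      by (intro real_polynomial_function.intros(3) real_polynomial_function.intros(2) real_polynomial_function.intros(4)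
        real_polynomial_function_sum comp) auto
    moreover have "(\<lambda>x. e\<^sup>2 + (- 1) * (\<Sum>b\<in>Basis. ((x - c) \<bullet> b) * ((x - c) \<bullet> b))) = q"
      unfolding q_def by (rule ext) (simp add: euclidean_inner[symmetric])
    ultimately show ?thesis by simp
  qed
  define \<psi> where "\<psi> x = exp_inv 0 (q x)" for x
  have bc: "bump_class q (\<lambda>x. k * \<psi> x)" for k
    unfolding \<psi>_def by (intro bump_class.base real_polynomial_function.intros(2))
  have smooth: "smooth_on UNIV (\<lambda>x. k * \<psi> x)" for k
    by (rule smooth_on_bump_class[OF q bc])
  have q_pos: "q x > 0 \<longleftrightarrow> dist c x < e" for x
  proof -
    have "q x > 0 \<longleftrightarrow> (norm (x - c))\<^sup>2 < e\<^sup>2" unfolding q_def by (simp add: power2_norm_eq_inner)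
    also have "\<dots> \<longleftrightarrow> norm (x - c) < e" using assms power2_less_imp_less power_strict_mono
      by (metis less_eq_real_def norm_ge_zero pos2)
    finally show ?thesis by (simp add: dist_norm norm_minus_commute)
  qed
  have 0: "\<psi> x = 0" if "x \<notin> cball c e" for x
    using that q_pos[of x] unfolding \<psi>_def exp_inv_def by (auto simp: dist_norm)
  have nn: "\<psi> x \<ge> 0" for x unfolding \<psi>_def by (rule exp_inv_nonneg)
  have "continuous_on UNIV (\<lambda>x. 1 * \<psi> x)" using smooth[of 1] unfolding smooth_on_def by (metis Ck_on.simps(1))
  then have cont: "continuous_on UNIV \<psi>" by simp
  have int: "integrable lborel \<psi>"
    by (rule integrable_compact_support[of "cball c e"]) (use 0 in \<open>auto intro!: continuous_on_subset[OF cont]\<close>)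
  have "(\<integral>x. \<psi> x \<partial>lborel) \<noteq> 0"
  proof
    assume "(\<integral>x. \<psi> x \<partial>lborel) = 0"
    then have "AE x in lborel. \<psi> x = 0"
      using integral_nonneg_eq_0_iff_AE[OF int] nn by auto
    then have "AE x in lborel. x \<notin> ball c e"
      by eventually_elim (use q_pos in \<open>force simp: \<psi>_def exp_inv_def\<close>)
    then have "ball c e \<in> null_sets lborel" by (subst (asm) AE_iff_null_sets[symmetric]) auto
    then have "negligible (ball c e)" by (simp add: negligible_iff_null_sets null_sets_completionI)
    then show False using assms open_not_negligible[OF open_ball] by (metis ball_eq_empty not_le)
  qed
  moreover have "(\<integral>x. \<psi> x \<partial>lborel) \<ge> 0" using nn by simp
  ultimately have Z: "(\<integral>x. \<psi> x \<partial>lborel) > 0" by simp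
  define k where "k = inverse (\<integral>x. \<psi> x \<partial>lborel)"
  have "smooth_on UNIV (\<lambda>x. k * \<psi> x)" by (rule smooth)
  moreover have "\<forall>x. k * \<psi> x \<ge> 0" using Z nn unfolding k_def by simp
  moreover have "\<forall>x. x \<notin> cball c e \<longrightarrow> k * \<psi> x = 0" using 0 by simp
  moreover have "integrable lborel (\<lambda>x. k * \<psi> x)" using int by simp
  moreover have "(\<integral>x. k * \<psi> x \<partial>lborel) = 1" using Z unfolding k_def by simp
  ultimately show ?thesis by blast
qed

lemma smooth_on_C1_scalar:
  fixes f :: "real ^ 'n \<Rightarrow> real"
  assumes "smooth_on S f" shows "C1_scalar S f (\<lambda>x. \<chi> j. frechet_derivative f (at x) (axis j 1))"
proof (rule C1_scalarI)
  have "Ck_on (Suc 0) S f" using assms unfolding smooth_on_def by blast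
  then have d: "\<And>x. x \<in> S \<Longrightarrow> f differentiable (at x)" "\<And>v. continuous_on S (\<lambda>x. frechet_derivative f (at x) v)"
    by auto
  show "(f has_derivative frechet_derivative f (at x)) (at x)" if "x \<in> S" for x
    using d(1)[OF that] frechet_derivative_works by blast
  then have lin: "linear (frechet_derivative f (at x))" if "x \<in> S" for x
    using that has_derivative_linear by blast
  show "frechet_derivative f (at x) h = (\<chi> j. frechet_derivative f (at x) (axis j 1)) \<bullet> h" if "x \<in> S" for x h
  proof -
    have "frechet_derivative f (at x) h = frechet_derivative f (at x) (\<Sum>j\<in>UNIV. h $ j *\<^sub>R axis j 1)"
      using basis_expansion[of h] by (simp add: scalar_mult_eq_scaleR)
    also have "\<dots> = (\<Sum>j\<in>UNIV. h $ j * frechet_derivative f (at x) (axis j 1))"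
      unfolding linear_sum[OF lin[OF that]] linear_scale[OF lin[OF that]] by simp
    finally show ?thesis by (simp add: inner_vec_def mult.commute)
  qed
  show "continuous_on S (\<lambda>x. \<chi> j. frechet_derivative f (at x) (axis j 1))"
    by (intro continuous_on_vec_lambda d)
qed

lemma smooth_on_C1_map:
  fixes f :: "real ^ 'n \<Rightarrow> real ^ 'n"
  assumes "smooth_on S f" shows "C1_map S f (\<lambda>x. jacobian f (at x))"
proof (rule C1_mapI_has_derivative)
  have "Ck_on (Suc 0) S f" using assms unfolding smooth_on_def by blast
  then have d: "\<And>x. x \<in> S \<Longrightarrow> f differentiable (at x)" "\<And>v. continuous_on S (\<lambda>x. frechet_derivative f (at x) v)"
    by auto
  show "(f has_derivative (\<lambda>h. jacobian f (at x) *v h)) (at x)" if "x \<in> S" for x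
    using d(1)[OF that] jacobian_works by blast
  show "continuous_on S (\<lambda>x. jacobian f (at x))"
    unfolding jacobian_def matrix_def by (intro continuous_on_vec_lambda continuous_on_component d)
qed

subsection \<open>The degree as an integral\<close>

definition std_bump :: "real ^ 'n \<Rightarrow> real" where
  "std_bump = (SOME \<phi>. smooth_on UNIV \<phi> \<and> (\<forall>x. \<phi> x \<ge> 0) \<and> (\<forall>x. x \<notin> cball 0 1 \<longrightarrow> \<phi> x = 0) \<and>
    integrable lborel \<phi> \<and> (\<integral>x. \<phi> x \<partial>lborel) = 1)"

lemma std_bump:
  fixes x :: "real ^ 'n"
  shows "smooth_on UNIV (std_bump :: real ^ 'n \<Rightarrow> real)" "std_bump x \<ge> 0" "norm x > 1 \<Longrightarrow> std_bump x = 0"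
    "integrable lborel (std_bump :: real ^ 'n \<Rightarrow> real)" "(\<integral>x. std_bump x \<partial>(lborel :: (real ^ 'n) measure)) = 1"
proof -
  have "\<exists>\<phi> :: real ^ 'n \<Rightarrow> real. smooth_on UNIV \<phi> \<and> (\<forall>x. \<phi> x \<ge> 0) \<and> (\<forall>x. x \<notin> cball 0 1 \<longrightarrow> \<phi> x = 0) \<and>
    integrable lborel \<phi> \<and> (\<integral>x. \<phi> x \<partial>lborel) = 1"
    by (rule ex_smooth_bump) simp
  from someI_ex[OF this, folded std_bump_def]
  show "smooth_on UNIV (std_bump :: real ^ 'n \<Rightarrow> real)" "std_bump x \<ge> 0" "norm x > 1 \<Longrightarrow> std_bump x = 0"
    "integrable lborel (std_bump :: real ^ 'n \<Rightarrow> real)" "(\<integral>x. std_bump x \<partial>(lborel :: (real^'n) measure)) = 1"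
    by auto
qed

definition scaled_degree ::
    "(real ^ 'n) set \<Rightarrow> (real ^ 'n \<Rightarrow> real ^ 'n) \<Rightarrow> (real ^ 'n \<Rightarrow> real ^ 'n ^ 'n) \<Rightarrow> real ^ 'n \<Rightarrow> real \<Rightarrow> real" where
  "scaled_degree U v A y e = (LINT x:U|lborel. std_bump ((1 / e) *\<^sub>R (v x - y)) * det ((1 / e) *\<^sub>R A x))"

definition C1_degree ::
    "(real ^ 'n) set \<Rightarrow> (real ^ 'n \<Rightarrow> real ^ 'n) \<Rightarrow> (real ^ 'n \<Rightarrow> real ^ 'n ^ 'n) \<Rightarrow> real ^ 'n \<Rightarrow> real" where
  "C1_degree U v A y = (THE D. eventually (\<lambda>e. scaled_degree U v A y e = D) (at_right 0))"

lemma scaled_degree_eq: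
  fixes v w :: "real ^ 'n \<Rightarrow> real ^ 'n"
  assumes U: "open U" "bounded U" and v: "C1_map U v A" and w: "C1_map U w B"
    and cont: "continuous_on (closure U) v" "continuous_on (closure U) w"
    and d: "\<And>x. x \<in> frontier U \<Longrightarrow> d \<le> norm (v x - y)"
      "\<And>x. x \<in> frontier U \<Longrightarrow> norm ((w x - y') - (v x - y)) \<le> d / 2"
    and e: "0 < e" "e < d / 2" "0 < e'" "e' < d / 2"
  shows "scaled_degree U v A y e = scaled_degree U w B y' e'"
  unfolding scaled_degree_def
proof (rule degree_integral_homotopy[OF U])
  show "C1_map U (\<lambda>x. (1 / e) *\<^sub>R (v x - y)) (\<lambda>x. (1 / e) *\<^sub>R A x)"
    using C1_map_scaleR_const[OF C1_map_diff[OF v C1_map_const]] by simp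
  show "C1_map U (\<lambda>x. (1 / e') *\<^sub>R (w x - y')) (\<lambda>x. (1 / e') *\<^sub>R B x)"
    using C1_map_scaleR_const[OF C1_map_diff[OF w C1_map_const]] by simp
  show "C1_scalar UNIV std_bump (\<lambda>x. \<chi> j. frechet_derivative std_bump (at x) (axis j 1))"
    by (rule smooth_on_C1_scalar[OF std_bump(1)])
  show "continuous_on (closure U) (\<lambda>x. (1 / e) *\<^sub>R (v x - y))" "continuous_on (closure U) (\<lambda>x. (1 / e') *\<^sub>R (w x - y'))"
    by (intro continuous_intros cont)+
  show "closed (cball (0 :: real ^ 'n) 1)" by simp
  show "std_bump z = 0" if "z \<notin> cball 0 1" for z :: "real ^ 'n" using that std_bump(3)[of z] by simp
  fix x t :: "_" assume x: "x \<in> frontier U" and t: "t \<in> {0..1::real}"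
  define a where "a = v x - y"
  define b where "b = (w x - y') - (v x - y)"
  define s where "s = (1 - t) / e + t / e'"
  have s: "s \<ge> 0" "s \<ge> t / e'" "(d / 2) * s > 1"
  proof -
    show "s \<ge> 0" "s \<ge> t / e'" using t e unfolding s_def by auto
    have de: "d / 2 / e > 1" "d / 2 / e' > 1" using e by auto
    have eq: "(d / 2) * s = (1 - t) * (d / 2 / e) + t * (d / 2 / e')" unfolding s_def
      by (simp only: distrib_left times_divide_eq_right times_divide_eq_left mult.commute mult.assoc mult.left_commute divide_divide_eq_left)
    show "(d / 2) * s > 1"
    proof (cases "t < 1")
      case True
      have "(1 - t) * 1 + t * 1 < (1 - t) * (d / 2 / e) + t * (d / 2 / e')"
        using de t True by (intro add_less_le_mono mult_strict_left_mono mult_left_mono) auto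
      then show ?thesis unfolding eq by (simp only: mult_1_right diff_add_cancel)
    next
      case False
      then have "t = 1" using t by simp
      then show ?thesis unfolding eq using de(2) by (simp only: diff_self mult_zero_left mult_1_left add_0_left)
    qed
  qed
  have "(1 / e) *\<^sub>R (v x - y) + t *\<^sub>R ((1 / e') *\<^sub>R (w x - y') - (1 / e) *\<^sub>R (v x - y)) = s *\<^sub>R a + (t / e') *\<^sub>R b"
  proof -
    have "(1 / e') *\<^sub>R (w x - y') = (1 / e') *\<^sub>R (a + b)" unfolding a_def b_def by simp
    then show ?thesis unfolding a_def[symmetric] s_def
      by (simp add: scaleR_add_right scaleR_add_left scaleR_diff_right diff_divide_distrib scaleR_diff_left)
  qed
  moreover have "norm (s *\<^sub>R a + (t / e') *\<^sub>R b) > 1"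
  proof -
    have "norm (s *\<^sub>R a) \<ge> s * d" using d(1)[OF x] s by (simp add: a_def mult_left_mono)
    moreover have "norm ((t / e') *\<^sub>R b) \<le> s * (d / 2)"
    proof -
      have "norm ((t / e') *\<^sub>R b) = (t / e') * norm b" using t e by simp
      also have "\<dots> \<le> s * (d / 2)" using d(2)[OF x] s t e by (intro mult_mono) (auto simp: b_def)
      finally show ?thesis .
    qed
    moreover have "norm (s *\<^sub>R a + (t / e') *\<^sub>R b) \<ge> norm (s *\<^sub>R a) - norm ((t / e') *\<^sub>R b)"
      by (metis add_uminus_conv_diff norm_diff_ineq norm_minus_cancel norm_triangle_ineq2 diff_minus_eq_add)
    moreover have "s * d = 2 * (d / 2 * s)" "s * (d / 2) = d / 2 * s" by simp_all
    ultimately show ?thesis using s(3) by linarith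
  qed
  ultimately show "(1 / e) *\<^sub>R (v x - y) + t *\<^sub>R ((1 / e') *\<^sub>R (w x - y') - (1 / e) *\<^sub>R (v x - y)) \<notin> cball 0 1"
    by simp
qed

locale C1_degree_data =
  fixes U :: "(real ^ 'n) set" and v :: "real ^ 'n \<Rightarrow> real ^ 'n" and A :: "real ^ 'n \<Rightarrow> real ^ 'n ^ 'n"
  assumes U: "open U" "bounded U" and C1: "C1_map U v A" and cont: "continuous_on (closure U) v"
begin

lemma degree_eq_scaled:
  assumes "\<And>x. x \<in> frontier U \<Longrightarrow> d \<le> norm (v x - y)" "0 < e" "e < d / 2"
  shows "C1_degree U v A y = scaled_degree U v A y e"
proof -
  have *: "eventually (\<lambda>e'. scaled_degree U v A y e' = scaled_degree U v A y e) (at_right 0)"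
    unfolding eventually_at_right_field
    by (rule exI[of _ "d / 2"], use assms in \<open>auto intro!: scaled_degree_eq[OF U C1 C1 cont cont]\<close>)
  show ?thesis
    unfolding C1_degree_def
  proof (rule the_equality[where P="\<lambda>D. eventually (\<lambda>e. scaled_degree U v A y e = D) (at_right 0)", OF *])
    fix D assume "eventually (\<lambda>e'. scaled_degree U v A y e' = D) (at_right 0)"
    from eventually_conj[OF this *] have "eventually (\<lambda>e'. D = scaled_degree U v A y e) (at_right (0::real))"
      by eventually_elim auto
    then show "D = scaled_degree U v A y e" by (simp add: eventually_const trivial_limit_at_right_real)
  qed
qed

lemma degree_far:
  assumes "\<And>x. x \<in> closure U \<Longrightarrow> d \<le> norm (v x - y)" "d > 0"
  shows "C1_degree U v A y = 0"
proof -
  define e where "e = d / 4"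
  have e: "0 < e" "e < d / 2" unfolding e_def using assms by auto
  have fr: "frontier U \<subseteq> closure U" by (simp add: frontier_def)
  have "std_bump ((1 / e) *\<^sub>R (v x - y)) = 0" if "x \<in> U" for x
  proof (rule std_bump(3))
    have "d \<le> norm (v x - y)" using assms(1) that closure_subset by blast
    moreover have "norm ((1 / e) *\<^sub>R (v x - y)) = norm (v x - y) / e" using e by (simp only: norm_scaleR) simp
    moreover have "1 < norm (v x - y) / e" using calculation(1) assms(2) by (simp add: e_def field_simps)
    ultimately show "1 < norm ((1 / e) *\<^sub>R (v x - y))" by (simp only:)
  qed
  then have "scaled_degree U v A y e = 0"
    unfolding scaled_degree_def set_lebesgue_integral_def
    by (intro integral_eq_zero_AE AE_I2) (auto simp: indicator_def)
  then show ?thesis using degree_eq_scaled[OF _ e, of y] assms(1) fr by auto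
qed

end

lemma degree_close:
  assumes v: "C1_degree_data U v A" and w: "C1_degree_data U w B"
    and d: "d > 0" "\<And>x. x \<in> frontier U \<Longrightarrow> d \<le> norm (v x - y)"
      "\<And>x. x \<in> frontier U \<Longrightarrow> norm ((w x - y') - (v x - y)) \<le> d / 2"
  shows "C1_degree U w B y' = C1_degree U v A y"
proof -
  interpret v: C1_degree_data U v A by (rule v)
  interpret w: C1_degree_data U w B by (rule w)
  have lower: "d / 2 \<le> norm (w x - y')" if "x \<in> frontier U" for x
    using d(2)[OF that] d(3)[OF that] norm_triangle_ineq2[of "v x - y" "w x - y'"]
    by (simp add: norm_minus_commute)
  have "C1_degree U w B y' = scaled_degree U w B y' (d / 8)"
    by (rule w.degree_eq_scaled[OF lower]) (use d in auto)
  also have "\<dots> = scaled_degree U v A y (d / 8)"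
    by (rule scaled_degree_eq[OF v.U v.C1 w.C1 v.cont w.cont, symmetric, of d]) (use d in auto)
  also have "\<dots> = C1_degree U v A y"
    by (rule v.degree_eq_scaled[symmetric, of d]) (use d in auto)
  finally show ?thesis .
qed

lemma compact_dist_pos:
  fixes v :: "'a::metric_space \<Rightarrow> 'b::euclidean_space"
  assumes "compact F" "continuous_on F v" "y \<notin> v ` F"
  obtains d where "d > 0" "\<And>x. x \<in> F \<Longrightarrow> d \<le> norm (v x - y)"
proof -
  have "compact (v ` F)" using assms compact_continuous_image by blast
  then have "\<exists>d>0. \<forall>a\<in>v ` F. \<forall>b\<in>{y}. d \<le> dist a b"
    using separate_compact_closed[of "v ` F" "{y}"] assms(3) by auto
  then show ?thesis using that by (auto simp: dist_norm)
qed

context C1_degree_data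
begin

lemma cont_frontier: "continuous_on (frontier U) v"
  using cont by (rule continuous_on_subset) (simp add: frontier_def)

lemma degree_component:
  assumes "y' \<in> connected_component_set (- (v ` frontier U)) y"
  shows "C1_degree U v A y' = C1_degree U v A y"
proof -
  have cl: "compact (v ` frontier U)"
    using U(2) cont_frontier by (intro compact_continuous_image compact_frontier_bounded)
  then have op: "open (connected_component_set (- (v ` frontier U)) y)"
    by (intro open_connected_component open_Compl compact_imp_closed)
  have y: "y \<in> connected_component_set (- (v ` frontier U)) y"
    using assms connected_component_refl_eq connected_component_in by fastforce
  have "C1_degree U v A constant_on connected_component_set (- (v ` frontier U)) y"
  proof (rule locally_constant_imp_constant[OF connected_connected_component])
    fix a assume a: "a \<in> connected_component_set (- (v ` frontier U)) y"
    then have "a \<notin> v ` frontier U" using connected_component_in by fastforce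
    then obtain d where d: "d > 0" "\<And>x. x \<in> frontier U \<Longrightarrow> d \<le> norm (v x - a)"
      using compact_dist_pos[OF compact_frontier_bounded[OF U(2)] cont_frontier] by metis
    show "\<exists>T. openin (top_of_set (connected_component_set (- (v ` frontier U)) y)) T \<and> a \<in> T \<and>
       (\<forall>x\<in>T. C1_degree U v A x = C1_degree U v A a)"
    proof (intro exI[of _ "connected_component_set (- (v ` frontier U)) y \<inter> ball a (d / 2)"] conjI ballI)
      show "openin (top_of_set (connected_component_set (- (v ` frontier U)) y)) (connected_component_set (- (v ` frontier U)) y \<inter> ball a (d / 2))"
        by (simp add: openin_open_Int)
      show "a \<in> connected_component_set (- (v ` frontier U)) y \<inter> ball a (d / 2)" using a d by simp
      fix x assume "x \<in> connected_component_set (- (v ` frontier U)) y \<inter> ball a (d / 2)"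
      then have "dist a x < d / 2" by simp
      then show "C1_degree U v A x = C1_degree U v A a"
        by (intro degree_close[OF C1_degree_data_axioms C1_degree_data_axioms d]) (auto simp: dist_norm norm_minus_commute)
    qed
  qed
  then show ?thesis using assms y unfolding constant_on_def by metis
qed

end

lemma std_bump_cont: "continuous_on S std_bump"
proof -
  have "continuous_on UNIV (std_bump :: real ^ 'a \<Rightarrow> real)"
    using std_bump(1) unfolding smooth_on_def by (metis Ck_on.simps(1))
  then show ?thesis using continuous_on_subset by blast
qed

lemma mollify_error:
  fixes \<phi> :: "real ^ 'n \<Rightarrow> real"
  assumes phi: "continuous_on UNIV \<phi>" and e: "e > 0" and om: "\<And>y. dist z y \<le> e \<Longrightarrow> \<bar>\<phi> y - \<phi> z\<bar> \<le> \<omega>"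
  shows "\<bar>(\<integral>y. \<phi> y * (std_bump ((1 / e) *\<^sub>R (z - y)) * (1 / e) ^ CARD('n)) \<partial>lborel) - \<phi> z\<bar> \<le> \<omega>"
proof -
  define k where "k y = std_bump ((1 / e) *\<^sub>R (z - y)) * (1 / e) ^ CARD('n)" for y :: "real ^ 'n"
  have k_cont: "continuous_on S k" for S
    unfolding k_def by (intro continuous_intros continuous_on_compose2[OF std_bump_cont[of UNIV]]) auto
  have k0: "k y = 0" if "y \<notin> cball z e" for y
  proof -
    have "norm ((1 / e) *\<^sub>R (z - y)) > 1" using that e by (simp add: dist_norm)
    then show ?thesis by (simp add: k_def std_bump(3))
  qed
  have k_nn: "k y \<ge> 0" for y unfolding k_def using e by (intro mult_nonneg_nonneg std_bump(2)) simp
  have k_int: "integrable lborel k" by (rule integrable_compact_support[OF compact_cball k_cont k0])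
  have pk_int: "integrable lborel (\<lambda>y. \<phi> y * k y)"
    by (rule integrable_compact_support[OF compact_cball[of z e]])
      (use k0 in \<open>auto intro!: continuous_intros k_cont continuous_on_subset[OF phi]\<close>)
  have k1: "(\<integral>y. k y \<partial>lborel) = 1"
  proof -
    have m: "k \<in> borel_measurable borel" by (rule borel_measurable_continuous_onI[OF k_cont])
    have "(\<integral>y. k y \<partial>lborel) = (\<integral>y. k y \<partial>density (distr lborel borel (\<lambda>x. z + (- e) *\<^sub>R x)) (\<lambda>_. ennreal (\<bar>- e\<bar> ^ DIM(real ^ 'n))))"
      using e by (subst lborel_affine[of "- e" z]) auto
    also have "\<dots> = (\<integral>x. \<bar>- e\<bar> ^ DIM(real ^ 'n) *\<^sub>R k (z + (- e) *\<^sub>R x) \<partial>lborel)"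
      using m by (simp add: integral_density integral_distr)
    also have "\<dots> = (\<integral>x. std_bump x \<partial>(lborel :: (real ^ 'n) measure))"
      unfolding k_def using e by (simp add: power_divide)
    finally show ?thesis by (simp add: std_bump(5))
  qed
  have "(\<integral>y. \<phi> y * k y \<partial>lborel) - \<phi> z = (\<integral>y. \<phi> y * k y - \<phi> z * k y \<partial>lborel)"
    using pk_int k_int k1 by simp
  also have "\<bar>\<dots>\<bar> \<le> (\<integral>y. \<omega> * k y \<partial>lborel)"
  proof (rule integral_abs_bound_integral)
    show "integrable lborel (\<lambda>y. \<phi> y * k y - \<phi> z * k y)" "integrable lborel (\<lambda>y. \<omega> * k y)"
      using pk_int k_int by auto
    fix y show "\<bar>\<phi> y * k y - \<phi> z * k y\<bar> \<le> \<omega> * k y"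
    proof (cases "y \<in> cball z e")
      case True
      then have "\<bar>\<phi> y - \<phi> z\<bar> * k y \<le> \<omega> * k y" using om k_nn by (intro mult_right_mono) auto
      then show ?thesis using k_nn by (simp add: left_diff_distrib[symmetric] abs_mult)
    qed (simp add: k0)
  qed
  also have "\<dots> = \<omega>" using k1 by simp
  finally show ?thesis unfolding k_def .
qed

lemma det_scaleR: "det (c *\<^sub>R A) = c ^ CARD('n) * det A" for A :: "real ^ 'n ^ 'n"
  unfolding det_def by (simp add: prod.distrib sum_distrib_left algebra_simps)

text \<open>Averaging \<open>\<phi>\<close> at scale \<open>e\<close> exhibits the degree integral as an integral against the degree.\<close>

lemma (in C1_degree_data) degree_integral_eq:
  assumes bnd: "\<And>x. x \<in> U \<Longrightarrow> \<bar>det (A x)\<bar> \<le> B"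
    and phi: "continuous_on UNIV \<phi>" "integrable lborel \<phi>" and S: "closed S" "\<And>y. y \<notin> S \<Longrightarrow> \<phi> y = 0"
    and disj: "S \<inter> v ` frontier U = {}"
  shows "(LINT x:U|lborel. \<phi> (v x) * det (A x)) = (\<integral>y. \<phi> y * C1_degree U v A y \<partial>lborel)"
proof -
  define V where "V x = (if x \<in> U then v x else 0)" for x
  define D where "D x = (if x \<in> U then det (A x) else 0)" for x
  have Ub: "U \<in> sets borel" using U by auto
  have mV[measurable]: "V \<in> borel_measurable borel"
    unfolding V_def[abs_def] by (rule borel_measurable_continuous_on_if) (use U C1_map_continuous_on[OF C1] in auto)
  have mD[measurable]: "D \<in> borel_measurable borel"
    unfolding D_def[abs_def] by (rule borel_measurable_continuous_on_if)
      (use U C1_map_continuous_on[OF C1] continuous_on_det in auto)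
  have mphi[measurable]: "\<phi> \<in> borel_measurable borel" by (rule borel_measurable_continuous_onI[OF phi(1)])
  have mb[measurable]: "std_bump \<in> borel_measurable (borel :: (real^'n) measure)" by (rule borel_measurable_continuous_onI[OF std_bump_cont])
  have fin: "emeasure lborel U < \<infinity>" using U(2) emeasure_bounded_finite by blast
  have iU: "integrable lborel (indicator U :: _ \<Rightarrow> real)" using fin Ub by simp
  have iD: "integrable lborel D"
  proof (rule Bochner_Integration.integrable_bound[of _ "\<lambda>x. B * indicator U x"])
    show "integrable lborel (\<lambda>x. B * indicator U x)" using iU by simp
    show "AE x in lborel. norm (D x) \<le> norm (B * indicator U x)"
    proof (intro AE_I2)
      fix x show "norm (D x) \<le> norm (B * indicator U x)"
        using bnd[of x] abs_ge_self[of B] by (cases "x \<in> U") (auto simp: D_def)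
    qed
  qed simp
  obtain R where R: "R > 0" "\<And>x. x \<in> U \<Longrightarrow> norm (v x) \<le> R"
  proof -
    have "compact (v ` closure U)" using cont U by (intro compact_continuous_image) auto
    then have "bounded (v ` closure U)" by (rule compact_imp_bounded)
    then obtain R where "R > 0" "\<forall>y\<in>v ` closure U. norm y \<le> R" unfolding bounded_pos by blast
    then show ?thesis using that closure_subset by blast
  qed
  obtain C where C: "C > 0" "\<And>x :: real ^ 'n. \<bar>std_bump x\<bar> \<le> C"
  proof -
    have "compact (std_bump ` cball (0 :: real ^ 'n) 1)" using std_bump_cont by (intro compact_continuous_image) auto
    from compact_imp_bounded[OF this]
    obtain C where C: "C > 0" "\<forall>y\<in>std_bump ` cball (0 :: real ^ 'n) 1. norm y \<le> C"
      unfolding bounded_pos by blast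
    have "\<bar>std_bump x\<bar> \<le> C" for x :: "real ^ 'n"
      using C std_bump(3)[of x] by (cases "norm x \<le> 1") auto
    then show ?thesis using that C(1) by blast
  qed
  obtain d where d: "d > 0" "\<And>x y. x \<in> frontier U \<Longrightarrow> y \<in> S \<Longrightarrow> d \<le> norm (v x - y)"
  proof -
    have "compact (v ` frontier U)"
      using U(2) cont_frontier by (intro compact_continuous_image compact_frontier_bounded)
    from separate_compact_closed[OF this S(1)]
    obtain d where "d > 0" "\<And>a b. a \<in> v ` frontier U \<Longrightarrow> b \<in> S \<Longrightarrow> d \<le> dist a b"
      using disj by blast
    then show ?thesis using that[of d] by (simp add: dist_norm)
  qed
  define L where "L = (\<integral>x. D x * \<phi> (V x) \<partial>lborel)"
  define Q where "Q = (\<integral>y. \<phi> y * C1_degree U v A y \<partial>lborel)"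
  have "\<bar>Q - L\<bar> \<le> \<omega> * (\<integral>x. \<bar>D x\<bar> \<partial>lborel)" if om: "\<omega> > 0" for \<omega>
  proof -
    have "uniformly_continuous_on (cball 0 (R + 1)) \<phi>"
      by (intro compact_uniformly_continuous continuous_on_subset[OF phi(1)]) auto
    then obtain h where h: "h > 0" "\<And>a b. a \<in> cball 0 (R + 1) \<Longrightarrow> b \<in> cball 0 (R + 1) \<Longrightarrow> dist b a < h \<Longrightarrow> dist (\<phi> b) (\<phi> a) < \<omega>"
      unfolding uniformly_continuous_on_def using om by metis
    define e where "e = Min {d / 4, h / 2, 1}"
    have e: "e > 0" "e < d / 2" "e < h" "e \<le> 1" unfolding e_def using d h by auto
    define k where "k y x = std_bump ((1 / e) *\<^sub>R (V x - y)) * (1 / e) ^ CARD('n)" for y x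
    have err: "\<bar>(\<integral>y. \<phi> y * k y x \<partial>lborel) - \<phi> (V x)\<bar> \<le> \<omega>" for x
      unfolding k_def
    proof (rule mollify_error[OF phi(1) e(1)])
      fix y assume y: "dist (V x) y \<le> e"
      have "norm (V x) \<le> R" using R by (auto simp: V_def)
      then have "V x \<in> cball 0 (R + 1)" "y \<in> cball 0 (R + 1)"
        using y e norm_triangle_sub[of y "V x"] by (auto simp: dist_norm norm_minus_commute)
      then show "\<bar>\<phi> y - \<phi> (V x)\<bar> \<le> \<omega>" using h(2)[of "V x" y] y e by (simp add: dist_real_def dist_commute)
    qed
    have mk[measurable]: "(\<lambda>(y, x). k y x) \<in> borel_measurable (borel \<Otimes>\<^sub>M borel)"
      unfolding k_def by measurable
    have int2: "integrable (lborel \<Otimes>\<^sub>M lborel) (\<lambda>(y, x). \<phi> y * (D x * k y x))"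
    proof (rule Bochner_Integration.integrable_bound[of _ "\<lambda>p. \<phi> (fst p) * D (snd p) * (C * (1 / e) ^ CARD('n))"])
      have "integrable (lborel \<Otimes>\<^sub>M lborel) (\<lambda>p. \<phi> (fst p) * D (snd p))"
      proof (rule lborel_pair.Fubini_integrable)
        show "integrable lborel (\<lambda>x. \<integral>y. norm (\<phi> (fst (x, y)) * D (snd (x, y))) \<partial>lborel)"
          using phi(2) by (simp add: abs_mult)
        show "AE x in lborel. integrable lborel (\<lambda>y. \<phi> (fst (x, y)) * D (snd (x, y)))"
          using iD by simp
      qed measurable
      then show "integrable (lborel \<Otimes>\<^sub>M lborel) (\<lambda>p. \<phi> (fst p) * D (snd p) * (C * (1 / e) ^ CARD('n)))"
        by (rule integrable_mult_left)
      show "(\<lambda>(y, x). \<phi> y * (D x * k y x)) \<in> borel_measurable (lborel \<Otimes>\<^sub>M lborel)"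
        by measurable
      have "\<bar>k y x\<bar> \<le> C * (1 / e) ^ CARD('n)" for y x
        unfolding k_def abs_mult using C e by (intro mult_mono) auto
      then have "\<bar>\<phi> y * (D x * k y x)\<bar> \<le> \<bar>\<phi> y * D x * (C * (1 / e) ^ CARD('n))\<bar>" for y x
        using C e by (simp only: abs_mult mult.assoc) (intro mult_left_mono; auto)
      then show "AE p in lborel \<Otimes>\<^sub>M lborel. norm (case p of (y, x) \<Rightarrow> \<phi> y * (D x * k y x)) \<le> norm (\<phi> (fst p) * D (snd p) * (C * (1 / e) ^ CARD('n)))"
        by (intro AE_I2) (auto split: prod.splits)
    qed
    have deg: "\<phi> y * C1_degree U v A y = (\<integral>x. \<phi> y * (D x * k y x) \<partial>lborel)" for y
    proof (cases "y \<in> S")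
      case True
      have "C1_degree U v A y = scaled_degree U v A y e"
        by (rule degree_eq_scaled[of d]) (use d True e in auto)
      also have "\<dots> = (\<integral>x. D x * k y x \<partial>lborel)"
        unfolding scaled_degree_def set_lebesgue_integral_def
        by (intro Bochner_Integration.integral_cong refl) (auto simp: D_def V_def k_def det_scaleR indicator_def)
      finally show ?thesis by simp
    qed (simp add: S)
    have Q: "Q = (\<integral>x. (\<integral>y. \<phi> y * (D x * k y x) \<partial>lborel) \<partial>lborel)"
      unfolding Q_def deg by (rule lborel_pair.Fubini_integral[OF int2, symmetric])
    also have "\<dots> = (\<integral>x. D x * (\<integral>y. \<phi> y * k y x \<partial>lborel) \<partial>lborel)"
      by (subst integral_mult_right_zero[symmetric]) (simp add: ac_simps)
    finally have Q: "Q = (\<integral>x. D x * (\<integral>y. \<phi> y * k y x \<partial>lborel) \<partial>lborel)" .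
    have int_Q: "integrable lborel (\<lambda>x. D x * (\<integral>y. \<phi> y * k y x \<partial>lborel))"
    proof -
      have "integrable lborel (\<lambda>x. \<integral>y. \<phi> y * (D x * k y x) \<partial>lborel)"
        using lborel_pair.integrable_snd[OF int2] by simp
      moreover have "(\<integral>y. \<phi> y * (D x * k y x) \<partial>lborel) = D x * (\<integral>y. \<phi> y * k y x \<partial>lborel)" for x
        by (subst integral_mult_right_zero[symmetric]) (simp add: ac_simps)
      ultimately show ?thesis by simp
    qed
    have int_err: "integrable lborel (\<lambda>x. D x * ((\<integral>y. \<phi> y * k y x \<partial>lborel) - \<phi> (V x)))"
    proof (rule Bochner_Integration.integrable_bound[of _ "\<lambda>x. D x * \<omega>"])
      show "integrable lborel (\<lambda>x. D x * \<omega>)" using iD by simp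
      show "AE x in lborel. norm (D x * ((\<integral>y. \<phi> y * k y x \<partial>lborel) - \<phi> (V x))) \<le> norm (D x * \<omega>)"
        using err om by (intro AE_I2) (auto simp: abs_mult intro!: mult_left_mono)
    qed measurable
    have "Q - L = (\<integral>x. D x * ((\<integral>y. \<phi> y * k y x \<partial>lborel) - \<phi> (V x)) \<partial>lborel)"
    proof -
      have "integrable lborel (\<lambda>x. D x * (\<integral>y. \<phi> y * k y x \<partial>lborel) - D x * ((\<integral>y. \<phi> y * k y x \<partial>lborel) - \<phi> (V x)))"
        using int_Q int_err by (rule Bochner_Integration.integrable_diff)
      then have "integrable lborel (\<lambda>x. D x * \<phi> (V x))" by (simp add: algebra_simps)
      then show ?thesis unfolding Q L_def using int_Q by (simp add: right_diff_distrib)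
    qed
    also have "\<bar>\<dots>\<bar> \<le> (\<integral>x. \<omega> * \<bar>D x\<bar> \<partial>lborel)"
      by (rule integral_abs_bound_integral[OF int_err])
        (use iD mult_left_mono[OF err abs_ge_zero] in \<open>auto simp: abs_mult mult.commute\<close>)
    finally show ?thesis by simp
  qed
  then have le: "\<bar>Q - L\<bar> \<le> e" if "e > 0" for e
  proof -
    define I where "I = (\<integral>x. \<bar>D x\<bar> \<partial>lborel)"
    have I: "I \<ge> 0" unfolding I_def by simp
    have "\<bar>Q - L\<bar> \<le> e / (I + 1) * I" unfolding I_def[symmetric]
      using \<open>\<And>\<omega>. 0 < \<omega> \<Longrightarrow> \<bar>Q - L\<bar> \<le> \<omega> * (\<integral>x. \<bar>D x\<bar> \<partial>lborel)\<close>[of "e / (I + 1)"] I that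
      by (simp only: I_def[symmetric]) (simp add: add_nonneg_pos)
    also have "\<dots> \<le> e" using I that by (simp add: field_simps)
    finally show ?thesis .
  qed
  have "\<bar>Q - L\<bar> \<le> 0" by (rule field_le_epsilon) (use le in simp)
  then have "Q = L" by simp
  moreover have "L = (LINT x:U|lborel. \<phi> (v x) * det (A x))"
    unfolding L_def set_lebesgue_integral_def
    by (intro Bochner_Integration.integral_cong refl) (auto simp: D_def V_def indicator_def)
  ultimately show ?thesis unfolding Q_def by simp
qed

subsection \<open>The Brouwer degree of a continuous map\<close>

abbreviation jac :: "(real ^ 'n \<Rightarrow> real ^ 'n) \<Rightarrow> real ^ 'n \<Rightarrow> real ^ 'n ^ 'n" where
  "jac v \<equiv> \<lambda>x. jacobian v (at x)"

lemma smooth_on_closure_C1: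
  fixes v :: "real ^ 'n \<Rightarrow> real ^ 'n"
  assumes "open U" "bounded U" "smooth_on_closure U v"
  shows "C1_degree_data U v (jac v)" "\<exists>B. \<forall>x\<in>U. \<bar>det (jac v x)\<bar> \<le> B"
proof -
  obtain W where W: "open W" "closure U \<subseteq> W" "smooth_on W v"
    using assms(3) unfolding smooth_on_closure_def by blast
  note C1 = C1_map_subset[OF smooth_on_C1_map[OF W(3)] W(2)]
  show "C1_degree_data U v (jac v)"
    using assms C1 C1_map_subset[OF C1 closure_subset] C1_map_continuous_on(1)[OF C1] by unfold_locales
  have "compact ((\<lambda>x. det (jac v x)) ` closure U)"
    using assms(2) C1_map_continuous_on(2)[OF C1] by (intro compact_continuous_image continuous_on_det) auto
  from compact_imp_bounded[OF this] obtain B where "\<forall>d\<in>(\<lambda>x. det (jac v x)) ` closure U. norm d \<le> B"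
    unfolding bounded_iff by blast
  then show "\<exists>B. \<forall>x\<in>U. \<bar>det (jac v x)\<bar> \<le> B" using closure_subset[of U] by (intro exI[of _ B]) auto
qed

lemma smooth_degree_eq:
  fixes v :: "real ^ 'n \<Rightarrow> real ^ 'n"
  assumes U: "open U" "bounded U" and v: "smooth_on_closure U v" and y: "y \<notin> v ` frontier U"
  shows "smooth_degree v U y = C1_degree U v (jac v) y"
proof -
  interpret C1_degree_data U v "jac v" by (rule smooth_on_closure_C1[OF U v])
  obtain B where B: "\<And>x. x \<in> U \<Longrightarrow> \<bar>det (jac v x)\<bar> \<le> B" using smooth_on_closure_C1(2)[OF U v] by blast
  define V where "V = connected_component_set (- (v ` frontier U)) y"
  have V: "V \<subseteq> - (v ` frontier U)" unfolding V_def by (rule connected_component_subset)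
  have val: "(LINT x:U|lborel. \<phi> (v x) * det (jac v x)) = C1_degree U v (jac v) y" if \<phi>: "unit_form_in V \<phi>" for \<phi>
  proof -
    have phi: "continuous_on UNIV \<phi>" "integrable lborel \<phi>" "closure {y. \<phi> y \<noteq> 0} \<subseteq> V" "(\<integral>y. \<phi> y \<partial>lborel) = 1"
      using \<phi> unfolding unit_form_in_def smooth_on_def by (metis Ck_on.simps(1), blast+)
    have "(LINT x:U|lborel. \<phi> (v x) * det (jac v x)) = (\<integral>z. \<phi> z * C1_degree U v (jac v) z \<partial>lborel)"
      by (rule degree_integral_eq[OF B phi(1,2), of "closure {y. \<phi> y \<noteq> 0}"])
        (use phi(3) V closure_subset[of "{y. \<phi> y \<noteq> 0}"] in auto)
    also have "\<dots> = (\<integral>z. \<phi> z * C1_degree U v (jac v) y \<partial>lborel)"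
    proof (intro Bochner_Integration.integral_cong refl)
      fix z show "\<phi> z * C1_degree U v (jac v) z = \<phi> z * C1_degree U v (jac v) y"
      proof (cases "\<phi> z = 0")
        case False
        then have "z \<in> V" using phi(3) closure_subset[of "{y. \<phi> y \<noteq> 0}"] by auto
        then show ?thesis using degree_component unfolding V_def by simp
      qed simp
    qed
    also have "\<dots> = C1_degree U v (jac v) y" using phi(4) by simp
    finally show ?thesis .
  qed
  have "\<exists>\<phi>. unit_form_in V \<phi>"
  proof -
    have cl: "compact (v ` frontier U)"
      using U(2) cont_frontier by (intro compact_continuous_image compact_frontier_bounded)
    then have "open V" unfolding V_def by (intro open_connected_component open_Compl compact_imp_closed)
    moreover have "y \<in> V" using y unfolding V_def by simp
    ultimately obtain e where e: "e > 0" "cball y e \<subseteq> V" using open_contains_cball_eq[of V] by blast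
    obtain \<phi> :: "real ^ 'n \<Rightarrow> real" where phi: "smooth_on UNIV \<phi>" "\<forall>x. x \<notin> cball y e \<longrightarrow> \<phi> x = 0"
      "integrable lborel \<phi>" "(\<integral>x. \<phi> x \<partial>lborel) = 1"
      using ex_smooth_bump[where c=y, OF e(1)] by blast
    have "closure {x. \<phi> x \<noteq> 0} \<subseteq> cball y e" by (rule closure_minimal) (use phi(2) in auto)
    then show ?thesis using phi e unfolding unit_form_in_def by blast
  qed
  then obtain \<phi> where phi: "unit_form_in V \<phi>" by blast
  show ?thesis
    unfolding smooth_degree_def V_def[symmetric]
  proof (rule the_equality)
    show "\<forall>\<phi>. unit_form_in V \<phi> \<longrightarrow> (LINT x:U|lborel. \<phi> (v x) * det (jac v x)) = C1_degree U v (jac v) y"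
      using val by blast
    fix D assume "\<forall>\<phi>. unit_form_in V \<phi> \<longrightarrow> (LINT x:U|lborel. \<phi> (v x) * det (jac v x)) = D"
    from this[rule_format, OF phi] show "D = C1_degree U v (jac v) y" using val[OF phi] by simp
  qed
qed

lemma smooth_on_closure_polynomial:
  fixes p :: "real ^ 'n \<Rightarrow> real ^ 'n"
  shows "polynomial_function p \<Longrightarrow> smooth_on_closure U p"
  unfolding smooth_on_closure_def using smooth_on_polynomial_function by blast

lemma brouwer_degree_eq:
  fixes u v :: "real ^ 'n \<Rightarrow> real ^ 'n"
  assumes U: "open U" "bounded U" and u: "continuous_on (closure U) u" and v: "smooth_on_closure U v"
    and d: "d > 0" "\<And>x. x \<in> frontier U \<Longrightarrow> d \<le> norm (u x - y)" "\<And>x. x \<in> closure U \<Longrightarrow> norm (v x - u x) \<le> d / 8"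
  shows "brouwer_degree u U y = C1_degree U v (jac v) y"
proof -
  have fr: "x \<in> closure U" if "x \<in> frontier U" for x using that by (simp add: frontier_def)
  have lim: "(\<lambda>k. smooth_degree (w k) U y) \<longlonglongrightarrow> C1_degree U v (jac v) y"
    if w: "\<forall>k. smooth_on_closure U (w k)" "uniform_limit (closure U) w u sequentially" for w
  proof (rule tendsto_eventually)
    have "eventually (\<lambda>k. \<forall>x\<in>closure U. dist (w k x) (u x) < d / 8) sequentially"
      by (rule uniform_limitD[OF w(2)]) (use d in simp)
    then show "eventually (\<lambda>k. smooth_degree (w k) U y = C1_degree U v (jac v) y) sequentially"
    proof eventually_elim
      fix k assume k: "\<forall>x\<in>closure U. dist (w k x) (u x) < d / 8"
      have lowv: "d / 2 \<le> norm (v x - y)" if "x \<in> frontier U" for x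
        using d(2)[OF that] d(3)[OF fr[OF that]] norm_triangle_ineq2[of "u x - y" "u x - v x"] d(1)
        by (simp add: norm_minus_commute)
      have "y \<notin> w k ` frontier U"
      proof
        assume "y \<in> w k ` frontier U"
        then obtain x where "x \<in> frontier U" "y = w k x" by blast
        then show False using d(1) d(2)[of x] k fr[of x] by (force simp: dist_norm norm_minus_commute)
      qed
      then have "smooth_degree (w k) U y = C1_degree U (w k) (jac (w k)) y"
        using w(1) by (intro smooth_degree_eq U) auto
      also have "\<dots> = C1_degree U v (jac v) y"
      proof (rule degree_close[OF smooth_on_closure_C1(1)[OF U v] smooth_on_closure_C1(1)[OF U w(1)[rule_format]], of "d / 2"])
        fix x assume x: "x \<in> frontier U"
        show "d / 2 \<le> norm (v x - y)" by (rule lowv[OF x])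
        have "norm (w k x - v x) \<le> dist (w k x) (u x) + norm (v x - u x)"
          using norm_triangle_ineq4[of "w k x - u x" "v x - u x"] by (simp add: dist_norm)
        then show "norm (w k x - y - (v x - y)) \<le> d / 2 / 2"
          using bspec[OF k fr[OF x]] d(3)[OF fr[OF x]] by simp
      qed (use d in simp)
      finally show "smooth_degree (w k) U y = C1_degree U v (jac v) y" .
    qed
  qed
  obtain p where p: "uniform_limit (closure U) p u sequentially" "\<And>k. polynomial_function (p k)"
    using Stone_Weierstrass_uniform_limit[OF _ u] U(2) by (metis compact_closure)
  show ?thesis
    unfolding brouwer_degree_def
  proof (rule the_equality)
    fix D assume "\<forall>w. (\<forall>k. smooth_on_closure U (w k)) \<and> uniform_limit (closure U) w u sequentially
      \<longrightarrow> (\<lambda>k. smooth_degree (w k) U y) \<longlonglongrightarrow> D"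
    then have "(\<lambda>k. smooth_degree (p k) U y) \<longlonglongrightarrow> D"
      using p smooth_on_closure_polynomial by blast
    moreover have "(\<lambda>k. smooth_degree (p k) U y) \<longlonglongrightarrow> C1_degree U v (jac v) y"
      using p smooth_on_closure_polynomial by (intro lim) auto
    ultimately show "D = C1_degree U v (jac v) y" by (rule LIMSEQ_unique)
  qed (use lim in blast)
qed

locale degree_data =
  fixes U :: "(real ^ 'n) set" and u :: "real ^ 'n \<Rightarrow> real ^ 'n"
  assumes U: "open U" "bounded U" and cont: "continuous_on (closure U) u"
begin

lemma frontier_closure: "x \<in> frontier U \<Longrightarrow> x \<in> closure U"
  by (simp add: frontier_def)

lemma cont_frontier: "continuous_on (frontier U) u"
  using cont by (rule continuous_on_subset) (simp add: frontier_def)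

lemma compact_image: "compact (u ` frontier U)"
  using U(2) cont_frontier by (intro compact_continuous_image compact_frontier_bounded)

lemma approx:
  assumes "e > 0"
  obtains v where "smooth_on_closure U v" "\<And>x. x \<in> closure U \<Longrightarrow> norm (v x - u x) \<le> e"
proof -
  have "compact (closure U)" using U by simp
  from Stone_Weierstrass_polynomial_function[OF this cont assms]
  obtain g where g: "polynomial_function g" "\<forall>x\<in>closure U. norm (u x - g x) < e" by blast
  show ?thesis
  proof
    show "smooth_on_closure U g" using g(1) by (rule smooth_on_closure_polynomial)
    show "norm (g x - u x) \<le> e" if "x \<in> closure U" for x using g(2) that by (force simp: norm_minus_commute)
  qed
qed

lemma brouwer_degree_locally_constant:
  assumes "y \<notin> u ` frontier U"
  shows "\<exists>r>0. \<forall>y'\<in>ball y r. brouwer_degree u U y' = brouwer_degree u U y"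
proof -
  obtain d where d: "d > 0" "\<And>x. x \<in> frontier U \<Longrightarrow> d \<le> norm (u x - y)"
    using compact_dist_pos[OF compact_frontier_bounded[OF U(2)] cont_frontier assms] by blast
  obtain v where v: "smooth_on_closure U v" "\<And>x. x \<in> closure U \<Longrightarrow> norm (v x - u x) \<le> d / 16"
    using approx[of "d / 16"] d(1) by auto
  have "brouwer_degree u U y' = brouwer_degree u U y" if y': "y' \<in> ball y (d / 4)" for y'
  proof -
    have yy: "norm (y - y') < d / 4" using y' by (simp add: dist_norm)
    have "brouwer_degree u U y' = C1_degree U v (jac v) y'"
    proof (rule brouwer_degree_eq[OF U cont v(1), of "d / 2"])
      show "d / 2 \<le> norm (u x - y')" if "x \<in> frontier U" for x
        using d(2)[OF that] yy norm_triangle_ineq2[of "u x - y" "y' - y"] d(1) by (simp add: norm_minus_commute)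
    qed (use d v(2) in auto)
    also have "\<dots> = C1_degree U v (jac v) y"
    proof (rule degree_close[OF smooth_on_closure_C1(1)[OF U v(1)] smooth_on_closure_C1(1)[OF U v(1)], of "d / 2"])
      show "d / 2 \<le> norm (v x - y)" if "x \<in> frontier U" for x
        using d(2)[OF that] v(2)[OF frontier_closure[OF that]] norm_triangle_ineq2[of "u x - y" "u x - v x"] d(1)
        by (simp add: norm_minus_commute)
      show "norm (v x - y' - (v x - y)) \<le> d / 2 / 2" for x using yy by simp
    qed (use d in simp)
    also have "\<dots> = brouwer_degree u U y"
    proof (rule brouwer_degree_eq[OF U cont v(1) d, symmetric])
      show "norm (v x - u x) \<le> d / 8" if "x \<in> closure U" for x using v(2)[OF that] d(1) by simp
    qed
    finally show ?thesis .
  qed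
  moreover have "d / 4 > 0" using d(1) by simp
  ultimately show ?thesis by blast
qed

lemma brouwer_degree_bounded_support:
  obtains R where "\<And>y. norm y > R \<Longrightarrow> brouwer_degree u U y = 0"
proof -
  have "compact (u ` closure U)" using U cont by (intro compact_continuous_image) auto
  from compact_imp_bounded[OF this] obtain R where R: "\<And>x. x \<in> closure U \<Longrightarrow> norm (u x) \<le> R"
    unfolding bounded_iff by blast
  have "brouwer_degree u U y = 0" if "norm y > R + 2" for y
  proof -
    have low: "2 \<le> norm (u x - y)" if "x \<in> closure U" for x
      using R[OF that] \<open>norm y > R + 2\<close> norm_triangle_ineq2[of y "u x"] by (simp add: norm_minus_commute)
    obtain v where v: "smooth_on_closure U v" "\<And>x. x \<in> closure U \<Longrightarrow> norm (v x - u x) \<le> 1 / 8"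
      using approx[of "1 / 8"] by auto
    interpret v: C1_degree_data U v "jac v" by (rule smooth_on_closure_C1[OF U v(1)])
    have "brouwer_degree u U y = C1_degree U v (jac v) y"
    proof (rule brouwer_degree_eq[OF U cont v(1), of 1])
      show "1 \<le> norm (u x - y)" if "x \<in> frontier U" for x using low[OF frontier_closure[OF that]] by simp
    qed (use v(2) in auto)
    also have "\<dots> = 0"
    proof (rule v.degree_far[of 1])
      show "1 \<le> norm (v x - y)" if "x \<in> closure U" for x
        using low[OF that] v(2)[OF that] norm_triangle_ineq2[of "u x - y" "u x - v x"] by (simp add: norm_minus_commute)
    qed simp
    finally show ?thesis .
  qed
  then show ?thesis using that by blast
qed

lemma brouwer_degree_integral:
  assumes S: "compact S" "S \<inter> u ` frontier U = {}"
  obtains \<delta> where "\<delta> > 0" "\<And>x y. x \<in> frontier U \<Longrightarrow> y \<in> S \<Longrightarrow> \<delta> < norm (u x - y)"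
    "\<And>w B \<phi> \<phi>'. C1_degree_data U w B \<Longrightarrow> (\<And>x. x \<in> frontier U \<Longrightarrow> norm (w x - u x) \<le> \<delta>) \<Longrightarrow>
      C1_scalar UNIV \<phi> \<phi>' \<Longrightarrow> (\<And>y. y \<notin> S \<Longrightarrow> \<phi> y = 0) \<Longrightarrow>
      (LINT x:U|lborel. \<phi> (w x) * det (B x)) = (\<integral>y. \<phi> y * brouwer_degree u U y \<partial>lborel)"
proof -
  have "u ` frontier U \<inter> S = {}" using S(2) by blast
  from separate_compact_closed[OF compact_image compact_imp_closed[OF S(1)] this]
  obtain d where d: "d > 0" "\<And>x y. x \<in> frontier U \<Longrightarrow> y \<in> S \<Longrightarrow> d \<le> norm (u x - y)"
    by (auto simp: dist_norm)
  obtain v where v: "smooth_on_closure U v" "\<And>x. x \<in> closure U \<Longrightarrow> norm (v x - u x) \<le> d / 8"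
    using approx[of "d / 8"] d(1) by auto
  interpret v: C1_degree_data U v "jac v" by (rule smooth_on_closure_C1[OF U v(1)])
  obtain B0 where B0: "\<And>x. x \<in> U \<Longrightarrow> \<bar>det (jac v x)\<bar> \<le> B0" using smooth_on_closure_C1(2)[OF U v(1)] by blast
  show ?thesis
  proof
    show "d / 8 > 0" using d by simp
    show "d / 8 < norm (u x - y)" if "x \<in> frontier U" "y \<in> S" for x y using d(2)[OF that] d(1) by simp
    fix w B \<phi> \<phi>'
    assume w: "C1_degree_data U w B" "\<And>x. x \<in> frontier U \<Longrightarrow> norm (w x - u x) \<le> d / 8"
      and phi: "C1_scalar UNIV \<phi> \<phi>'" "\<And>y. y \<notin> S \<Longrightarrow> \<phi> y = 0"
    interpret w: C1_degree_data U w B by (rule w)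
    have "(LINT x:U|lborel. \<phi> (w x) * det (B x)) = (LINT x:U|lborel. \<phi> (v x) * det (jac v x))"
    proof (rule degree_integral_homotopy[OF U w.C1 v.C1 phi(1) w.cont v.cont compact_imp_closed[OF S(1)] phi(2)])
      fix x t assume x: "x \<in> frontier U" and t: "t \<in> {0..1::real}"
      show "w x + t *\<^sub>R (v x - w x) \<notin> S"
      proof
        assume "w x + t *\<^sub>R (v x - w x) \<in> S"
        then have "d \<le> norm (u x - (w x + t *\<^sub>R (v x - w x)))" using d(2) x by blast
        also have "u x - (w x + t *\<^sub>R (v x - w x)) = (u x - w x) - t *\<^sub>R ((v x - u x) - (w x - u x))" by simp
        also have "norm \<dots> \<le> norm (u x - w x) + norm (t *\<^sub>R ((v x - u x) - (w x - u x)))" by (rule norm_triangle_ineq4)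
        also have "norm (t *\<^sub>R ((v x - u x) - (w x - u x))) \<le> norm ((v x - u x) - (w x - u x))"
          using t by (simp add: mult_left_le_one_le)
        also have "\<dots> \<le> norm (v x - u x) + norm (w x - u x)" by (rule norm_triangle_ineq4)
        finally show False using w(2)[OF x] v(2)[OF frontier_closure[OF x]] d(1) by (simp add: norm_minus_commute)
      qed
    qed
    also have "\<dots> = (\<integral>y. \<phi> y * C1_degree U v (jac v) y \<partial>lborel)"
    proof (rule v.degree_integral_eq[OF B0 C1_scalar_continuous_on[OF phi(1)] _ compact_imp_closed[OF S(1)] phi(2)])
      show "integrable lborel \<phi>"
        by (rule integrable_compact_support[OF S(1)]) (auto simp: phi(2) intro: continuous_on_subset[OF C1_scalar_continuous_on[OF phi(1)]])
      show "S \<inter> v ` frontier U = {}"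
      proof -
        have "v x \<notin> S" if x: "x \<in> frontier U" for x
        proof
          assume "v x \<in> S"
          then have "d \<le> norm (u x - v x)" using d(2) x by blast
          then show False using v(2)[OF frontier_closure[OF x]] d(1) by (simp add: norm_minus_commute)
        qed
        then show ?thesis by blast
      qed
    qed
    also have "\<dots> = (\<integral>y. \<phi> y * brouwer_degree u U y \<partial>lborel)"
    proof (intro Bochner_Integration.integral_cong refl)
      fix y show "\<phi> y * C1_degree U v (jac v) y = \<phi> y * brouwer_degree u U y"
      proof (cases "y \<in> S")
        case True
        then show ?thesis using brouwer_degree_eq[OF U cont v(1) d(1) d(2)[OF _ True] v(2)] by simp
      qed (simp add: phi(2))
    qed
    finally show "(LINT x:U|lborel. \<phi> (w x) * det (B x)) = (\<integral>y. \<phi> y * brouwer_degree u U y \<partial>lborel)" .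
  qed
qed

end

subsection \<open>Covering numbers and neighbourhoods of the boundary\<close>

lemma covering_number_cover:
  fixes E :: "'a::euclidean_space set"
  assumes "compact E" "r > 0"
  obtains P where "finite P" "card P = covering_number r E" "E \<subseteq> (\<Union>a\<in>P. cbox a (a + r *\<^sub>R One))"
proof -
  have "E \<subseteq> (\<Union>x\<in>E. box (x - (r / 2) *\<^sub>R One) (x + (r / 2) *\<^sub>R One))"
    using assms(2) by (auto simp: mem_box inner_diff_left inner_add_left)
  from compactE_image[OF assms(1) open_box this]
  obtain C where C: "C \<subseteq> E" "finite C" "E \<subseteq> (\<Union>x\<in>C. box (x - (r / 2) *\<^sub>R One) (x + (r / 2) *\<^sub>R One))"
    by blast
  have "E \<subseteq> (\<Union>a\<in>(\<lambda>x. x - (r / 2) *\<^sub>R One) ` C. cbox a (a + r *\<^sub>R One))"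
  proof
    fix y assume "y \<in> E"
    then obtain x where x: "x \<in> C" "y \<in> box (x - (r / 2) *\<^sub>R One) (x + (r / 2) *\<^sub>R One)" using C(3) by blast
    have "x - (r / 2) *\<^sub>R One + r *\<^sub>R One = x + (r / 2) *\<^sub>R One"
      by (simp add: algebra_simps flip: scaleR_add_left)
    then have "y \<in> cbox (x - (r / 2) *\<^sub>R One) (x - (r / 2) *\<^sub>R One + r *\<^sub>R One)"
      using x(2) box_subset_cbox by (metis subsetD)
    then show "y \<in> (\<Union>a\<in>(\<lambda>x. x - (r / 2) *\<^sub>R One) ` C. cbox a (a + r *\<^sub>R One))" using x(1) by blast
  qed
  then have "\<exists>k P. finite P \<and> card P = k \<and> E \<subseteq> (\<Union>a\<in>P. cbox a (a + r *\<^sub>R One))"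
    by (intro exI conjI) (use C(2) in \<open>rule finite_imageI\<close>, rule refl)
  from LeastI_ex[OF this] show ?thesis using that unfolding covering_number_def by blast
qed

lemma frontier_near:
  fixes U :: "(real ^ 'n) set"
  assumes "x \<in> U" "\<not> cube_in U x s"
  obtains q where "q \<in> frontier U" "\<And>i. \<bar>q $ i - x $ i\<bar> \<le> s"
proof -
  obtain y where y: "y \<notin> U" "\<And>i. \<bar>y $ i - x $ i\<bar> \<le> s" using assms(2) unfolding cube_in_def by blast
  have "closed_segment x y \<inter> frontier U \<noteq> {}"
    by (rule connected_Int_frontier) (use assms(1) y(1) in auto)
  then obtain q where q: "q \<in> frontier U" "q \<in> closed_segment x y" by blast
  then obtain t where t: "0 \<le> t" "t \<le> 1" "q = (1 - t) *\<^sub>R x + t *\<^sub>R y" by (auto simp: in_segment)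
  have "\<bar>q $ i - x $ i\<bar> \<le> s" for i
  proof -
    have "q $ i - x $ i = t * (y $ i - x $ i)" unfolding t(3) by (simp add: algebra_simps)
    then have "\<bar>q $ i - x $ i\<bar> = t * \<bar>y $ i - x $ i\<bar>" using t by (simp add: abs_mult)
    also have "\<dots> \<le> 1 * s" using t y(2) by (intro mult_mono) auto
    finally show ?thesis by simp
  qed
  then show ?thesis using q(1) that by blast
qed

lemma boundary_layer_cover:
  fixes U :: "(real ^ 'n) set"
  assumes "bounded U" "r > 0"
  obtains H where "H \<in> sets borel" "{x \<in> U. \<not> cube_in U x (5 * r)} \<subseteq> H"
    "emeasure lborel H \<le> ennreal (real (covering_number r (frontier U)) * (11 * r) ^ CARD('n))"
proof -
  obtain P where P: "finite P" "card P = covering_number r (frontier U)" "frontier U \<subseteq> (\<Union>a\<in>P. cbox a (a + r *\<^sub>R One))"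
    using covering_number_cover[OF compact_frontier_bounded[OF assms(1)] assms(2)] by blast
  define Q :: "real ^ 'n \<Rightarrow> (real ^ 'n) set" where "Q a = cbox (a - (5 * r) *\<^sub>R One) (a + (6 * r) *\<^sub>R One)" for a
  define H where "H = (\<Union>a\<in>P. Q a)"
  have "{x \<in> U. \<not> cube_in U x (5 * r)} \<subseteq> H"
  proof
    fix x assume "x \<in> {x \<in> U. \<not> cube_in U x (5 * r)}"
    then obtain q where q: "q \<in> frontier U" "\<And>i. \<bar>q $ i - x $ i\<bar> \<le> 5 * r" using frontier_near by blast
    then obtain a where a: "a \<in> P" "q \<in> cbox a (a + r *\<^sub>R One)" using P(3) by blast
    have "(a - (5 * r) *\<^sub>R One) $ i \<le> x $ i \<and> x $ i \<le> (a + (6 * r) *\<^sub>R One) $ i" for i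
    proof -
      have "a $ i \<le> q $ i" "q $ i \<le> a $ i + r" using a(2) One_component[where 'n='n] by (auto simp: mem_box_cart)
      then show ?thesis using q(2)[of i] One_component[of i] by (simp add: abs_le_iff)
    qed
    then have "x \<in> Q a" unfolding Q_def mem_box_cart by blast
    then show "x \<in> H" using a(1) unfolding H_def by blast
  qed
  moreover have "H \<in> sets borel" unfolding H_def Q_def using P(1) by auto
  moreover have "emeasure lborel H \<le> ennreal (real (covering_number r (frontier U)) * (11 * r) ^ CARD('n))"
  proof -
    have "emeasure lborel H \<le> (\<Sum>a\<in>P. emeasure lborel (Q a))"
      unfolding H_def by (rule emeasure_subadditive_finite[OF P(1)]) (auto simp: Q_def)
    also have "emeasure lborel (Q a) = ennreal ((11 * r) ^ CARD('n))" for a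
    proof -
      have "emeasure lborel (Q a) = ennreal (\<Prod>b\<in>Basis. (a + (6 * r) *\<^sub>R One - (a - (5 * r) *\<^sub>R One)) \<bullet> b)"
        unfolding Q_def using assms(2) by (intro emeasure_lborel_cbox) (auto simp: inner_diff_left inner_add_left)
      also have "(\<Prod>b\<in>Basis. (a + (6 * r) *\<^sub>R One - (a - (5 * r) *\<^sub>R One)) \<bullet> b) = (\<Prod>b\<in>(Basis :: (real ^ 'n) set). 11 * r)"
        by (rule prod.cong) (auto simp: inner_diff_left inner_add_left)
      finally show ?thesis by simp
    qed
    then have "(\<Sum>a\<in>P. emeasure lborel (Q a)) = ennreal (real (covering_number r (frontier U)) * (11 * r) ^ CARD('n))"
      using assms(2) by (simp add: P(2)[symmetric] ennreal_of_nat_eq_real_of_nat ennreal_mult)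
    finally show ?thesis .
  qed
  ultimately show ?thesis using that by blast
qed

lemma no_large_cube:
  fixes U :: "(real ^ 'n) set"
  assumes "bounded U" obtains R where "R > 0" "\<And>x. \<not> cube_in U x R"
proof -
  obtain B where B: "B > 0" "\<And>x. x \<in> U \<Longrightarrow> norm x \<le> B" using assms unfolding bounded_pos by blast
  have "\<not> cube_in U x (B + 1)" for x
  proof
    assume c: "cube_in U x (B + 1)"
    define y z where "y = (\<chi> i. x $ i + (B + 1))" and "z = (\<chi> i. x $ i - (B + 1))"
    have "y \<in> U" "z \<in> U" using c B(1) unfolding cube_in_def y_def z_def by auto
    then have "norm y \<le> B" "norm z \<le> B" using B by auto
    then have "\<bar>y $ i\<bar> \<le> B" "\<bar>z $ i\<bar> \<le> B" for i using component_le_norm_cart order_trans by blast+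
    then have "\<bar>x $ undefined + (B + 1)\<bar> \<le> B" "\<bar>x $ undefined - (B + 1)\<bar> \<le> B" unfolding y_def z_def by auto
    then show False by linarith
  qed
  then show ?thesis using that[of "B + 1"] B(1) by simp
qed

lemma det_bound:
  fixes A :: "real ^ 'n ^ 'n"
  assumes "\<And>i j. \<bar>A $ i $ j\<bar> \<le> c i"
  shows "\<bar>det A\<bar> \<le> fact CARD('n) * (\<Prod>i\<in>UNIV. c i)"
proof -
  have "\<bar>det A\<bar> \<le> (\<Sum>p | p permutes (UNIV :: 'n set). \<bar>of_int (sign p) * (\<Prod>i\<in>UNIV. A $ i $ p i)\<bar>)"
    unfolding det_def by (rule sum_abs)
  also have "\<dots> \<le> (\<Sum>p | p permutes (UNIV :: 'n set). \<Prod>i\<in>UNIV. c i)"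
  proof (rule sum_mono)
    fix p :: "'n \<Rightarrow> 'n"
    have "\<bar>of_int (sign p) * (\<Prod>i\<in>UNIV. A $ i $ p i)\<bar> = (\<Prod>i\<in>UNIV. \<bar>A $ i $ p i\<bar>)"
      by (simp add: abs_mult sign_def abs_prod)
    also have "\<dots> \<le> (\<Prod>i\<in>UNIV. c i)" by (rule prod_mono) (use assms in auto)
    finally show "\<bar>of_int (sign p) * (\<Prod>i\<in>UNIV. A $ i $ p i)\<bar> \<le> (\<Prod>i\<in>UNIV. c i)" .
  qed
  also have "\<dots> = fact CARD('n) * (\<Prod>i\<in>UNIV. c i)" by (simp add: card_permutations[OF refl])
  finally show ?thesis .
qed

subsection \<open>Multiscale approximation of Hoelder maps\<close>

text \<open>Grid points outside the closure of \<open>U\<close>, where the values of \<open>u\<close> are irrelevant, are projected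
  to it.\<close>

definition spline_approx :: "(real ^ 'n) set \<Rightarrow> (real ^ 'n \<Rightarrow> real ^ 'n) \<Rightarrow> real \<Rightarrow> real ^ 'n \<Rightarrow> real ^ 'n" where
  "spline_approx U u r x = (\<Sum>z\<in>grid (grid_size U r). grid_bump r z x *\<^sub>R u (closest_point (closure U) (grid_point r z)))"

definition spline_approx' :: "(real ^ 'n) set \<Rightarrow> (real ^ 'n \<Rightarrow> real ^ 'n) \<Rightarrow> real \<Rightarrow> real ^ 'n \<Rightarrow> real ^ 'n ^ 'n" where
  "spline_approx' U u r x = (\<chi> i. \<Sum>z\<in>grid (grid_size U r). u (closest_point (closure U) (grid_point r z)) $ i *\<^sub>R grid_bump' r z x)"

lemma C1_spline_approx: "C1_map S (spline_approx U u r) (spline_approx' U u r)"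
  unfolding C1_map_def
proof
  fix i
  have "C1_scalar S (\<lambda>x. \<Sum>z\<in>grid (grid_size U r). u (closest_point (closure U) (grid_point r z)) $ i * grid_bump r z x)
    (\<lambda>x. \<Sum>z\<in>grid (grid_size U r). u (closest_point (closure U) (grid_point r z)) $ i *\<^sub>R grid_bump' r z x)"
    by (intro C1_scalar_sum C1_scalar_cmult C1_grid_bump)
  then show "C1_scalar S (\<lambda>x. spline_approx U u r x $ i) (\<lambda>x. spline_approx' U u r x $ i)"
    unfolding spline_approx_def spline_approx'_def by (simp add: mult.commute)
qed

locale holder_data =
  fixes U :: "(real ^ 'n) set" and u :: "real ^ 'n \<Rightarrow> real ^ 'n" and M \<alpha> R :: real
  assumes U: "open U" "bounded U" "U \<noteq> {}" and M: "M > 0" and \<alpha>: "0 < \<alpha>" "\<alpha> \<le> 1"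
    and holder: "\<And>x y. x \<in> closure U \<Longrightarrow> y \<in> closure U \<Longrightarrow> norm (u x - u y) \<le> M * dist x y powr \<alpha>"
    and R: "R > 0" "\<And>x. \<not> cube_in U x R"
begin

definition osc :: "real \<Rightarrow> real" where "osc s = M * (2 * real CARD('n) * s) powr \<alpha>"

lemma osc_pos: "s > 0 \<Longrightarrow> osc s > 0"
  unfolding osc_def using M real_card_ge_1[where 'n='n] by simp

lemma osc_double: "s > 0 \<Longrightarrow> osc (2 * s) \<le> 2 * osc s"
proof -
  assume s: "s > 0"
  have "2 powr \<alpha> \<le> 2 powr 1" using \<alpha> by (intro powr_mono) auto
  then have "2 powr \<alpha> * (2 * real CARD('n) * s) powr \<alpha> \<le> 2 * (2 * real CARD('n) * s) powr \<alpha>" by (intro mult_right_mono) auto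
  then have "(2 * real CARD('n) * (2 * s)) powr \<alpha> \<le> 2 * (2 * real CARD('n) * s) powr \<alpha>"
    using s by (simp add: powr_mult[symmetric] ac_simps)
  then show ?thesis unfolding osc_def using M by (simp add: mult_left_mono algebra_simps)
qed

lemma osc_mono: "0 \<le> s \<Longrightarrow> s \<le> t \<Longrightarrow> osc s \<le> osc t"
  unfolding osc_def using M \<alpha> real_card_ge_1[where 'n='n] by (intro mult_left_mono powr_mono2) auto

lemma closest_grid_value:
  assumes "r > 0" "x \<in> closure U" "grid_bump r z x \<noteq> 0 \<or> grid_bump' r z x \<noteq> 0"
  shows "norm (u (closest_point (closure U) (grid_point r z)) - u x) \<le> osc r"
proof -
  let ?z = "grid_point r z" and ?p = "closest_point (closure U) (grid_point r z)"
  have cl: "closed (closure U)" "closure U \<noteq> {}" using U by auto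
  have p: "?p \<in> closure U" using closest_point_in_set[OF cl] .
  have zx: "dist ?z x \<le> real CARD('n) * r"
  proof -
    have "norm (x - ?z) \<le> (\<Sum>i\<in>UNIV. \<bar>(x - ?z) $ i\<bar>)" by (rule norm_le_l1_cart)
    also have "\<dots> \<le> (\<Sum>i\<in>(UNIV :: 'n set). r)"
      using grid_bump_support[OF assms(1,3)] by (intro sum_mono) (simp add: less_imp_le)
    finally show ?thesis by (simp add: dist_norm norm_minus_commute)
  qed
  have "dist ?z ?p \<le> dist ?z x" by (rule closest_point_le[OF cl(1) assms(2)])
  then have "dist ?p x \<le> 2 * real CARD('n) * r" using zx dist_triangle[of ?p x ?z] by (simp add: dist_commute)
  then have "dist ?p x powr \<alpha> \<le> (2 * real CARD('n) * r) powr \<alpha>" using \<alpha> by (intro powr_mono2) auto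
  then have "M * dist ?p x powr \<alpha> \<le> osc r" unfolding osc_def using M by simp
  then show ?thesis using holder[OF p assms(2)] by linarith
qed

lemma spline_approx_error:
  assumes "r > 0" "x \<in> closure U"
  shows "norm (spline_approx U u r x - u x) \<le> osc r"
proof -
  note size = grid_size[OF U(2) assms(1) assms(2)]
  note part = grid_bump_partition[OF size assms(1)]
  have "spline_approx U u r x - u x
     = (\<Sum>z\<in>grid (grid_size U r). grid_bump r z x *\<^sub>R (u (closest_point (closure U) (grid_point r z)) - u x))"
    unfolding spline_approx_def
    using part by (simp add: scaleR_diff_right sum_subtractf scaleR_sum_left[symmetric])
  also have "norm \<dots> \<le> (\<Sum>z\<in>grid (grid_size U r). norm (grid_bump r z x *\<^sub>R (u (closest_point (closure U) (grid_point r z)) - u x)))"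
    by (rule norm_sum)
  also have "\<dots> \<le> (\<Sum>z\<in>grid (grid_size U r). grid_bump r z x * osc r)"
  proof (rule sum_mono)
    fix z
    show "norm (grid_bump r z x *\<^sub>R (u (closest_point (closure U) (grid_point r z)) - u x)) \<le> grid_bump r z x * osc r"
      using closest_grid_value[OF assms, of z] grid_bump_nonneg[of r z x]
      by (cases "grid_bump r z x = 0") (auto intro: mult_left_mono)
  qed
  also have "\<dots> = osc r" using part by (simp add: sum_distrib_right[symmetric])
  finally show ?thesis .
qed

lemma spline_approx'_bound:
  assumes "r > 0" "x \<in> closure U"
  shows "\<bar>spline_approx' U u r x $ i $ j\<bar> \<le> 6 * osc r / r"
proof -
  note size = grid_size[OF U(2) assms(1) assms(2)]
  define c where "c z = u (closest_point (closure U) (grid_point r z)) - u x" for z :: "'n \<Rightarrow> int"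
  have p0: "(\<Sum>z\<in>grid (grid_size U r). grid_bump' r z x $ j) = 0"
    using grid_bump'_partition[OF size assms(1)] by (metis sum_component zero_index)
  have "spline_approx' U u r x $ i $ j = (\<Sum>z\<in>grid (grid_size U r). (c z $ i + u x $ i) * grid_bump' r z x $ j)"
    unfolding spline_approx'_def c_def by simp
  also have "\<dots> = (\<Sum>z\<in>grid (grid_size U r). c z $ i * grid_bump' r z x $ j)"
    using p0 by (simp add: distrib_right sum.distrib sum_distrib_left[symmetric])
  also have "\<bar>\<dots>\<bar> \<le> (\<Sum>z\<in>grid (grid_size U r). \<bar>c z $ i * grid_bump' r z x $ j\<bar>)" by (rule sum_abs)
  also have "\<dots> \<le> (\<Sum>z\<in>grid (grid_size U r). osc r * \<bar>grid_bump' r z x $ j\<bar>)"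
  proof (rule sum_mono)
    fix z
    have "\<bar>c z $ i\<bar> \<le> osc r" if "grid_bump' r z x \<noteq> 0"
      using closest_grid_value[OF assms, of z] that component_le_norm_cart[of "c z" i] unfolding c_def by linarith
    then show "\<bar>c z $ i * grid_bump' r z x $ j\<bar> \<le> osc r * \<bar>grid_bump' r z x $ j\<bar>"
      by (cases "grid_bump' r z x = 0") (auto simp: abs_mult intro: mult_right_mono)
  qed
  also have "\<dots> = osc r * (\<Sum>z\<in>grid (grid_size U r). \<bar>grid_bump' r z x $ j\<bar>)" by (simp add: sum_distrib_left)
  also have "\<dots> \<le> osc r * (6 / r)"
    by (intro mult_left_mono grid_bump'_abs_sum[OF size assms(1)]) (simp add: less_imp_le[OF osc_pos] assms(1))
  finally show ?thesis by (simp add: ac_simps)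
qed

definition rad :: "nat \<Rightarrow> real" where "rad k = R / 2 ^ k"

lemma rad_pos: "rad k > 0" unfolding rad_def using R by simp
lemma rad_Suc: "rad k = 2 * rad (Suc k)" unfolding rad_def by simp
lemma rad_antimono: "j \<le> k \<Longrightarrow> rad k \<le> rad j"
  unfolding rad_def using R by (intro divide_left_mono power_increasing) auto

fun W :: "nat \<Rightarrow> real ^ 'n \<Rightarrow> real ^ 'n" where
  "W 0 x = spline_approx U u (rad 0) x"
| "W (Suc k) x = W k x + (1 - cutoff U (rad (Suc k)) x) *\<^sub>R (spline_approx U u (rad (Suc k)) x - spline_approx U u (rad k) x)"

fun W' :: "nat \<Rightarrow> real ^ 'n \<Rightarrow> real ^ 'n ^ 'n" where
  "W' 0 x = spline_approx' U u (rad 0) x"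
| "W' (Suc k) x = W' k x + (\<chi> i. (1 - cutoff U (rad (Suc k)) x) *\<^sub>R (spline_approx' U u (rad (Suc k)) x $ i - spline_approx' U u (rad k) x $ i)
     - (spline_approx U u (rad (Suc k)) x $ i - spline_approx U u (rad k) x $ i) *\<^sub>R cutoff' U (rad (Suc k)) x)"

lemma C1_W: "C1_map S (W k) (W' k)"
proof (induction k)
  case 0
  have "W 0 = spline_approx U u (rad 0)" "W' 0 = spline_approx' U u (rad 0)" by (auto simp: fun_eq_iff)
  then show ?case by (simp only: C1_spline_approx)
next
  case (Suc k)
  show ?case unfolding C1_map_def
  proof
    fix i
    have s: "C1_scalar S (\<lambda>x. spline_approx U u r x $ i) (\<lambda>x. spline_approx' U u r x $ i)" for r
      using C1_spline_approx unfolding C1_map_def by blast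
    have w: "C1_scalar S (\<lambda>x. W k x $ i) (\<lambda>x. W' k x $ i)" using Suc unfolding C1_map_def by blast
    from C1_scalar_add[OF w C1_scalar_mult[OF C1_scalar_diff[OF C1_scalar_const[of S 1] C1_cutoff[of S U "rad (Suc k)"]] C1_scalar_diff[OF s[of "rad (Suc k)"] s[of "rad k"]]]]
    show "C1_scalar S (\<lambda>x. W (Suc k) x $ i) (\<lambda>x. W' (Suc k) x $ i)" by (simp add: algebra_simps)
  qed
qed

lemma W_stable:
  assumes "cube_in U x (5 * rad (Suc k))" "k \<le> K"
  shows "W K x = W k x" "W' K x = W' k x"
proof -
  have "W (k + m) x = W k x \<and> W' (k + m) x = W' k x" for m
  proof (induction m)
    case (Suc m)
    have "rad (Suc (k + m)) \<le> rad (Suc k)" by (rule rad_antimono) simp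
    then have "cube_in U x (5 * rad (Suc (k + m)))" using cube_in_mono[OF assms(1)] by simp
    from cutoff_inside[OF U(2) rad_pos this] Suc show ?case by (simp add: vec_eq_iff)
  qed simp
  from this[of "K - k"] show "W K x = W k x" "W' K x = W' k x" using assms(2) by auto
qed

lemma W_outer:
  assumes "\<not> cube_in U x (3 * rad k)"
  shows "W k x = spline_approx U u (rad k) x" "W' k x = spline_approx' U u (rad k) x"
proof -
  have "m \<le> k \<Longrightarrow> W m x = spline_approx U u (rad m) x \<and> W' m x = spline_approx' U u (rad m) x" for m
  proof (induction m)
    case (Suc m)
    have "\<not> cube_in U x (3 * rad (Suc m))"
    proof
      assume "cube_in U x (3 * rad (Suc m))"
      then have "cube_in U x (3 * rad k)" by (rule cube_in_mono) (use rad_antimono[OF Suc.prems] in simp)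
      then show False using assms by blast
    qed
    then have "cutoff U (rad (Suc m)) x = 0" "cutoff' U (rad (Suc m)) x = 0"
      using cutoff_support[OF rad_pos] by blast+
    then show ?case using Suc by (simp add: vec_eq_iff)
  qed simp
  then show "W k x = spline_approx U u (rad k) x" "W' k x = spline_approx' U u (rad k) x" by auto
qed

lemma W_layer:
  assumes x: "x \<in> closure U" "\<not> cube_in U x (5 * rad k)"
  shows "norm (W k x - u x) \<le> 5 * osc (rad k)" "\<bar>W' k x $ i $ j\<bar> \<le> 36 * osc (rad k) / rad k"
proof -
  have "norm (W k x - u x) \<le> 5 * osc (rad k) \<and> \<bar>W' k x $ i $ j\<bar> \<le> 36 * osc (rad k) / rad k"
  proof (cases k)
    case 0
    have "norm (W 0 x - u x) \<le> osc (rad 0)" using spline_approx_error[OF rad_pos x(1)] by simp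
    moreover have "\<bar>W' 0 x $ i $ j\<bar> \<le> 6 * osc (rad 0) / rad 0" using spline_approx'_bound[OF rad_pos x(1)] by simp
    moreover have "6 * osc (rad 0) / rad 0 \<le> 36 * osc (rad 0) / rad 0"
      using osc_pos[OF rad_pos] rad_pos by (intro divide_right_mono mult_right_mono) (auto simp: less_imp_le)
    ultimately show ?thesis using osc_pos[OF rad_pos, of 0] unfolding 0 by simp
  next
    case (Suc m)
    let ?o = "osc (rad k)" and ?r = "rad k"
    let ?v1 = "spline_approx U u (rad k) x" and ?v0 = "spline_approx U u (rad m) x"
    let ?d1 = "spline_approx' U u (rad k) x" and ?d0 = "spline_approx' U u (rad m) x"
    have r: "?r > 0" "rad m = 2 * ?r" using rad_pos rad_Suc[of m] Suc by auto
    have o: "?o > 0" using osc_pos r by auto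
    have om: "osc (rad m) \<le> 2 * ?o" using osc_double[OF r(1)] r(2) by simp
    have "\<not> cube_in U x (3 * rad m)" using x(2) cube_in_mono[of U x "3 * rad m" "5 * ?r"] r by auto
    note W_m = W_outer[OF this]
    define ct where "ct = cutoff U (rad k) x"
    have chi: "0 \<le> 1 - ct" "1 - ct \<le> 1" unfolding ct_def using cutoff_nonneg[of U "rad k" x] cutoff_le_1[OF U(2) r(1), of x] by auto
    have v1: "norm (?v1 - u x) \<le> ?o" by (rule spline_approx_error[OF r(1) x(1)])
    have v0: "norm (?v0 - u x) \<le> 2 * ?o" using spline_approx_error[OF rad_pos x(1), of m] om by linarith
    have dv: "norm (?v1 - ?v0) \<le> 3 * ?o"
      using norm_triangle_ineq4[of "?v1 - u x" "?v0 - u x"] v1 v0 by simp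
    have Wk: "W k x = ?v0 + (1 - ct) *\<^sub>R (?v1 - ?v0)" unfolding Suc ct_def using W_m by simp
    have "norm (W k x - u x) \<le> norm (?v0 - u x) + norm ((1 - ct) *\<^sub>R (?v1 - ?v0))"
      using norm_triangle_ineq[of "?v0 - u x" "(1 - ct) *\<^sub>R (?v1 - ?v0)"] unfolding Wk by (simp add: algebra_simps)
    also have "norm ((1 - ct) *\<^sub>R (?v1 - ?v0)) \<le> 1 * norm (?v1 - ?v0)"
      unfolding norm_scaleR using chi by (intro mult_right_mono) auto
    finally have 1: "norm (W k x - u x) \<le> 5 * ?o" using v0 dv by simp
    have d1: "\<bar>?d1 $ i $ j\<bar> \<le> 6 * ?o / ?r" by (rule spline_approx'_bound[OF r(1) x(1)])
    have d0: "\<bar>?d0 $ i $ j\<bar> \<le> 6 * ?o / ?r"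
    proof -
      have "\<bar>?d0 $ i $ j\<bar> \<le> 6 * osc (rad m) / rad m" by (rule spline_approx'_bound[OF rad_pos x(1)])
      also have "\<dots> \<le> 6 * (2 * ?o) / (2 * ?r)" unfolding r(2)[symmetric]
        using om rad_pos[of m] by (intro divide_right_mono) auto
      finally show ?thesis using r by simp
    qed
    have ch: "\<bar>cutoff' U (rad k) x $ j\<bar> \<le> 6 / ?r" by (rule cutoff'_bound[OF U(2) r(1)])
    have W'k: "W' k x $ i $ j = ?d0 $ i $ j + (1 - ct) * (?d1 $ i $ j - ?d0 $ i $ j) - (?v1 - ?v0) $ i * cutoff' U (rad k) x $ j"
      unfolding Suc ct_def using W_m by simp
    have a: "\<bar>(1 - ct) * (?d1 $ i $ j - ?d0 $ i $ j)\<bar> \<le> 1 * (6 * ?o / ?r + 6 * ?o / ?r)"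
      unfolding abs_mult using chi d1 d0 by (intro mult_mono) auto
    have b: "\<bar>(?v1 - ?v0) $ i * cutoff' U (rad k) x $ j\<bar> \<le> (3 * ?o) * (6 / ?r)"
      unfolding abs_mult using dv component_le_norm_cart[of "?v1 - ?v0" i] ch o by (intro mult_mono) auto
    have "\<bar>W' k x $ i $ j\<bar> \<le> 6 * ?o / ?r + (6 * ?o / ?r + 6 * ?o / ?r) + (3 * ?o) * (6 / ?r)"
    proof -
      have "\<bar>p + q - s\<bar> \<le> \<bar>p\<bar> + \<bar>q\<bar> + \<bar>s\<bar>" for p q s :: real by linarith
      then show ?thesis unfolding W'k by (rule order_trans) (intro add_mono d0 a[unfolded mult_1] b)
    qed
    also have "\<dots> = 36 * ?o / ?r" by (simp add: add_divide_distrib[symmetric])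
    finally show ?thesis using 1 by simp
  qed
  then show "norm (W k x - u x) \<le> 5 * osc (rad k)" "\<bar>W' k x $ i $ j\<bar> \<le> 36 * osc (rad k) / rad k" by auto
qed

lemma W'_shell:
  assumes x: "x \<in> closure U" "\<not> cube_in U x (5 * rad k)" "cube_in U x (3 * rad (Suc k))" and K: "k < K"
  shows "\<bar>W' K x $ i $ j\<bar> \<le> 72 * osc (rad k) / rad k"
proof -
  have r: "rad (Suc k) = rad k / 2" "rad k > 0" "rad (Suc k) > 0" using rad_Suc[of k] rad_pos by auto
  have o: "osc (rad k) > 0" using osc_pos r by auto
  have "5 * rad (Suc (Suc k)) \<le> 3 * rad (Suc k)" using rad_Suc[of "Suc k"] rad_pos[of "Suc (Suc k)"] by simp
  from cube_in_mono[OF x(3) this] have "W' K x = W' (Suc k) x" using K by (intro W_stable) auto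
  moreover have "\<bar>W' (Suc k) x $ i $ j\<bar> \<le> 72 * osc (rad k) / rad k"
  proof (cases "cube_in U x (5 * rad (Suc k))")
    case True
    then have "W' (Suc k) x = W' k x" by (intro W_stable) auto
    then have "\<bar>W' (Suc k) x $ i $ j\<bar> \<le> 36 * osc (rad k) / rad k" using W_layer(2)[OF x(1,2)] by simp
    also have "\<dots> \<le> 72 * osc (rad k) / rad k" using o r by (intro divide_right_mono mult_right_mono) auto
    finally show ?thesis .
  next
    case False
    have om: "osc (rad (Suc k)) \<le> osc (rad k)"
      by (rule osc_mono) (use rad_antimono[of k "Suc k"] less_imp_le[OF rad_pos] in auto)
    have "\<bar>W' (Suc k) x $ i $ j\<bar> \<le> 36 * osc (rad (Suc k)) / rad (Suc k)" by (rule W_layer(2)[OF x(1) False])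
    also have "\<dots> \<le> 36 * osc (rad k) / rad (Suc k)"
      using om rad_pos[of "Suc k"] by (intro divide_right_mono mult_left_mono) auto
    also have "36 * osc (rad k) / rad (Suc k) = 72 * osc (rad k) / rad k" unfolding r(1) by simp
    finally show ?thesis .
  qed
  ultimately show ?thesis by (simp del: W'.simps)
qed

definition shell :: "nat \<Rightarrow> real ^ 'n \<Rightarrow> real" where
  "shell k x = cutoff U (rad (Suc k)) x - cutoff U (rad k) x"
definition shell' :: "nat \<Rightarrow> real ^ 'n \<Rightarrow> real ^ 'n" where
  "shell' k x = cutoff' U (rad (Suc k)) x - cutoff' U (rad k) x"

lemma C1_shell: "C1_scalar S (shell k) (shell' k)"
  unfolding shell_def[abs_def] shell'_def[abs_def] by (intro C1_scalar_diff C1_cutoff)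

lemma shell_support:
  assumes "shell k x \<noteq> 0 \<or> shell' k x \<noteq> 0"
  shows "x \<in> U" "\<not> cube_in U x (5 * rad k)" "cube_in U x (3 * rad (Suc k))"
proof -
  have r: "rad k = 2 * rad (Suc k)" "rad (Suc k) > 0" using rad_Suc[of k] rad_pos by auto
  show "\<not> cube_in U x (5 * rad k)"
  proof
    assume c: "cube_in U x (5 * rad k)"
    have "cube_in U x (5 * rad (Suc k))" by (rule cube_in_mono[OF c]) (use r in simp)
    then show False using assms cutoff_inside[OF U(2) rad_pos c] cutoff_inside[OF U(2) rad_pos[of "Suc k"], of x]
      unfolding shell_def shell'_def by simp
  qed
  show c: "cube_in U x (3 * rad (Suc k))"
  proof (rule ccontr)
    assume ns: "\<not> cube_in U x (3 * rad (Suc k))"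
    then have "\<not> cube_in U x (3 * rad k)" using cube_in_mono[of U x "3 * rad k" "3 * rad (Suc k)"] r by auto
    then show False using assms ns cutoff_support[OF rad_pos, of U _ x] unfolding shell_def shell'_def by (metis diff_self)
  qed
  show "x \<in> U" using cube_in_mem[OF c] r by simp
qed

lemma shell_bounds: "\<bar>shell k x\<bar> \<le> 1" "\<bar>shell' k x $ j\<bar> \<le> 18 / rad k"
proof -
  show "\<bar>shell k x\<bar> \<le> 1" unfolding shell_def
    using cutoff_nonneg[of U "rad k" x] cutoff_nonneg[of U "rad (Suc k)" x] cutoff_le_1[OF U(2) rad_pos[of k], of x] cutoff_le_1[OF U(2) rad_pos[of "Suc k"], of x]
    by linarith
  have "\<bar>cutoff' U (rad (Suc k)) x $ j\<bar> \<le> 12 / rad k" "\<bar>cutoff' U (rad k) x $ j\<bar> \<le> 6 / rad k"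
    using cutoff'_bound[OF U(2) rad_pos[of "Suc k"], of x j] cutoff'_bound[OF U(2) rad_pos[of k], of x j] rad_Suc[of k] by auto
  then have "\<bar>shell' k x $ j\<bar> \<le> 12 / rad k + 6 / rad k" unfolding shell'_def by simp
  then show "\<bar>shell' k x $ j\<bar> \<le> 18 / rad k" by (simp add: add_divide_distrib[symmetric])
qed

lemma shell_sum: "cutoff U (rad K) x = (\<Sum>k<K. shell k x)"
proof -
  have "cutoff U (rad 0) x = 0"
  proof (rule ccontr)
    assume "\<not> ?thesis"
    then have "cube_in U x (3 * R)" using cutoff_support[OF rad_pos, of U 0 x] by (simp add: rad_def)
    then show False using cube_in_mono[of U x "3 * R" R] R by auto
  qed
  then show ?thesis unfolding shell_def using sum_lessThan_telescope[of "\<lambda>k. cutoff U (rad k) x" K] by simp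
qed

end

lemma prod_if_eq: "(\<Prod>i\<in>UNIV. if i = (j :: 'n::finite) then a else b) = a * (b :: real) ^ (CARD('n) - 1)"
proof -
  have "(\<Prod>i\<in>UNIV. if i = j then a else b) = (if j = j then a else b) * (\<Prod>i\<in>UNIV-{j}. if i = j then a else b)"
    by (rule prod.remove) auto
  also have "(\<Prod>i\<in>UNIV-{j}. if i = j then a else b) = (\<Prod>i\<in>UNIV-{j}. b)" by (rule prod.cong) auto
  finally show ?thesis by (simp add: card_Diff_singleton)
qed

lemma holder_uniformly_continuous:
  assumes "\<alpha> > 0" "M > 0" "\<And>x y. x \<in> S \<Longrightarrow> y \<in> S \<Longrightarrow> norm (u x - u y) \<le> M * dist x y powr \<alpha>"
  shows "uniformly_continuous_on S u"
  unfolding uniformly_continuous_on_def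
proof (intro allI impI)
  fix e :: real assume e: "e > 0"
  define d where "d = (e / M) powr (1 / \<alpha>)"
  have d: "d > 0" unfolding d_def using e assms by simp
  have "dist (u y) (u x) < e" if "x \<in> S" "y \<in> S" "dist y x < d" for x y
  proof -
    have "dist y x powr \<alpha> < d powr \<alpha>" using that assms(1) by (intro powr_less_mono2) auto
    also have "\<dots> = e / M" unfolding d_def using e assms by (simp add: powr_powr)
    finally have "M * dist y x powr \<alpha> < e" using assms(2) by (simp add: field_simps)
    then show ?thesis using assms(3)[OF that(2,1)] by (simp add: dist_norm)
  qed
  then show "\<exists>d>0. \<forall>x\<in>S. \<forall>x'\<in>S. dist x' x < d \<longrightarrow> dist (u x') (u x) < e" using d by blast
qed

definition shell_const :: "'n::finite itself \<Rightarrow> real \<Rightarrow> real" where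
  "shell_const _ q = 2 * (fact CARD('n) * 792 ^ CARD('n)
     + real CARD('n) * (fact CARD('n) * (18 * 72 ^ (CARD('n) - 1) * 11 ^ CARD('n))) / (1 - real CARD('n) / q))"

lemma shell_const_nonneg: "q > real CARD('n) \<Longrightarrow> shell_const TYPE('n::finite) q \<ge> 0"
  unfolding shell_const_def by (auto intro!: add_nonneg_nonneg mult_nonneg_nonneg divide_nonneg_nonneg)

context holder_data
begin

lemma cont_u: "continuous_on (closure U) u"
  by (intro uniformly_continuous_imp_continuous holder_uniformly_continuous[OF \<alpha>(1) M holder])

lemma shell_estimate:
  assumes phi: "C1_scalar UNIV \<phi> \<phi>'" and q: "q > real CARD('n)" and N: "N > 0"
    and I: "(\<integral>\<^sup>+y. ennreal (\<bar>\<phi> y\<bar> powr q) \<partial>lborel) \<le> ennreal (N powr q)" and K: "k < K"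
  shows "\<bar>\<integral>x. shell k x * (\<phi> (W K x) * det (W' K x)) \<partial>lborel\<bar>
    \<le> N * shell_const TYPE('n) q * (real (covering_number (rad k) (frontier U)) * osc (rad k) powr (real CARD('n) - real CARD('n) / q))"
proof -
  let ?r = "rad k" and ?o = "osc (rad k)" and ?n = "CARD('n)"
  define c where "c = real (covering_number ?r (frontier U))"
  have r: "?r > 0" and o: "?o > 0" using rad_pos osc_pos by auto
  have c: "c \<ge> 0" unfolding c_def by simp
  obtain m where m: "?n = Suc m" using not0_implies_Suc[of ?n] by auto
  define b where "b = 72 * ?o / ?r"
  have b: "b > 0" unfolding b_def using o r by simp
  obtain H where H: "H \<in> sets borel" "{x \<in> U. \<not> cube_in U x (5 * ?r)} \<subseteq> H" "emeasure lborel H \<le> ennreal (c * (11 * ?r) ^ ?n)"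
    using boundary_layer_cover[OF U(2) r] unfolding c_def by blast
  have sup: "x \<in> H" "\<bar>W' K x $ i $ j\<bar> \<le> b" if "shell k x \<noteq> 0 \<or> shell' k x \<noteq> 0" for x i j
    using shell_support[OF that] H(2) W'_shell[of x k K i j] closure_subset[of U] K unfolding b_def by auto
  define A0 where "A0 = (fact ?n * b ^ ?n) * (c * (11 * ?r) ^ ?n)"
  define A1 where "A1 = (real ?n * (fact ?n * (18 / ?r * b ^ (?n - 1)))) * (c * (11 * ?r) ^ ?n)"
  have A0: "A0 \<ge> 0" "A1 \<ge> 0" unfolding A0_def A1_def using b c r by auto
  have int: "(\<integral>\<^sup>+x. ennreal (f x) \<partial>lborel) \<le> ennreal (B * (c * (11 * ?r) ^ ?n))"
    if "B \<ge> 0" "\<And>x. x \<in> H \<Longrightarrow> f x \<le> B" "\<And>x. x \<notin> H \<Longrightarrow> f x = 0" for f B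
  proof -
    have "(\<integral>\<^sup>+x. ennreal (f x) \<partial>lborel) \<le> (\<integral>\<^sup>+x. ennreal B * indicator H x \<partial>lborel)"
    proof (rule nn_integral_mono)
      fix x show "ennreal (f x) \<le> ennreal B * indicator H x"
        using that by (cases "x \<in> H") (auto intro: ennreal_leI)
    qed
    also have "\<dots> = ennreal B * emeasure lborel H" using H(1) by (simp add: nn_integral_cmult_indicator)
    also have "\<dots> \<le> ennreal B * ennreal (c * (11 * ?r) ^ ?n)" by (intro mult_left_mono H(3)) auto
    also have "\<dots> = ennreal (B * (c * (11 * ?r) ^ ?n))" using that(1) c r by (simp add: ennreal_mult)
    finally show ?thesis .
  qed
  have bd0: "(\<integral>\<^sup>+x. ennreal \<bar>shell k x * det (W' K x)\<bar> \<partial>lborel) \<le> ennreal A0"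
    unfolding A0_def
  proof (rule int)
    show "0 \<le> fact ?n * b ^ ?n" using b by simp
    show "\<bar>shell k x * det (W' K x)\<bar> \<le> fact ?n * b ^ ?n" for x
    proof (cases "shell k x = 0")
      case False
      have "\<bar>det (W' K x)\<bar> \<le> fact ?n * (\<Prod>i\<in>(UNIV :: 'n set). b)"
        by (rule det_bound) (use sup(2) False in blast)
      then have "\<bar>shell k x\<bar> * \<bar>det (W' K x)\<bar> \<le> 1 * (fact ?n * b ^ ?n)"
        using shell_bounds(1)[of k x] by (intro mult_mono) auto
      then show ?thesis by (simp add: abs_mult)
    qed (use b in simp)
    show "\<bar>shell k x * det (W' K x)\<bar> = 0" if "x \<notin> H" for x using sup(1)[of x] that by auto
  qed
  have bd1: "(\<integral>\<^sup>+x. ennreal (\<Sum>j\<in>UNIV. \<bar>det (row_upd (W' K x) j (shell' k x))\<bar>) \<partial>lborel) \<le> ennreal A1"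
    unfolding A1_def
  proof (rule int)
    show "0 \<le> real ?n * (fact ?n * (18 / ?r * b ^ (?n - 1)))" using b r by simp
    show "(\<Sum>j\<in>UNIV. \<bar>det (row_upd (W' K x) j (shell' k x))\<bar>) \<le> real ?n * (fact ?n * (18 / ?r * b ^ (?n - 1)))" for x
    proof (cases "shell' k x = 0")
      case False
      have "\<bar>det (row_upd (W' K x) j (shell' k x))\<bar> \<le> fact ?n * (18 / ?r * b ^ (?n - 1))" for j
      proof -
        have "\<bar>det (row_upd (W' K x) j (shell' k x))\<bar> \<le> fact ?n * (\<Prod>i\<in>UNIV. if i = j then 18 / ?r else b)"
          by (rule det_bound) (use sup(2)[of x] False shell_bounds(2) in \<open>auto simp: row_upd_def\<close>)
        then show ?thesis by (simp only: prod_if_eq)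
      qed
      then have "(\<Sum>j\<in>UNIV. \<bar>det (row_upd (W' K x) j (shell' k x))\<bar>) \<le> (\<Sum>j\<in>(UNIV :: 'n set). fact ?n * (18 / ?r * b ^ (?n - 1)))"
        by (intro sum_mono) auto
      then show ?thesis by simp
    qed (use b r in \<open>simp add: det_row_upd_0\<close>)
    show "(\<Sum>j\<in>UNIV. \<bar>det (row_upd (W' K x) j (shell' k x))\<bar>) = 0" if "x \<notin> H" for x
    proof -
      have "shell' k x = 0" using sup(1)[of x] that by auto
      then show ?thesis by (simp add: det_row_upd_0)
    qed
  qed
  have "compact (closure U)" using U(2) by simp
  moreover have "shell k x = 0" if "x \<notin> closure U" for x
    using shell_support(1)[of k x] closure_subset[of U] that by auto
  ultimately have "\<bar>\<integral>x. shell k x * (\<phi> (W K x) * det (W' K x)) \<partial>lborel\<bar>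
    \<le> 2 * N * (A0 * ?o powr (- real ?n / q) + A1 * (?o powr (1 - real ?n / q) / (1 - real ?n / q)))"
    using localized_degree_estimate[OF C1_W phi C1_shell _ _ q o N I bd0 A0(1) bd1 A0(2)] by blast
  also have "\<dots> = N * shell_const TYPE('n) q * (c * ?o powr (real ?n - real ?n / q))"
  proof -
    have A0': "A0 = fact ?n * 792 ^ ?n * c * ?o ^ ?n"
    proof -
      have "b * (11 * ?r) = 792 * ?o" unfolding b_def using r by simp
      then have "b ^ ?n * (11 * ?r) ^ ?n = 792 ^ ?n * ?o ^ ?n" by (simp only: power_mult_distrib[symmetric])
      then show ?thesis unfolding A0_def by (simp add: ac_simps)
    qed
    have A1': "A1 = real ?n * (fact ?n * (18 * 72 ^ (?n - 1) * 11 ^ ?n)) * c * ?o ^ m"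
    proof -
      have "18 / ?r * b ^ m * (11 * ?r) ^ Suc m = 18 * 72 ^ m * 11 ^ Suc m * ?o ^ m"
        unfolding b_def using r by (simp add: power_divide power_mult_distrib field_simps)
      then have key: "18 / ?r * b ^ (?n - 1) * (11 * ?r) ^ ?n = 18 * 72 ^ (?n - 1) * 11 ^ ?n * ?o ^ m"
        unfolding m diff_Suc_1 .
      have "A1 = real ?n * fact ?n * c * (18 / ?r * b ^ (?n - 1) * (11 * ?r) ^ ?n)"
        unfolding A1_def by (simp only: ac_simps)
      then show ?thesis unfolding key by (simp only: ac_simps)
    qed
    have p0: "?o ^ ?n * ?o powr (- real ?n / q) = ?o powr (real ?n - real ?n / q)"
      using o by (simp add: powr_realpow[symmetric] powr_add[symmetric])
    have p1: "?o ^ m * ?o powr (1 - real ?n / q) = ?o powr (real ?n - real ?n / q)"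
    proof -
      have "real ?n = real m + 1" using m by simp
      then show ?thesis using o by (simp add: powr_realpow[symmetric] powr_add[symmetric] algebra_simps)
    qed
    have "A0 * ?o powr (- real ?n / q) = fact ?n * 792 ^ ?n * c * ?o powr (real ?n - real ?n / q)"
      unfolding A0' p0[symmetric] by (simp only: mult.assoc)
    moreover have "A1 * (?o powr (1 - real ?n / q) / (1 - real ?n / q))
      = real ?n * (fact ?n * (18 * 72 ^ (?n - 1) * 11 ^ ?n)) / (1 - real ?n / q) * c * ?o powr (real ?n - real ?n / q)"
      unfolding A1' p1[symmetric] by (simp add: mult.assoc)
    ultimately show ?thesis unfolding shell_const_def by (simp only:) (simp add: distrib_left distrib_right ac_simps)
  qed
  finally show ?thesis unfolding c_def .
qed

lemma ex_small_osc: assumes "e > 0" obtains k where "osc (rad k) \<le> e"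
proof -
  define s where "s = (e / M) powr (1 / \<alpha>) / (2 * real CARD('n))"
  have s: "s > 0" unfolding s_def using assms M by simp
  obtain k where "R / s < 2 ^ k" using real_arch_pow[of 2 "R / s"] by auto
  then have "rad k \<le> s" unfolding rad_def using s by (simp add: field_simps)
  then have "osc (rad k) \<le> osc s" by (intro osc_mono) (auto simp: less_imp_le[OF rad_pos])
  also have "osc s = M * ((e / M) powr (1 / \<alpha>)) powr \<alpha>" unfolding osc_def s_def by simp
  also have "\<dots> = e" using assms M \<alpha> by (simp add: powr_powr)
  finally show ?thesis using that by blast
qed

lemma degree_pairing:
  assumes S: "compact S" "S \<inter> u ` frontier U = {}" and phi: "C1_scalar UNIV \<phi> \<phi>'" "\<And>y. y \<notin> S \<Longrightarrow> \<phi> y = 0"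
    and q: "q > real CARD('n)" and N: "N > 0"
    and I: "(\<integral>\<^sup>+y. ennreal (\<bar>\<phi> y\<bar> powr q) \<partial>lborel) \<le> ennreal (N powr q)"
    and Z: "\<And>K. (\<Sum>k<K. real (covering_number (rad k) (frontier U)) * osc (rad k) powr (real CARD('n) - real CARD('n) / q)) \<le> Z"
  shows "\<bar>\<integral>y. \<phi> y * brouwer_degree u U y \<partial>lborel\<bar> \<le> N * shell_const TYPE('n) q * Z"
proof -
  interpret degree_data U u using U cont_u by unfold_locales
  obtain \<delta> where d: "\<delta> > 0" "\<And>x y. x \<in> frontier U \<Longrightarrow> y \<in> S \<Longrightarrow> \<delta> < norm (u x - y)"
    "\<And>w B \<phi> \<phi>'. C1_degree_data U w B \<Longrightarrow> (\<And>x. x \<in> frontier U \<Longrightarrow> norm (w x - u x) \<le> \<delta>) \<Longrightarrow>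
      C1_scalar UNIV \<phi> \<phi>' \<Longrightarrow> (\<And>y. y \<notin> S \<Longrightarrow> \<phi> y = 0) \<Longrightarrow>
      (LINT x:U|lborel. \<phi> (w x) * det (B x)) = (\<integral>y. \<phi> y * brouwer_degree u U y \<partial>lborel)"
    using brouwer_degree_integral[OF S] by blast
  obtain K where "osc (rad K) \<le> \<delta> / 9" using ex_small_osc[of "\<delta> / 9"] d(1) by auto
  then have K: "9 * osc (rad K) \<le> \<delta>" by simp
  have o: "osc (rad K) > 0" using osc_pos rad_pos by blast
  have data: "C1_degree_data U (W K) (W' K)"
    using U C1_W C1_map_continuous_on(1)[OF C1_W] by unfold_locales
  have bdry: "norm (W K x - u x) \<le> \<delta>" if x: "x \<in> frontier U" for x
  proof -
    have "x \<notin> U" using x U(1) by (simp add: frontier_def interior_open)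
    then have "\<not> cube_in U x (5 * rad K)" using cube_in_mem[of U x "5 * rad K"] rad_pos[of K] by auto
    from W_layer(1)[OF frontier_closure[OF x] this] show ?thesis using K o by linarith
  qed
  have off: "\<phi> (W K x) = 0" if x: "x \<in> U" "\<not> cube_in U x (5 * rad K)" for x
  proof (rule phi(2))
    obtain p where p: "p \<in> frontier U" "\<And>i. \<bar>p $ i - x $ i\<bar> \<le> 5 * rad K" using frontier_near[OF x] by blast
    have xc: "x \<in> closure U" using x(1) closure_subset by auto
    have "norm (p - x) \<le> (\<Sum>i\<in>UNIV. \<bar>(p - x) $ i\<bar>)" by (rule norm_le_l1_cart)
    also have "\<dots> \<le> (\<Sum>i\<in>(UNIV :: 'n set). 5 * rad K)" using p(2) by (intro sum_mono) simp
    finally have "norm (p - x) \<le> real CARD('n) * (5 * rad K)" by simp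
    also have "\<dots> \<le> real CARD('n) * (8 * rad K)" using rad_pos[of K] by (intro mult_left_mono) auto
    finally have "dist p x \<le> 2 * real CARD('n) * (2 * (2 * rad K))" by (simp add: dist_norm)
    then have "dist p x powr \<alpha> \<le> (2 * real CARD('n) * (2 * (2 * rad K))) powr \<alpha>" using \<alpha> by (intro powr_mono2) auto
    then have "M * dist p x powr \<alpha> \<le> osc (2 * (2 * rad K))" unfolding osc_def using M by simp
    also have "\<dots> \<le> 2 * osc (2 * rad K)" using rad_pos[of K] by (intro osc_double) simp
    also have "\<dots> \<le> 2 * (2 * osc (rad K))" using osc_double[OF rad_pos[of K]] by simp
    finally have "norm (u p - u x) \<le> 4 * osc (rad K)"
      using holder[OF frontier_closure[OF p(1)] xc] by simp
    then have "norm (u p - W K x) \<le> \<delta>"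
      using W_layer(1)[OF xc x(2)] norm_triangle_ineq4[of "u p - u x" "W K x - u x"] K by simp
    then show "W K x \<notin> S" using d(2)[OF p(1), of "W K x"] by auto
  qed
  have cW: "continuous_on UNIV (\<lambda>x. \<phi> (W K x) * det (W' K x))"
    using C1_map_continuous_on[OF C1_W]
    by (intro continuous_on_mult continuous_on_det continuous_on_compose2[OF C1_scalar_continuous_on[OF phi(1)]]) auto
  have int: "integrable lborel (\<lambda>x. shell k x * (\<phi> (W K x) * det (W' K x)))" for k
  proof (rule integrable_compact_support[of "closure U"])
    show "compact (closure U)" using U(2) by simp
    show "continuous_on (closure U) (\<lambda>x. shell k x * (\<phi> (W K x) * det (W' K x)))"
      by (intro continuous_on_mult C1_scalar_continuous_on[OF C1_shell] continuous_on_subset[OF cW]) auto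
    show "shell k x * (\<phi> (W K x) * det (W' K x)) = 0" if "x \<notin> closure U" for x
      using shell_support(1)[of k x] closure_subset[of U] that by auto
  qed
  have "(\<integral>y. \<phi> y * brouwer_degree u U y \<partial>lborel) = (LINT x:U|lborel. \<phi> (W K x) * det (W' K x))"
    by (rule d(3)[OF data bdry phi, symmetric])
  also have "\<dots> = (\<integral>x. (\<Sum>k<K. shell k x * (\<phi> (W K x) * det (W' K x))) \<partial>lborel)"
    unfolding set_lebesgue_integral_def
  proof (intro Bochner_Integration.integral_cong refl)
    fix x
    have "indicator U x *\<^sub>R (\<phi> (W K x) * det (W' K x)) = cutoff U (rad K) x * (\<phi> (W K x) * det (W' K x))"
    proof (cases "x \<in> U")
      case True
      show ?thesis
      proof (cases "cube_in U x (5 * rad K)")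
        case True
        then show ?thesis using cutoff_inside(1)[OF U(2) rad_pos True] \<open>x \<in> U\<close> by simp
      qed (use off True in simp)
    qed (simp add: cutoff_outside[OF rad_pos])
    then show "indicator U x *\<^sub>R (\<phi> (W K x) * det (W' K x)) = (\<Sum>k<K. shell k x * (\<phi> (W K x) * det (W' K x)))"
      by (simp only: shell_sum sum_distrib_right)
  qed
  also have "\<dots> = (\<Sum>k<K. \<integral>x. shell k x * (\<phi> (W K x) * det (W' K x)) \<partial>lborel)"
    by (rule Bochner_Integration.integral_sum) (rule int)
  finally have "\<bar>\<integral>y. \<phi> y * brouwer_degree u U y \<partial>lborel\<bar> \<le> (\<Sum>k<K. \<bar>\<integral>x. shell k x * (\<phi> (W K x) * det (W' K x)) \<partial>lborel\<bar>)"
    by (simp only: sum_abs)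
  also have "\<dots> \<le> (\<Sum>k<K. N * shell_const TYPE('n) q * (real (covering_number (rad k) (frontier U)) * osc (rad k) powr (real CARD('n) - real CARD('n) / q)))"
    by (intro sum_mono shell_estimate[OF phi(1) q N I]) auto
  also have "\<dots> = N * shell_const TYPE('n) q * (\<Sum>k<K. real (covering_number (rad k) (frontier U)) * osc (rad k) powr (real CARD('n) - real CARD('n) / q))"
    by (simp add: sum_distrib_left)
  also have "\<dots> \<le> N * shell_const TYPE('n) q * Z"
    using N shell_const_nonneg[OF q] by (intro mult_left_mono Z) auto
  finally show ?thesis .
qed

end

subsection \<open>Duality\<close>

lemma cutoff_compact_support:
  fixes U :: "(real ^ 'n) set"
  assumes "r > 0"
  obtains L where "compact L" "L \<subseteq> U" "\<And>x. x \<notin> L \<Longrightarrow> cutoff U r x = 0"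
proof
  let ?c = "\<lambda>z. cbox (grid_point r z - (\<chi> i. r)) (grid_point r z + (\<chi> i. r))"
  let ?L = "\<Union>z\<in>inner_grid U r. ?c z"
  show "compact ?L" by (intro compact_UN) auto
  show "?L \<subseteq> U"
  proof
    fix x assume "x \<in> ?L"
    then obtain z where z: "z \<in> inner_grid U r" "x \<in> ?c z" by blast
    then have "\<bar>x $ i - grid_point r z $ i\<bar> \<le> r" for i
      by (auto simp: mem_box_cart abs_le_iff algebra_simps dest: spec[of _ i])
    moreover have "cube_in U (grid_point r z) (4 * r)" using z(1) unfolding inner_grid_def by auto
    ultimately have "cube_in U x (3 * r)" by (intro cube_in_shift[of U "grid_point r z" "4 * r" x r]) auto
    then show "x \<in> U" using assms cube_in_mem by force
  qed
  show "cutoff U r x = 0" if "x \<notin> ?L" for x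
    unfolding cutoff_def
  proof (rule sum.neutral, rule ballI)
    fix z assume z: "z \<in> inner_grid U r"
    show "grid_bump r z x = 0"
    proof (rule ccontr)
      assume "grid_bump r z x \<noteq> 0"
      then have "\<bar>x $ i - grid_point r z $ i\<bar> < r" for i using grid_bump_support[OF assms] by blast
      then have "x \<in> ?c z" unfolding mem_box_cart by (auto simp: abs_less_iff algebra_simps less_imp_le)
      then show False using that z by blast
    qed
  qed
qed

lemma C1_scalar_locally_constant:
  assumes "open S" "\<And>y. y \<in> S \<Longrightarrow> \<exists>r>0. \<forall>y'\<in>ball y r. g y' = g y"
  shows "C1_scalar S (\<lambda>y. F (g y)) (\<lambda>y. 0)"
proof (rule C1_scalarI)
  fix y assume "y \<in> S"
  then obtain r where r: "r > 0" "\<And>y'. y' \<in> ball y r \<Longrightarrow> g y' = g y" using assms(2) by blast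
  show "((\<lambda>y. F (g y)) has_derivative (\<lambda>h. 0)) (at y)"
  proof (rule has_derivative_transform_within_open[where s="ball y r" and f="\<lambda>_. F (g y)"])
    show "F (g y) = F (g y')" if "y' \<in> ball y r" for y' using r(2)[OF that] by simp
  qed (use r(1) in simp_all)
qed auto

context holder_data
begin

lemma degree_Lp_bound:
  assumes p: "p > 1" and q: "q = p / (p - 1)" "q > real CARD('n)"
    and Z: "\<And>K. (\<Sum>k<K. real (covering_number (rad k) (frontier U)) * osc (rad k) powr (real CARD('n) - real CARD('n) / q)) \<le> Z"
  shows "(\<integral>\<^sup>+y. indicator (- (u ` frontier U)) y * ennreal (\<bar>brouwer_degree u U y\<bar> powr p) \<partial>lborel)
     \<le> ennreal ((shell_const TYPE('n) q * Z) powr p)"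
proof -
  interpret degree_data U u using U cont_u by unfold_locales
  define g where "g = brouwer_degree u U"
  obtain B where B: "\<And>y. norm y > B \<Longrightarrow> g y = 0" using brouwer_degree_bounded_support unfolding g_def by blast
  define D where "D = - (u ` frontier U) \<inter> ball 0 (B + 1)"
  have D: "open D" "bounded D" unfolding D_def using compact_image by (auto intro: open_Compl compact_imp_closed bounded_subset[OF bounded_ball])
  have lc: "\<exists>r>0. \<forall>y'\<in>ball y r. g y' = g y" if "y \<in> D" for y
    using brouwer_degree_locally_constant[of y] that unfolding D_def g_def by blast
  have q1: "q > 1" "(p - 1) * q = p" using q(2) real_card_ge_1[where 'n='n] p q(1) by linarith (use p q(1) in \<open>simp add: field_simps\<close>)
  define C where "C = shell_const TYPE('n) q * Z"
  define J where "J r = (\<integral>y. cutoff D r y * \<bar>g y\<bar> powr p \<partial>lborel)" for r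
  have Jint: "integrable lborel (\<lambda>y. cutoff D r y * \<bar>g y\<bar> powr p)" and Jmeas: "(\<lambda>y. cutoff D r y * \<bar>g y\<bar> powr p) \<in> borel_measurable borel"
    and J: "J r \<le> C powr p" if r: "r > 0" for r
  proof -
    obtain L where L: "compact L" "L \<subseteq> D" "\<And>x. x \<notin> L \<Longrightarrow> cutoff D r x = 0" using cutoff_compact_support[OF r] by blast
    have ext: "C1_scalar UNIV (\<lambda>y. cutoff D r y * F (g y)) (\<lambda>y. cutoff D r y *\<^sub>R 0 + F (g y) *\<^sub>R cutoff' D r y)" for F
      by (rule C1_scalar_extend[OF C1_cutoff compact_imp_closed[OF L(1)] L(2) D(1) L(3) C1_scalar_locally_constant[OF D(1) lc]])
    have cont: "continuous_on T (\<lambda>y. cutoff D r y * F (g y))" for F T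
      using C1_scalar_continuous_on[OF ext] continuous_on_subset by blast
    show int: "integrable lborel (\<lambda>y. cutoff D r y * \<bar>g y\<bar> powr p)"
      by (rule integrable_compact_support[OF L(1) cont[of _ "\<lambda>t. \<bar>t\<bar> powr p"]]) (simp add: L)
    show "(\<lambda>y. cutoff D r y * \<bar>g y\<bar> powr p) \<in> borel_measurable borel"
      by (rule borel_measurable_continuous_onI[OF cont[of _ "\<lambda>t. \<bar>t\<bar> powr p"]])
    show "J r \<le> C powr p"
    proof (cases "J r > 0")
      case True
      define \<phi> where "\<phi> y = cutoff D r y * (sgn (g y) * \<bar>g y\<bar> powr (p - 1))" for y
      define N where "N = J r powr (1 / q)"
      have N: "N > 0" "N powr q = J r" unfolding N_def using True q1 by (auto simp: powr_powr)
      have phig: "\<phi> y * g y = cutoff D r y * \<bar>g y\<bar> powr p" for y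
      proof (cases "g y = 0")
        case False
        have "sgn (g y) * \<bar>g y\<bar> powr (p - 1) * g y = \<bar>g y\<bar> powr (p - 1) * \<bar>g y\<bar>"
          by (simp add: abs_sgn mult.commute mult.left_commute)
        also have "\<dots> = \<bar>g y\<bar> powr p" using False by (simp add: powr_mult_base mult.commute)
        finally show ?thesis unfolding \<phi>_def by (simp add: mult.assoc)
      qed (simp add: \<phi>_def)
      have phiq: "\<bar>\<phi> y\<bar> powr q \<le> cutoff D r y * \<bar>g y\<bar> powr p" for y
      proof (cases "g y = 0")
        case False
        have "\<bar>\<phi> y\<bar> = cutoff D r y * \<bar>g y\<bar> powr (p - 1)"
          using False cutoff_nonneg[of D r y] by (simp add: \<phi>_def abs_mult abs_sgn_eq)
        then have "\<bar>\<phi> y\<bar> powr q = cutoff D r y powr q * \<bar>g y\<bar> powr p"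
          using cutoff_nonneg[of D r y] q1(2) by (simp add: powr_mult powr_powr)
        also have "cutoff D r y powr q \<le> cutoff D r y powr 1"
          using cutoff_nonneg[of D r y] cutoff_le_1[OF D(2) r, of y] q1(1) by (intro powr_mono') auto
        finally show ?thesis using cutoff_nonneg[of D r y] by (simp add: mult_right_mono)
      qed (use q1 in \<open>simp add: \<phi>_def\<close>)
      have "(\<integral>\<^sup>+y. ennreal (\<bar>\<phi> y\<bar> powr q) \<partial>lborel) \<le> (\<integral>\<^sup>+y. ennreal (cutoff D r y * \<bar>g y\<bar> powr p) \<partial>lborel)"
        by (intro nn_integral_mono ennreal_leI phiq)
      also have "\<dots> = ennreal (J r)"
        unfolding J_def by (rule nn_integral_eq_integral[OF int]) (simp add: cutoff_nonneg)
      finally have I: "(\<integral>\<^sup>+y. ennreal (\<bar>\<phi> y\<bar> powr q) \<partial>lborel) \<le> ennreal (N powr q)" using N by simp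
      have "\<bar>\<integral>y. \<phi> y * brouwer_degree u U y \<partial>lborel\<bar> \<le> N * shell_const TYPE('n) q * Z"
      proof (rule degree_pairing[OF L(1) _ _ _ q(2) N(1) I Z])
        show "L \<inter> u ` frontier U = {}" using L(2) unfolding D_def by blast
        show "C1_scalar UNIV \<phi> (\<lambda>y. cutoff D r y *\<^sub>R 0 + (sgn (g y) * \<bar>g y\<bar> powr (p - 1)) *\<^sub>R cutoff' D r y)"
          unfolding \<phi>_def[abs_def] by (rule ext)
        show "\<phi> y = 0" if "y \<notin> L" for y using L(3)[OF that] by (simp add: \<phi>_def)
      qed
      then have "J r \<le> N * C" using phig True unfolding g_def[symmetric] J_def C_def by (simp add: mult.assoc)
      then have "J r powr (1 - 1 / q) \<le> C"
      proof -
        assume le: "J r \<le> N * C"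
        have "J r = J r powr (1 - 1 / q) * N" unfolding N_def using True by (simp add: powr_add[symmetric])
        then have "J r powr (1 - 1 / q) * N \<le> C * N" using le by (simp add: mult.commute)
        then show ?thesis using N(1) by simp
      qed
      then have "(J r powr (1 - 1 / q)) powr p \<le> C powr p" using p by (intro powr_mono2) auto
      moreover have "(1 - 1 / q) * p = 1"
      proof -
        have "p * q = p + q" using p q(1) by (simp add: field_simps)
        then show ?thesis using q1(1) by (simp add: field_simps)
      qed
      ultimately show ?thesis using True by (simp add: powr_powr)
    qed (auto intro: order_trans[of _ 0])
  qed
  define s :: "nat \<Rightarrow> real" where "s k = 1 / 2 ^ k" for k
  have s: "s k > 0" for k unfolding s_def by simp
  have "(\<integral>\<^sup>+y. indicator (- (u ` frontier U)) y * ennreal (\<bar>g y\<bar> powr p) \<partial>lborel)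
     \<le> (\<integral>\<^sup>+y. liminf (\<lambda>k. ennreal (cutoff D (s k) y * \<bar>g y\<bar> powr p)) \<partial>lborel)"
  proof (rule nn_integral_mono)
    fix y
    show "indicator (- (u ` frontier U)) y * ennreal (\<bar>g y\<bar> powr p) \<le> liminf (\<lambda>k. ennreal (cutoff D (s k) y * \<bar>g y\<bar> powr p))"
    proof (cases "y \<in> D")
      case True
      have "compact {y}" "{y} \<subseteq> D" using True by auto
      from cube_in_compact[OF this D(1)] obtain e where e: "e > 0" "cube_in D y e" by blast
      obtain k0 where "5 / e < 2 ^ k0" using real_arch_pow[of 2 "5 / e"] by auto
      then have k0: "5 * s k0 \<le> e" using e(1) unfolding s_def by (simp add: field_simps)
      have "eventually (\<lambda>k. ennreal (\<bar>g y\<bar> powr p) \<le> ennreal (cutoff D (s k) y * \<bar>g y\<bar> powr p)) sequentially"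
        unfolding eventually_sequentially
      proof (intro exI allI impI)
        fix k assume "k0 \<le> k"
        then have "s k \<le> s k0" unfolding s_def by (intro divide_left_mono power_increasing) auto
        then have "cube_in D y (5 * s k)" using k0 by (intro cube_in_mono[OF e(2)]) auto
        then show "ennreal (\<bar>g y\<bar> powr p) \<le> ennreal (cutoff D (s k) y * \<bar>g y\<bar> powr p)"
          using cutoff_inside(1)[OF D(2) s] by simp
      qed
      then have "ennreal (\<bar>g y\<bar> powr p) \<le> liminf (\<lambda>k. ennreal (cutoff D (s k) y * \<bar>g y\<bar> powr p))"
        by (rule Liminf_bounded)
      then show ?thesis by (auto simp: indicator_def)
    next
      case False
      then have "y \<in> u ` frontier U \<or> g y = 0" using B[of y] unfolding D_def by force
      then show ?thesis using p by auto
    qed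
  qed
  also have "\<dots> \<le> liminf (\<lambda>k. \<integral>\<^sup>+y. ennreal (cutoff D (s k) y * \<bar>g y\<bar> powr p) \<partial>lborel)"
    by (rule nn_integral_liminf) (use Jmeas[OF s] in simp)
  also have "\<dots> = liminf (\<lambda>k. ennreal (J (s k)))"
    unfolding J_def by (subst nn_integral_eq_integral[OF Jint[OF s]]) (simp_all add: cutoff_nonneg)
  also have "\<dots> \<le> liminf (\<lambda>k::nat. ennreal (C powr p))"
    by (intro Liminf_mono always_eventually allI ennreal_leI J s)
  also have "\<dots> = ennreal (C powr p)" by (simp add: Liminf_const)
  finally show ?thesis unfolding g_def C_def .
qed

end

subsection \<open>Growth of covering numbers\<close>

lemma covering_number_small:
  assumes "has_box_dim F d" "d < d'"
  obtains b where "b > 0" "\<And>r. 0 < r \<Longrightarrow> r < b \<Longrightarrow> real (covering_number r F) \<le> r powr (- d')"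
proof -
  have "eventually (\<lambda>r. ln (real (covering_number r F)) / (- ln r) < d') (at_right 0)"
    using order_tendstoD(2)[OF assms(1)[unfolded has_box_dim_def] assms(2)] .
  then obtain b where b: "b > 0" "\<And>r. 0 < r \<Longrightarrow> r < b \<Longrightarrow> ln (real (covering_number r F)) / (- ln r) < d'"
    unfolding eventually_at_right_field by blast
  have "real (covering_number r F) \<le> r powr (- d')" if "0 < r" "r < min b 1" for r
  proof (cases "covering_number r F = 0")
    case False
    have "ln r < 0" using that by simp
    then have "ln (real (covering_number r F)) < d' * (- ln r)" using b(2)[of r] that by (simp add: field_simps)
    then have "exp (ln (real (covering_number r F))) \<le> exp (d' * (- ln r))" by simp
    then show ?thesis using False that by (simp add: powr_def)
  qed simp
  then show ?thesis using that[of "min b 1"] b(1) by simp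
qed

lemma covering_number_dyadic:
  assumes "has_box_dim F d" "d < d'" "R > 0"
  obtains C where "C \<ge> 0" "\<And>k. real (covering_number (R / 2 ^ k) F) \<le> C * (R / 2 ^ k) powr (- d')"
proof -
  obtain b where b: "b > 0" "\<And>r. 0 < r \<Longrightarrow> r < b \<Longrightarrow> real (covering_number r F) \<le> r powr (- d')"
    using covering_number_small[OF assms(1,2)] by blast
  obtain m where "R / b < 2 ^ m" using real_arch_pow[of 2 "R / b"] by auto
  then have m: "R / 2 ^ m < b" using b(1) by (simp add: field_simps)
  define f where "f k = real (covering_number (R / 2 ^ k) F) * (R / 2 ^ k) powr d'" for k
  have f: "f k \<ge> 0" for k unfolding f_def by simp
  have pos: "R / 2 ^ k > 0" for k using assms(3) by simp
  define C where "C = 1 + (\<Sum>k<m. f k)"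
  have C: "C \<ge> 1" unfolding C_def using f by (simp add: sum_nonneg)
  have "f k \<le> C" for k
  proof (cases "k < m")
    case True
    have "f k \<le> (\<Sum>k<m. f k)" by (rule member_le_sum) (use True f in auto)
    then show ?thesis unfolding C_def by simp
  next
    case False
    then have "R / 2 ^ k \<le> R / 2 ^ m" using assms(3) by (intro divide_left_mono power_increasing) auto
    then have "real (covering_number (R / 2 ^ k) F) \<le> (R / 2 ^ k) powr (- d')" using b(2)[OF pos] m by simp
    then have "f k \<le> (R / 2 ^ k) powr (- d') * (R / 2 ^ k) powr d'" unfolding f_def by (intro mult_right_mono) auto
    also have "\<dots> = 1" using assms(3) by (simp add: powr_add[symmetric])
    finally show ?thesis using C by simp
  qed
  then have "f k * (R / 2 ^ k) powr (- d') \<le> C * (R / 2 ^ k) powr (- d')" for k by (intro mult_right_mono) auto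
  moreover have "f k * (R / 2 ^ k) powr (- d') = real (covering_number (R / 2 ^ k) F)" for k
    unfolding f_def using assms(3) by (simp add: mult.assoc powr_add[symmetric])
  ultimately show ?thesis using that[of C] C by simp
qed

lemma summable_covering_number:
  assumes "has_box_dim F d" "d < e" "R > 0" "c > 0"
  shows "summable (\<lambda>k. real (covering_number (R / 2 ^ k) F) * (c * (R / 2 ^ k)) powr e)"
proof -
  obtain d' where d': "d < d'" "d' < e" using dense[OF assms(2)] by blast
  obtain C where C: "C \<ge> 0" "\<And>k. real (covering_number (R / 2 ^ k) F) \<le> C * (R / 2 ^ k) powr (- d')"
    using covering_number_dyadic[OF assms(1) d'(1) assms(3)] by blast
  define x where "x = 2 powr (d' - e)"
  have x: "0 < x" "x < 1" unfolding x_def using d'(2) by (auto simp: powr_less_one)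
  have "summable (\<lambda>k. (C * c powr e * R powr (e - d')) * x ^ k)"
    using x by (intro summable_mult summable_geometric) auto
  then show ?thesis
  proof (rule summable_comparison_test'[where N=0])
    fix k
    have "real (covering_number (R / 2 ^ k) F) * (c * (R / 2 ^ k)) powr e
      \<le> (C * (R / 2 ^ k) powr (- d')) * (c * (R / 2 ^ k)) powr e"
      by (intro mult_right_mono C(2)) auto
    also have "\<dots> = C * c powr e * ((R / 2 ^ k) powr (- d') * (R / 2 ^ k) powr e)"
    proof -
      have "(c * (R / 2 ^ k)) powr e = c powr e * (R / 2 ^ k) powr e" by (rule powr_mult)
      then show ?thesis by (simp only: ac_simps)
    qed
    also have "(R / 2 ^ k) powr (- d') * (R / 2 ^ k) powr e = (R / 2 ^ k) powr (e - d')"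
      by (simp add: powr_add[symmetric])
    also have "\<dots> = R powr (e - d') * x ^ k"
    proof -
      have "(2 ^ k) powr (e - d') * x ^ k = 1"
        unfolding x_def by (simp add: powr_realpow[symmetric] powr_powr powr_power powr_add[symmetric] algebra_simps)
      then show ?thesis using assms(3) x by (simp add: powr_divide field_simps)
    qed
    finally show "norm (real (covering_number (R / 2 ^ k) F) * (c * (R / 2 ^ k)) powr e) \<le> (C * c powr e * R powr (e - d')) * x ^ k"
      by (simp add: mult.assoc)
  qed
qed

subsection \<open>Extension of Hoelder maps to the closure\<close>

lemma holder_space_bound:
  fixes u :: "'a::metric_space \<Rightarrow> 'b::real_normed_vector"
  assumes "u \<in> holder_space \<alpha> U" "x \<in> U" "y \<in> U"
  shows "norm (u x - u y) \<le> enn2real (holder_norm \<alpha> U u) * dist x y powr \<alpha>"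
proof (cases "x = y")
  case False
  have "ennreal (norm (u x - u y) / dist x y powr \<alpha>) \<le> holder_seminorm \<alpha> U u"
    unfolding holder_seminorm_def using assms(2,3) False
    by (intro SUP_upper2[of "(x, y)"]) auto
  also have "\<dots> \<le> holder_norm \<alpha> U u" unfolding holder_norm_def by simp
  also have "\<dots> = ennreal (enn2real (holder_norm \<alpha> U u))"
    using assms(1) unfolding holder_space_def by simp
  finally have "norm (u x - u y) / dist x y powr \<alpha> \<le> enn2real (holder_norm \<alpha> U u)"
    by (simp add: ennreal_le_iff)
  then show ?thesis using False by (simp add: field_simps)
qed simp

lemma cont_ext_sequence:
  fixes u :: "real ^ 'n \<Rightarrow> real ^ 'n"
  assumes "uniformly_continuous_on U u" "x \<in> closure U"
  obtains X where "\<And>k. X k \<in> U" "X \<longlonglongrightarrow> x" "(\<lambda>k. u (X k)) \<longlonglongrightarrow> cont_ext U u x"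
proof (cases "x \<in> U")
  case True
  then show ?thesis using that[of "\<lambda>_. x"] by (simp add: cont_ext_def)
next
  case False
  obtain l where l: "(u \<longlongrightarrow> l) (at x within U)"
    using uniformly_continuous_on_extension_at_closure[OF assms] .
  have "x islimpt U" using False assms(2) by (simp add: closure_def)
  then have "at x within U \<noteq> bot" using trivial_limit_within by blast
  then have e: "cont_ext U u x = l" using False tendsto_Lim[OF _ l] by (simp add: cont_ext_def)
  obtain X where X: "\<And>k. X k \<in> U - {x}" "X \<longlonglongrightarrow> x"
    using \<open>x islimpt U\<close> unfolding islimpt_sequential by blast
  have "(\<lambda>k. u (X k)) \<longlonglongrightarrow> l"
    using l X unfolding tendsto_at_iff_sequentially o_def by blast
  then show ?thesis using that[of X] X e by blast
qed

lemma cont_ext_holder: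
  fixes u :: "real ^ 'n \<Rightarrow> real ^ 'n"
  assumes \<alpha>: "\<alpha> > 0" and M: "M > 0"
    and u: "\<And>x y. x \<in> U \<Longrightarrow> y \<in> U \<Longrightarrow> norm (u x - u y) \<le> M * dist x y powr \<alpha>"
    and x: "x \<in> closure U" "y \<in> closure U"
  shows "norm (cont_ext U u x - cont_ext U u y) \<le> M * dist x y powr \<alpha>"
proof -
  note uc = holder_uniformly_continuous[OF \<alpha> M u]
  obtain X where X: "\<And>k. X k \<in> U" "X \<longlonglongrightarrow> x" "(\<lambda>k. u (X k)) \<longlonglongrightarrow> cont_ext U u x"
    using cont_ext_sequence[OF uc x(1)] by blast
  obtain Y where Y: "\<And>k. Y k \<in> U" "Y \<longlonglongrightarrow> y" "(\<lambda>k. u (Y k)) \<longlonglongrightarrow> cont_ext U u y"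
    using cont_ext_sequence[OF uc x(2)] by blast
  have "(\<lambda>k. norm (u (X k) - u (Y k))) \<longlonglongrightarrow> norm (cont_ext U u x - cont_ext U u y)"
    by (intro tendsto_intros X Y)
  moreover have "(\<lambda>k. M * dist (X k) (Y k) powr \<alpha>) \<longlonglongrightarrow> M * dist x y powr \<alpha>"
    by (intro tendsto_mult tendsto_const tendsto_powr' tendsto_dist X Y) (use \<alpha> in auto)
  ultimately show ?thesis
    by (rule LIMSEQ_le) (use u X(1) Y(1) in blast)
qed

subsection \<open>The image of the boundary is a null set\<close>

lemma (in holder_data) image_frontier_null:
  assumes "has_box_dim (frontier U) d" "d < real CARD('n) * \<alpha>"
  shows "u ` frontier U \<in> null_sets lborel"
proof -
  define a where "a k = real (covering_number (rad k) (frontier U)) * (2 * real CARD('n) * rad k) powr (real CARD('n) * \<alpha>)" for k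
  have "summable a"
    unfolding a_def rad_def using real_card_ge_1[where 'n='n] R(1) by (intro summable_covering_number[OF assms]) auto
  then have lim: "(\<lambda>k. ennreal ((2 * M) ^ CARD('n) * a k)) \<longlonglongrightarrow> ennreal ((2 * M) ^ CARD('n) * 0)"
    by (intro tendsto_ennrealI tendsto_mult tendsto_const summable_LIMSEQ_zero)
  have comp: "compact (u ` frontier U)"
    using U(2) by (intro compact_continuous_image compact_frontier_bounded continuous_on_subset[OF cont_u]) (auto simp: frontier_def)
  have le: "emeasure lborel (u ` frontier U) \<le> ennreal ((2 * M) ^ CARD('n) * a k)" for k
  proof -
    let ?r = "rad k"
    obtain P where P: "finite P" "card P = covering_number ?r (frontier U)" "frontier U \<subseteq> (\<Union>a\<in>P. cbox a (a + ?r *\<^sub>R One))"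
      using covering_number_cover[OF compact_frontier_bounded[OF U(2)] rad_pos] by blast
    define c where "c b = (SOME x. x \<in> frontier U \<and> x \<in> cbox b (b + ?r *\<^sub>R One))" for b
    define Q where "Q b = cbox (u (c b) - osc ?r *\<^sub>R One) (u (c b) + osc ?r *\<^sub>R One)" for b
    have o: "osc ?r > 0" using osc_pos rad_pos by blast
    have sub: "u ` frontier U \<subseteq> (\<Union>b\<in>P. Q b)"
    proof
      fix y assume "y \<in> u ` frontier U"
      then obtain x where x: "x \<in> frontier U" "y = u x" by blast
      then obtain b where b: "b \<in> P" "x \<in> cbox b (b + ?r *\<^sub>R One)" using P(3) by blast
      have "\<exists>x. x \<in> frontier U \<and> x \<in> cbox b (b + ?r *\<^sub>R One)" using x b by blast
      from someI_ex[OF this, folded c_def] have c: "c b \<in> frontier U" "c b \<in> cbox b (b + ?r *\<^sub>R One)" by auto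
      have "\<bar>(x - c b) $ i\<bar> \<le> ?r" for i
      proof -
        have "b $ i \<le> x $ i" "x $ i \<le> b $ i + ?r" "b $ i \<le> c b $ i" "c b $ i \<le> b $ i + ?r"
          using b(2) c(2) One_component[where 'n='n] by (auto simp: mem_box_cart)
        then show ?thesis by (simp add: abs_le_iff)
      qed
      then have "norm (x - c b) \<le> (\<Sum>i\<in>(UNIV :: 'n set). ?r)"
        by (intro order_trans[OF norm_le_l1_cart] sum_mono)
      then have "norm (x - c b) \<le> real CARD('n) * ?r" by simp
      also have "\<dots> \<le> 2 * real CARD('n) * ?r" using rad_pos[of k] by (intro mult_right_mono) auto
      finally have "dist x (c b) \<le> 2 * real CARD('n) * ?r" by (simp only: dist_norm)
      then have "M * dist x (c b) powr \<alpha> \<le> osc ?r" unfolding osc_def using M \<alpha> by (intro mult_left_mono powr_mono2) auto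
      then have n: "norm (y - u (c b)) \<le> osc ?r"
        using holder[of x "c b"] x c(1) by (simp add: frontier_def)
      have "(u (c b) - osc ?r *\<^sub>R One) $ i \<le> y $ i \<and> y $ i \<le> (u (c b) + osc ?r *\<^sub>R One) $ i" for i
        using component_le_norm_cart[of "y - u (c b)" i] n One_component[of i] by (simp add: abs_le_iff)
      then have "y \<in> Q b" unfolding Q_def mem_box_cart by blast
      then show "y \<in> (\<Union>b\<in>P. Q b)" using b(1) by blast
    qed
    have "emeasure lborel (u ` frontier U) \<le> emeasure lborel (\<Union>b\<in>P. Q b)"
      by (rule emeasure_mono[OF sub]) (use P(1) in \<open>auto simp: Q_def\<close>)
    also have "\<dots> \<le> (\<Sum>b\<in>P. emeasure lborel (Q b))"
      by (rule emeasure_subadditive_finite[OF P(1)]) (auto simp: Q_def)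
    also have "emeasure lborel (Q b) = ennreal ((2 * osc ?r) ^ CARD('n))" for b
    proof -
      have "emeasure lborel (Q b) = ennreal (\<Prod>i\<in>Basis. (u (c b) + osc ?r *\<^sub>R One - (u (c b) - osc ?r *\<^sub>R One)) \<bullet> i)"
        unfolding Q_def using o by (intro emeasure_lborel_cbox) (auto simp: inner_diff_left inner_add_left)
      also have "(\<Prod>i\<in>Basis. (u (c b) + osc ?r *\<^sub>R One - (u (c b) - osc ?r *\<^sub>R One)) \<bullet> i) = (\<Prod>i\<in>(Basis :: (real ^ 'n) set). 2 * osc ?r)"
      proof (rule prod.cong[OF refl])
        fix i :: "real ^ 'n" assume i: "i \<in> Basis"
        have One: "(One :: real ^ 'n) \<bullet> i = 1" using inner_sum_left_Basis[OF i, of "\<lambda>_. 1"] by simp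
        show "(u (c b) + osc ?r *\<^sub>R One - (u (c b) - osc ?r *\<^sub>R One)) \<bullet> i = 2 * osc ?r"
          unfolding inner_diff_left inner_add_left inner_scaleR_left One by simp
      qed
      finally show ?thesis by simp
    qed
    then have "(\<Sum>b\<in>P. emeasure lborel (Q b)) = ennreal (real (covering_number ?r (frontier U)) * (2 * osc ?r) ^ CARD('n))"
      using o by (simp add: P(2)[symmetric] ennreal_of_nat_eq_real_of_nat ennreal_mult)
    also have "real (covering_number ?r (frontier U)) * (2 * osc ?r) ^ CARD('n) = (2 * M) ^ CARD('n) * a k"
    proof -
      have "((2 * real CARD('n) * ?r) powr \<alpha>) ^ CARD('n) = (2 * real CARD('n) * ?r) powr (real CARD('n) * \<alpha>)"
        using rad_pos[of k] real_card_ge_1[where 'n='n] by (simp add: powr_power mult.commute)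
      then show ?thesis unfolding osc_def a_def by (simp add: power_mult_distrib)
    qed
    finally show ?thesis .
  qed
  have "emeasure lborel (u ` frontier U) \<le> ennreal ((2 * M) ^ CARD('n) * 0)"
    by (rule LIMSEQ_le_const[OF lim]) (use le in blast)
  then have "emeasure lborel (u ` frontier U) = 0" by simp
  moreover have "u ` frontier U \<in> sets lborel" using comp by (simp add: borel_compact)
  ultimately show ?thesis by (rule null_setsI)
qed

lemma conjugate_exponent:
  fixes n p d \<alpha> :: real
  assumes "n - 1 < d" "0 < d" "\<alpha> \<le> 1" "1 < p" "p < n * \<alpha> / d" "n > 0"
  shows "p / (p - 1) > n" "n - n / (p / (p - 1)) = n / p" "d < \<alpha> * (n / p)"
proof -
  have pd: "p * d < n * \<alpha>" using assms by (simp add: field_simps)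
  have "p * (n - 1) \<le> p * d" using assms by (intro mult_left_mono) auto
  also have "\<dots> < n * 1" using pd assms(3,6) mult_left_mono[of \<alpha> 1 n] by linarith
  finally show "p / (p - 1) > n" using assms(4) by (simp add: field_simps)
  show "n - n / (p / (p - 1)) = n / p" using assms(4) by (simp add: field_simps)
  show "d < \<alpha> * (n / p)" using pd assms(4) by (simp add: field_simps)
qed

lemma has_box_dim_frontier_nonempty:
  assumes "has_box_dim (frontier U) d" "d \<noteq> 0" shows "U \<noteq> {}"
proof
  assume "U = {}"
  then have "covering_number r (frontier U) = 0" for r :: real
    unfolding covering_number_def by (intro Least_eq_0 exI[of _ "{}"]) simp
  then have "((\<lambda>r::real. 0) \<longlongrightarrow> d) (at_right 0)" using assms(1) unfolding has_box_dim_def by simp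
  then have "d = 0" using tendsto_unique[OF trivial_limit_at_right_real _ tendsto_const] by blast
  then show False using assms(2) by simp
qed

text \<open>The powers of the Hoelder constant \<open>M\<close> are split off from the multiscale sum, so that the
  remaining constant depends on the domain only.\<close>

lemma degree_in_Lp:
  fixes U :: "(real ^ 'n) set" and \<alpha> d p :: real
  assumes \<alpha>: "0 < \<alpha>" "\<alpha> \<le> 1" and d: "real CARD('n) - 1 < d" "d < real CARD('n) * \<alpha>"
    and U: "open U" "bounded U" and dim: "has_box_dim (frontier U) d"
    and p: "1 < p" "p < real CARD('n) * \<alpha> / d"
  shows "\<exists>C. \<forall>u M. M > 0 \<longrightarrow>
    (\<forall>x\<in>closure U. \<forall>y\<in>closure U. norm (u x - u y) \<le> M * dist x y powr \<alpha>) \<longrightarrow>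
    in_Lp p (- (u ` frontier U)) (brouwer_degree u U) \<and>
    Lp_norm p (- (u ` frontier U)) (brouwer_degree u U) \<le> C * M powr (real CARD('n) / p)"
proof -
  let ?n = "real CARD('n)"
  have n: "?n \<ge> 1" by (rule real_card_ge_1)
  have d0: "d > 0" using d(1) n by linarith
  define q where "q = p / (p - 1)"
  have q: "q > ?n" "?n - ?n / q = ?n / p" "d < \<alpha> * (?n / p)"
    using conjugate_exponent[OF d(1) d0 \<alpha>(2) p] n unfolding q_def by auto
  have ne: "U \<noteq> {}" using has_box_dim_frontier_nonempty[OF dim] d0 by simp
  obtain R where R: "R > 0" "\<And>x. \<not> cube_in U x R" using no_large_cube[OF U(2)] by blast
  define a where "a k = real (covering_number (R / 2 ^ k) (frontier U)) * (2 * ?n * (R / 2 ^ k)) powr (\<alpha> * (?n / p))" for k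
  have a: "summable a" "\<And>k. a k \<ge> 0"
    unfolding a_def by (rule summable_covering_number[OF dim q(3) R(1)]) (use n in auto)
  define C where "C = shell_const TYPE('n) q * suminf a"
  have C: "C \<ge> 0" unfolding C_def using shell_const_nonneg[OF q(1)] a by (intro mult_nonneg_nonneg suminf_nonneg) auto
  have "in_Lp p (- (u ` frontier U)) (brouwer_degree u U) \<and>
    Lp_norm p (- (u ` frontier U)) (brouwer_degree u U) \<le> C * M powr (?n / p)"
    if M: "M > 0" and u: "\<And>x y. x \<in> closure U \<Longrightarrow> y \<in> closure U \<Longrightarrow> norm (u x - u y) \<le> M * dist x y powr \<alpha>" for u M
  proof -
    interpret H: holder_data U u M \<alpha> R using U ne M \<alpha> u R by unfold_locales auto
    interpret degree_data U u using U H.cont_u by unfold_locales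
    define D where "D = - (u ` frontier U)"
    define g where "g = brouwer_degree u U"
    have D: "open D" unfolding D_def using compact_image by (intro open_Compl compact_imp_closed)
    have Dl: "D \<in> sets lebesgue" using D by simp
    have null: "- D \<in> null_sets lebesgue"
      unfolding D_def using H.image_frontier_null[OF dim d(2)] by (simp add: null_sets_completionI)
    have cont: "continuous_on D (\<lambda>y. F (g y))" for F :: "real \<Rightarrow> real"
      using C1_scalar_continuous_on[OF C1_scalar_locally_constant[OF D, of g F]] brouwer_degree_locally_constant
      unfolding D_def g_def by blast
    have meas: "(\<lambda>y. F (g y)) \<in> borel_measurable (lebesgue_on D)" for F :: "real \<Rightarrow> real"
      by (rule continuous_imp_measurable_on_sets_lebesgue[OF cont Dl])
    define B where "B = shell_const TYPE('n) q * (M powr (?n / p) * suminf a)"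
    have "B \<ge> 0" unfolding B_def using shell_const_nonneg[OF q(1)] a by (intro mult_nonneg_nonneg suminf_nonneg) auto
    have B: "B = C * M powr (?n / p)" unfolding B_def C_def by simp
    have "(\<integral>\<^sup>+y. indicator D y * ennreal (\<bar>g y\<bar> powr p) \<partial>lborel) \<le> ennreal (B powr p)"
      unfolding D_def g_def B_def
    proof (rule H.degree_Lp_bound[OF p(1) q_def q(1)])
      fix K
      have "(\<Sum>k<K. real (covering_number (H.rad k) (frontier U)) * H.osc (H.rad k) powr (?n - ?n / q))
        = (\<Sum>k<K. M powr (?n / p) * a k)"
        unfolding q(2) H.osc_def H.rad_def a_def using M n R(1) by (intro sum.cong refl) (simp add: powr_mult powr_powr)
      also have "\<dots> = M powr (?n / p) * (\<Sum>k<K. a k)" by (simp add: sum_distrib_left)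
      also have "\<dots> \<le> M powr (?n / p) * suminf a" using a by (intro mult_left_mono sum_le_suminf) auto
      finally show "(\<Sum>k<K. real (covering_number (H.rad k) (frontier U)) * H.osc (H.rad k) powr (?n - ?n / q)) \<le> M powr (?n / p) * suminf a" .
    qed
    moreover have "(\<integral>\<^sup>+y. ennreal (\<bar>g y\<bar> powr p) \<partial>lebesgue_on D) = (\<integral>\<^sup>+y. indicator D y * ennreal (\<bar>g y\<bar> powr p) \<partial>lborel)"
      using Dl by (subst nn_integral_restrict_space) (simp_all add: nn_integral_completion mult.commute)
    ultimately have le: "(\<integral>\<^sup>+y. ennreal (\<bar>g y\<bar> powr p) \<partial>lebesgue_on D) \<le> ennreal (B powr p)" by simp
    then have fin: "(\<integral>\<^sup>+y. ennreal (\<bar>g y\<bar> powr p) \<partial>lebesgue_on D) < \<infinity>" by (simp add: order_le_less_trans)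
    have int: "integrable (lebesgue_on D) (\<lambda>y. \<bar>g y\<bar> powr p)"
      by (rule integrableI_nonneg[OF meas[of "\<lambda>t. \<bar>t\<bar> powr p"] _ fin]) simp
    have "ennreal (LINT y|lebesgue_on D. \<bar>g y\<bar> powr p) \<le> ennreal (B powr p)"
      using nn_integral_eq_integral[OF int] le by simp
    then have "(LINT y|lebesgue_on D. \<bar>g y\<bar> powr p) \<le> B powr p" by (simp add: ennreal_le_iff)
    then have "(LINT y|lebesgue_on D. \<bar>g y\<bar> powr p) powr (1 / p) \<le> (B powr p) powr (1 / p)"
      using p by (intro powr_mono2) auto
    also have "\<dots> = B" using \<open>B \<ge> 0\<close> p by (simp add: powr_powr)
    finally have "Lp_norm p D g \<le> C * M powr (?n / p)" unfolding Lp_norm_def B .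
    moreover have "in_Lp p D g" unfolding in_Lp_def using null meas[of "\<lambda>t. t"] int by simp
    ultimately show ?thesis unfolding D_def g_def by blast
  qed
  then show ?thesis by blast
qed

lemma in_Lp_1_of_in_Lp:
  assumes "in_Lp p D f" "p \<ge> 1" "\<And>y. norm y > B \<Longrightarrow> f y = 0"
  shows "in_Lp 1 D f"
proof -
  have D: "D \<in> sets lebesgue"
  proof -
    have "- D \<in> sets lebesgue" using assms(1) unfolding in_Lp_def by (blast dest: null_setsD2)
    from sets.compl_sets[OF this] show ?thesis by (simp add: Compl_eq_Diff_UNIV[symmetric])
  qed
  have meas: "f \<in> borel_measurable (lebesgue_on D)" and int: "integrable (lebesgue_on D) (\<lambda>x. \<bar>f x\<bar> powr p)"
    using assms(1) unfolding in_Lp_def by auto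
  have "integrable (lebesgue_on D) (\<lambda>x. \<bar>f x\<bar> powr 1)"
  proof (rule Bochner_Integration.integrable_bound)
    have "cball 0 B \<inter> D \<in> lmeasurable"
      using D by (intro bounded_set_imp_lmeasurable) (auto intro: bounded_subset[OF bounded_cball])
    then have "integrable (lebesgue_on D) (indicator (cball 0 B) :: _ \<Rightarrow> real)"
      using D by (subst integrable_restrict_space) (auto simp: indicator_inter_arith[symmetric] Int_commute fmeasurable_def)
    then show "integrable (lebesgue_on D) (\<lambda>x. indicator (cball 0 B) x + \<bar>f x\<bar> powr p)"
      using int by (rule Bochner_Integration.integrable_add)
    show "(\<lambda>x. \<bar>f x\<bar> powr 1) \<in> borel_measurable (lebesgue_on D)" using meas by simp
    show "AE x in lebesgue_on D. norm (\<bar>f x\<bar> powr 1) \<le> norm (indicator (cball 0 B) x + \<bar>f x\<bar> powr p)"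
    proof (rule AE_I2)
      fix x
      show "norm (\<bar>f x\<bar> powr 1) \<le> norm (indicator (cball 0 B) x + \<bar>f x\<bar> powr p)"
      proof (cases "norm x > B")
        case True
        then show ?thesis using assms(3) by simp
      next
        case False
        have "\<bar>f x\<bar> \<le> 1 + \<bar>f x\<bar> powr p"
        proof (cases "\<bar>f x\<bar> \<le> 1")
          case f: False
          then have "\<bar>f x\<bar> powr 1 \<le> \<bar>f x\<bar> powr p" using assms(2) by (intro powr_mono) auto
          then show ?thesis by simp
        qed (simp add: add_increasing2)
        then show ?thesis using False by (simp add: indicator_def)
      qed
    qed
  qed
  then show ?thesis using assms(1) unfolding in_Lp_def by auto
qed

theorem theorem1p1:
  fixes U :: "(real ^ 'n) set" and \<alpha> d :: real
  assumes "0 < \<alpha>" and "\<alpha> < 1"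
    and "real CARD('n) - 1 < d" and "d < real CARD('n)"
    and "real CARD('n) * \<alpha> > d"
    and "open U" and "bounded U"
    and "has_box_dim (frontier U) d"
  shows "(\<forall>u :: real ^ 'n \<Rightarrow> real ^ 'n. u \<in> holder_space \<alpha> U \<longrightarrow>
           (\<forall>p. 1 \<le> p \<and> p < real CARD('n) * \<alpha> / d \<longrightarrow>
              in_Lp p (- (cont_ext U u ` frontier U)) (brouwer_degree (cont_ext U u) U)))
       \<and> (\<forall>p. 1 < p \<and> p < real CARD('n) * \<alpha> / d \<longrightarrow>
           (\<exists>C. \<forall>u :: real ^ 'n \<Rightarrow> real ^ 'n. u \<in> holder_space \<alpha> U \<longrightarrow>
              Lp_norm p (- (cont_ext U u ` frontier U)) (brouwer_degree (cont_ext U u) U)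
                \<le> C * enn2real (holder_norm \<alpha> U u) powr (real CARD('n) / p)))"
proof -
  let ?n = "real CARD('n)"
  have n: "?n \<ge> 1" by (rule real_card_ge_1)
  have d0: "d > 0" using assms(3) n by linarith
  have ext: "norm (cont_ext U u x - cont_ext U u y) \<le> M * dist x y powr \<alpha>"
    if u: "u \<in> holder_space \<alpha> U" and M: "M > enn2real (holder_norm \<alpha> U u)" and xy: "x \<in> closure U" "y \<in> closure U"
    for u :: "real ^ 'n \<Rightarrow> real ^ 'n" and M x y
  proof (rule cont_ext_holder[OF assms(1) _ _ xy])
    show "M > 0" using M by (rule order_le_less_trans[OF enn2real_nonneg])
    fix x y assume "x \<in> U" "y \<in> U"
    then have "norm (u x - u y) \<le> enn2real (holder_norm \<alpha> U u) * dist x y powr \<alpha>" by (rule holder_space_bound[OF u])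
    also have "\<dots> \<le> M * dist x y powr \<alpha>" using M by (intro mult_right_mono) auto
    finally show "norm (u x - u y) \<le> M * dist x y powr \<alpha>" .
  qed
  have gt1: "in_Lp p (- (cont_ext U u ` frontier U)) (brouwer_degree (cont_ext U u) U)"
    if p: "1 < p" "p < ?n * \<alpha> / d" and u: "u \<in> holder_space \<alpha> U" for p and u :: "real ^ 'n \<Rightarrow> real ^ 'n"
  proof -
    define M where "M = enn2real (holder_norm \<alpha> U u) + 1"
    have M: "M > enn2real (holder_norm \<alpha> U u)" "M > 0" unfolding M_def by (auto intro: add_nonneg_pos)
    obtain C where C: "\<forall>u M. M > 0 \<longrightarrow>
      (\<forall>x\<in>closure U. \<forall>y\<in>closure U. norm (u x - u y) \<le> M * dist x y powr \<alpha>) \<longrightarrow>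
      in_Lp p (- (u ` frontier U)) (brouwer_degree u U) \<and>
      Lp_norm p (- (u ` frontier U)) (brouwer_degree u U) \<le> C * M powr (?n / p)"
      using degree_in_Lp[OF assms(1) less_imp_le[OF assms(2)] assms(3,5,6,7,8) p] by blast
    have "\<forall>x\<in>closure U. \<forall>y\<in>closure U. norm (cont_ext U u x - cont_ext U u y) \<le> M * dist x y powr \<alpha>"
      using ext[OF u M(1)] by blast
    then show ?thesis using C M(2) by blast
  qed
  show ?thesis
  proof (intro conjI allI impI)
    fix u :: "real ^ 'n \<Rightarrow> real ^ 'n" and p
    assume u: "u \<in> holder_space \<alpha> U" and p: "1 \<le> p \<and> p < ?n * \<alpha> / d"
    show "in_Lp p (- (cont_ext U u ` frontier U)) (brouwer_degree (cont_ext U u) U)"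
    proof (cases "p = 1")
      case False
      then show ?thesis using gt1 u p by simp
    next
      case True
      obtain p' where p': "1 < p'" "p' < ?n * \<alpha> / d" using dense[of 1 "?n * \<alpha> / d"] True p by auto
      define M where "M = enn2real (holder_norm \<alpha> U u) + 1"
      have M: "M > enn2real (holder_norm \<alpha> U u)" "M > 0" unfolding M_def by (auto intro: add_nonneg_pos)
      obtain R where R: "R > 0" "\<And>x. \<not> cube_in U x R" using no_large_cube[OF assms(7)] by blast
      have "U \<noteq> {}" using has_box_dim_frontier_nonempty[OF assms(8)] d0 by simp
      then interpret H: holder_data U "cont_ext U u" M \<alpha> R
        using assms(1,2,6,7) M(2) ext[OF u M(1)] R by unfold_locales auto
      interpret degree_data U "cont_ext U u" using assms(6,7) H.cont_u by unfold_locales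
      obtain B where B: "\<And>y. norm y > B \<Longrightarrow> brouwer_degree (cont_ext U u) U y = 0"
        using brouwer_degree_bounded_support by blast
      show ?thesis unfolding True
        by (rule in_Lp_1_of_in_Lp[OF gt1[OF p' u] less_imp_le[OF p'(1)] B])
    qed
  next
    fix p assume p: "1 < p \<and> p < ?n * \<alpha> / d"
    obtain C where C: "\<forall>u M. M > 0 \<longrightarrow>
      (\<forall>x\<in>closure U. \<forall>y\<in>closure U. norm (u x - u y) \<le> M * dist x y powr \<alpha>) \<longrightarrow>
      in_Lp p (- (u ` frontier U)) (brouwer_degree u U) \<and>
      Lp_norm p (- (u ` frontier U)) (brouwer_degree u U) \<le> C * M powr (?n / p)"
      using degree_in_Lp[OF assms(1) less_imp_le[OF assms(2)] assms(3,5,6,7,8) conjunct1[OF p] conjunct2[OF p]] by blast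
    show "\<exists>C. \<forall>u :: real ^ 'n \<Rightarrow> real ^ 'n. u \<in> holder_space \<alpha> U \<longrightarrow>
       Lp_norm p (- (cont_ext U u ` frontier U)) (brouwer_degree (cont_ext U u) U) \<le> C * enn2real (holder_norm \<alpha> U u) powr (?n / p)"
    proof (intro exI[of _ C] allI impI)
      fix u :: "real ^ 'n \<Rightarrow> real ^ 'n" assume u: "u \<in> holder_space \<alpha> U"
      define h where "h = enn2real (holder_norm \<alpha> U u)"
      have h: "h \<ge> 0" unfolding h_def by simp
      have "((\<lambda>M. C * M powr (?n / p)) \<longlongrightarrow> C * h powr (?n / p)) (at_right h)"
      proof (intro tendsto_mult tendsto_const tendsto_powr')
        show "((\<lambda>M. M) \<longlongrightarrow> h) (at_right h)" by (rule tendsto_ident_at)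
        have "eventually (\<lambda>M. h < M) (at_right h)" by (rule eventually_at_right_less)
        then have "eventually (\<lambda>M. 0 \<le> M) (at_right h)" by eventually_elim (use h in linarith)
        then show "h \<noteq> 0 \<or> 0 < ?n / p \<and> eventually (\<lambda>M. 0 \<le> M) (at_right h)" using p n by auto
      qed
      then show "Lp_norm p (- (cont_ext U u ` frontier U)) (brouwer_degree (cont_ext U u) U) \<le> C * enn2real (holder_norm \<alpha> U u) powr (?n / p)"
        unfolding h_def[symmetric]
      proof (rule tendsto_lowerbound)
        have "eventually (\<lambda>M. h < M) (at_right h)" by (rule eventually_at_right_less)
        then show "eventually (\<lambda>M. Lp_norm p (- (cont_ext U u ` frontier U)) (brouwer_degree (cont_ext U u) U) \<le> C * M powr (?n / p)) (at_right h)"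
        proof eventually_elim
          fix M assume M: "h < M"
          have "M > 0" using h M by linarith
          moreover have "\<forall>x\<in>closure U. \<forall>y\<in>closure U. norm (cont_ext U u x - cont_ext U u y) \<le> M * dist x y powr \<alpha>"
            using ext[OF u M[unfolded h_def]] by blast
          ultimately show "Lp_norm p (- (cont_ext U u ` frontier U)) (brouwer_degree (cont_ext U u) U) \<le> C * M powr (?n / p)" using C by blast
        qed
      qed (rule trivial_limit_at_right_real)
    qed
  qed
qed

end
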